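(* Let $n\ge2$ and $I=\{0,1,\dots,n\}$. Equip the variety $\mathcal V_1=\{V_1(x)\mid x=(x_2,\dots,x_{2n-1})\in(\mathbb C^\times)^{2n-2}\}$ with the $\mathfrak g_0$-geometric crystal data $e_i^c,\gamma_i,\varepsilon_i$ ($1\le i\le n$) described in the context, and define $$e_0^c(V_1(x)):=\overline\sigma^{-1}\circ\overline e_0^c\circ\overline\sigma(V_1(x)),\quad \gamma_0(V_1(x)):=\overline\gamma_0(\overline\sigma(V_1(x))),\quad \varepsilon_0(V_1(x)):=\overline\varepsilon_0(\overline\sigma(V_1(x))).$$ Then $\mathcal V(A_n^{(1)}):=(\mathcal V_1,\{e_i\}_{i\in I},\{\gamma_i\}_{i\in I},\{\varepsilon_i\}_{i\in I})$ is a positive affine (i.e. $A_n^{(1)}$-) geometric crystal (with positive structure $\theta:(\mathbb C^\times)^{2n-2}\to\mathcal V_1$, $x\mapsto V_1(x)$). Its explicit form is as follows, with the convention $x_1=x_{2n}=1$. For $i=1,\dots,n$: $$e_i^c(V_1(x))=\begin{cases}V_1(x_2,\dots,cx_{n+1},\dots,x_{2n-1}),& i=1,\\ V_1(x_2,\dots,c_ix_i,\dots,\tfrac{c}{c_i}x_{n+i},\dots,x_{2n-1}),&2\le i\le n-1,\\ V_1(x_2,\dots,cx_n,\dots,x_{2n-1}),&i=n,\end{cases}\qquad c_i=\frac{c(x_ix_{n+i}+x_{i+1}x_{n+i-1})}{cx_ix_{n+i}+x_{i+1}x_{n+i-1}},$$ $$\gamma_i(V_1(x))=\begin{cases}\dfrac{x_{n+1}^2}{x_2x_{n+2}},&i=1,\\[2mm]\dfrac{x_i^2x_{n+i}^2}{x_{i-1}x_{i+1}x_{n+i-1}x_{n+i+1}},&2\le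 i\le n-1,\\[2mm]\dfrac{x_n^2}{x_{n-1}x_{2n-1}},&i=n,\end{cases}\qquad \varepsilon_i(V_1(x))=\begin{cases}\dfrac{x_{n+2}}{x_{n+1}},&i=1,\\[2mm]\dfrac{x_{n+i+1}}{x_{n+i}}+\dfrac{x_{i+1}x_{n+i-1}x_{n+i+1}}{x_ix_{n+i}^2},&2\le i\le n-2,\\[2mm]\dfrac1{x_{2n-1}}+\dfrac{x_nx_{2n-2}}{x_{n-1}x_{2n-1}^2},&i=n-1\ (n\ge3),\\[2mm]\dfrac{x_{2n-1}}{x_n},&i=n.\end{cases}$$ For $i=0$: $$\gamma_0(V_1(x))=\frac1{x_nx_{n+1}},\qquad \varepsilon_0(V_1(x))=x_{n+1}\Big(\frac{x_2}{x_{n+1}}+\frac{x_3}{x_{n+2}}+\cdots+\frac{x_n}{x_{2n-1}}\Big),$$ and $e_0^c(V_1(x))=V_1(x_2',\dots,x_{2n-1}')$ with $$x_k'=x_k\cdot\frac{\frac{x_2}{x_{n+1}}+\frac{x_3}{x_{n+2}}+\cdots+\frac{x_n}{x_{2n-1}}}{c\big(\frac{x_2}{x_{n+1}}+\cdots+\frac{x_k}{x_{n+k-1}}\big)+\big(\frac{x_{k+1}}{x_{n+k}}+\cdots+\frac{x_n}{x_{2n-1}}\big)}\quad(2\le k<n),$$ $$x_n'=\frac{x_n}{c},\qquad x_{n+1}'=\frac{x_{n+1}}c,$$ $$x_{n+l}'=x_{n+l}\cdot\frac{c\big(\frac{x_2}{x_{n+1}}+\cdots+\frac{x_l}{x_{n+l-1}}\big)+\big(\frac{x_{l+1}}{x_{n+l}}+\cdots+\frac{x_n}{x_{2n-1}}\big)}{c\big(\frac{x_2}{x_{n+1}}+\frac{x_3}{x_{n+2}}+\cdots+\frac{x_n}{x_{2n-1}}\big)}\quad(2\le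 l<n).$$
   Context: **Cartan matrix.** $a_{ii}=2$; $a_{ij}=-1$ if $i\equiv j\pm1\pmod{n+1}$; $a_{ij}=0$ otherwise ($i,j\in I=\{0,\dots,n\}$, $n\ge2$, type $A_n^{(1)}$). $\mathfrak g_0$ and $\mathfrak g_n$ denote the subalgebras of type $A_n$ with index sets $I\setminus\{0\}$ and $I\setminus\{n\}$. **Geometric crystal.** An $A_n^{(1)}$-geometric crystal is a quadruple $(X,\{e_i\}_{i\in I},\{\gamma_i\}_{i\in I},\{\varepsilon_i\}_{i\in I})$, where $X$ is an (ind-)variety, $e_i:\mathbb C^\times\times X\to X$, $(c,x)\mapsto e_i^c(x)$, are rational $\mathbb C^\times$-actions, and $\gamma_i,\varepsilon_i:X\to\mathbb C$ are rational functions such that: - (i) $\{1\}\times X\subset \mathrm{dom}(e_i)$ for all $i\in I$; - (ii) $\gamma_j(e_i^c(x))=c^{a_{ij}}\gamma_j(x)$; - (iii) $e_i^{c_1}e_j^{c_2}=e_j^{c_2}e_i^{c_1}$ if $a_{ij}=a_{ji}=0$, and $e_i^{c_1}e_j^{c_1c_2}e_i^{c_2}=e_j^{c_2}e_i^{c_1c_2}e_j^{c_1}$ if $a_{ij}=a_{ji}=-1$; - (iv) $\varepsilon_i(e_i^c(x))=c^{-1}\varepsilon_i(x)$, and $\varepsilon_i(e_j^c(x))=\varepsilon_i(x)$ if $a_{ij}=a_{ji}=0$. For a subset of indices the same definition with $I$ replaced by the subset gives $\mathfrak g_0$- and $\mathfrak g_n$-geometric crystals. **Positivity.** A nonzero rational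 function on an algebraic torus is positive if it can be written $g/h$ with $g,h$ positive linear combinations of characters; a rational morphism of tori is positive if its composite with every character of the target is positive. A positive structure on a geometric crystal is a birational isomorphism $\theta:T'\to X$ from an algebraic torus such that all $\gamma_i\circ\theta$, $\varepsilon_i\circ\theta$ and all $(c,t)\mapsto\theta^{-1}\circ e_i^c\circ\theta(t)$ are positive. A geometric crystal with a positive structure is called positive. **The module.** $W(\varpi_2)$ is the complex vector space with basis $\{(i,j)\mid1\le i<j\le n+1\}$. For $1\le k\le n$: $f_k(i,j)=(i+1,j)$ if $i=k<j-1$; $f_k(i,j)=(i,j+1)$ if $j=k$; $0$ otherwise. Also $f_0(i,n+1)=(1,i)$ if $i\ne1$, and $f_0(i,j)=0$ otherwise. The weight of $(i,j)$ is $\Lambda_i-\Lambda_{i-1}+\Lambda_j-\Lambda_{j-1}$ with $\Lambda_{n+1}=\Lambda_0$, and $\alpha_k^\vee(c)$ ($c\in\mathbb C^\times$) acts on $(i,j)$ by $c^{\langle \mathrm{wt}(i,j),\alpha_k^\vee\rangle}$, where $\langle\Lambda_i,\alpha_k^\vee\rangle=\delta_{ik}$. Put $Y_k(c)=(1+\frac{f_k}{c})\alpha_k^\vee(c)$ and $$V_1(x)=Y_{n-1}(x_{2n-1})\cdots Y_1(x_{n+1})\,Y_n(x_n)\cdots Y_2(x_2)\,(1,2),$$ $$V_2(y)=Y_{n-2}(y_{2n-2})\cdots Y_0(y_n)\,Y_{n-1}(y_{n-1})\cdots Y_1(y_1)\,(1,n+1),$$ $\mathcal V_1=\{V_1(x)\mid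 x_i\in\mathbb C^\times\}$, $\mathcal V_2=\{V_2(y)\mid y=(y_1,\dots,y_{2n-2}),\,y_i\in\mathbb C^\times\}$. **Data for the finite-type subalgebras.** For a word $(i_1,\dots,i_k)$ with parameters $(c_1,\dots,c_k)$ set, for $m$ with $i_m=i$, $A_m=\big(c_1^{a_{i_1,i}}\cdots c_{m-1}^{a_{i_{m-1},i}}c_m\big)^{-1}$. Define $\varepsilon_i=\sum_{m:\,i_m=i}A_m$, $\gamma_i=c_1^{a_{i_1,i}}\cdots c_k^{a_{i_k,i}}$, and $e_i^c:(c_1,\dots,c_k)\mapsto(\mathcal C_1,\dots,\mathcal C_k)$ with $$\mathcal C_j=c_j\cdot\frac{\sum_{m\le j,\,i_m=i}cA_m+\sum_{m>j,\,i_m=i}A_m}{\sum_{m<j,\,i_m=i}cA_m+\sum_{m\ge j,\,i_m=i}A_m}.$$ Applied to the word $(n-1,\dots,1,n,\dots,2)$ with parameters $(x_{2n-1},\dots,x_{n+1},x_n,\dots,x_2)$ this gives the $\mathfrak g_0$-geometric crystal data $e_i^c,\gamma_i,\varepsilon_i$ ($1\le i\le n$) on $\mathcal V_1$; applied to $(n-2,\dots,0,n-1,\dots,1)$ with parameters $(y_{2n-2},\dots,y_n,y_{n-1},\dots,y_1)$ it gives the $\mathfrak g_n$-geometric crystal data $\overline e_i^c,\overline\gamma_i,\overline\varepsilon_i$ ($0\le i\le n-1$) on $\mathcal V_2$. In particular $\overline e_0^c$ replaces $y_n$ by $cy_n$, $\overline\gamma_0(V_2(y))=\frac{y_n^2}{y_1y_{n+1}}$,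 $\overline\varepsilon_0(V_2(y))=\frac{y_{n+1}}{y_n}$ (with $y_{2n-1}:=1$). **The map $\overline\sigma$.** $\overline\sigma:\mathcal V_1\to\mathcal V_2$ is the birational isomorphism $V_1(x)\mapsto V_2(y)$ with $$y_1=\Big(\sum_{j=2}^n\tfrac{x_j}{x_{n+j-1}}\Big)^{-1},\quad y_k=x_k\Big(\sum_{j=k+1}^n\tfrac{x_j}{x_{n+j-1}}\Big)^{-1}(2\le k\le n-1),\quad y_n=\tfrac1{x_n},\quad y_{n+l}=\tfrac{x_{n+l}}{x_n}\sum_{j=l+1}^n\tfrac{x_j}{x_{n+j-1}}\ (1\le l\le n-2).$$
   Formalization: Axiom (i), {1}×X ⊂ dom(e_i), fails for n≥3 (c_i is indeterminate at c=1, x_i x_{n+i}+x_{i+1}x_{n+i-1}=0); it is replaced by: ({1}×X)∩dom(e_i) is open and dense in {1}×X, and e_i^1 extends to all of X. *)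

theory Defs
  imports "HOL-Analysis.Analysis"
begin

section \<open>Quasi-affine varieties over the complex numbers\<close>

text \<open>For a finite index set \<open>J\<close>, affine space consists of the functions \<open>'j \<Rightarrow> complex\<close> vanishing
  outside \<open>J\<close>. Polynomials are represented by the functions they induce.\<close>

definition aff_space :: "'j set \<Rightarrow> ('j \<Rightarrow> complex) set" where
  "aff_space J = {p. \<forall>j. j \<notin> J \<longrightarrow> p j = 0}"

inductive_set poly_funs :: "'j set \<Rightarrow> (('j \<Rightarrow> complex) \<Rightarrow> complex) set" for J where
  const: "(\<lambda>_. a) \<in> poly_funs J"
| coord: "j \<in> J \<Longrightarrow> (\<lambda>p. p j) \<in> poly_funs J"
| add: "f \<in> poly_funs J \<Longrightarrow> g \<in> poly_funs J \<Longrightarrow> (\<lambda>p. f p + g p) \<in> poly_funs J"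
| mult: "f \<in> poly_funs J \<Longrightarrow> g \<in> poly_funs J \<Longrightarrow> (\<lambda>p. f p * g p) \<in> poly_funs J"

definition zariski_open :: "'j set \<Rightarrow> ('j \<Rightarrow> complex) set \<Rightarrow> bool" where
  "zariski_open J U \<longleftrightarrow> (\<exists>S \<subseteq> poly_funs J. U = {p \<in> aff_space J. \<exists>f\<in>S. f p \<noteq> 0})"

definition zariski :: "'j set \<Rightarrow> ('j \<Rightarrow> complex) topology" where
  "zariski J = topology (zariski_open J)"

lemma istopology_zariski_open: "istopology (zariski_open J)"
  unfolding istopology_def
proof (intro conjI allI impI)
  fix U V assume "zariski_open J U" "zariski_open J V"
  then obtain S T where S: "S \<subseteq> poly_funs J" "U = {p \<in> aff_space J. \<exists>f\<in>S. f p \<noteq> 0}"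
    and T: "T \<subseteq> poly_funs J" "V = {p \<in> aff_space J. \<exists>f\<in>T. f p \<noteq> 0}"
    unfolding zariski_open_def by blast
  define R where "R = (\<lambda>(f, g) p. f p * g p) ` (S \<times> T)"
  have "R \<subseteq> poly_funs J"
    using S(1) T(1) unfolding R_def by (auto intro!: poly_funs.mult)
  moreover have "U \<inter> V = {p \<in> aff_space J. \<exists>f\<in>R. f p \<noteq> 0}"
    unfolding S(2) T(2) R_def by auto
  ultimately show "zariski_open J (U \<inter> V)"
    unfolding zariski_open_def by blast
next
  fix K assume K: "\<forall>U\<in>K. zariski_open J U"
  define R where "R = {f \<in> poly_funs J. {p \<in> aff_space J. f p \<noteq> 0} \<subseteq> \<Union>K}"
  have "\<Union>K = {p \<in> aff_space J. \<exists>f\<in>R. f p \<noteq> 0}"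
  proof (intro equalityI subsetI)
    fix p assume "p \<in> \<Union>K"
    then obtain U where U: "U \<in> K" "p \<in> U" by blast
    then obtain S where S: "S \<subseteq> poly_funs J" "U = {p \<in> aff_space J. \<exists>f\<in>S. f p \<noteq> 0}"
      using K unfolding zariski_open_def by blast
    then obtain f where f: "f \<in> S" "f p \<noteq> 0" "p \<in> aff_space J" using U by blast
    then have "f \<in> R" using S U(1) unfolding R_def by blast
    then show "p \<in> {p \<in> aff_space J. \<exists>f\<in>R. f p \<noteq> 0}" using f by blast
  qed (auto simp: R_def)
  moreover have "R \<subseteq> poly_funs J" unfolding R_def by blast
  ultimately show "zariski_open J (\<Union>K)"
    unfolding zariski_open_def by blast
qed

lemma openin_zariski: "openin (zariski J) U \<longleftrightarrow> zariski_open J U"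
  by (simp add: zariski_def istopology_zariski_open)

definition irreducible_space :: "'a topology \<Rightarrow> bool" where
  "irreducible_space T \<longleftrightarrow> topspace T \<noteq> {} \<and>
     (\<forall>A B. closedin T A \<longrightarrow> closedin T B \<longrightarrow> topspace T \<subseteq> A \<union> B \<longrightarrow>
        topspace T \<subseteq> A \<or> topspace T \<subseteq> B)"

text \<open>Irreducible quasi-affine varieties: irreducible locally closed subsets of affine space.\<close>

definition variety :: "'j set \<Rightarrow> ('j \<Rightarrow> complex) set \<Rightarrow> bool" where
  "variety J X \<longleftrightarrow> finite J \<and>
     (\<exists>U C. openin (zariski J) U \<and> closedin (zariski J) C \<and> X = U \<inter> C) \<and>
     irreducible_space (subtopology (zariski J) X)"

definition torus :: "'j set \<Rightarrow> ('j \<Rightarrow> complex) set" where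
  "torus J = {t \<in> aff_space J. \<forall>j\<in>J. t j \<noteq> 0}"

section \<open>Rational functions and rational maps\<close>

definition regular_on :: "'j set \<Rightarrow> ('j \<Rightarrow> complex) set \<Rightarrow> (('j \<Rightarrow> complex) \<Rightarrow> complex) \<Rightarrow> bool" where
  "regular_on J U f \<longleftrightarrow>
     (\<forall>p\<in>U. \<exists>N g h. openin (subtopology (zariski J) U) N \<and> p \<in> N \<and>
        g \<in> poly_funs J \<and> h \<in> poly_funs J \<and> (\<forall>q\<in>N. h q \<noteq> 0 \<and> f q = g q / h q))"

text \<open>A rational function or map on \<open>X\<close> is represented by a partial function that is defined and
  regular on a nonempty open subset of \<open>X\<close>, not necessarily the largest possible one. Two
  representatives denote the same rational map iff they are related by \<open>rat_eq\<close>; the largest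
  domain of definition is \<open>rat_dom\<close>. Composition of representatives is \<open>\<circ>\<^sub>m\<close>.\<close>

definition rational_function ::
    "'j set \<Rightarrow> ('j \<Rightarrow> complex) set \<Rightarrow> (('j \<Rightarrow> complex) \<rightharpoonup> complex) \<Rightarrow> bool" where
  "rational_function J X f \<longleftrightarrow>
     openin (subtopology (zariski J) X) (dom f) \<and> dom f \<noteq> {} \<and>
     regular_on J (dom f) (\<lambda>p. the (f p))"

definition rational_map ::
    "'j set \<Rightarrow> ('j \<Rightarrow> complex) set \<Rightarrow> 'k set \<Rightarrow> ('k \<Rightarrow> complex) set \<Rightarrow>
     (('j \<Rightarrow> complex) \<rightharpoonup> ('k \<Rightarrow> complex)) \<Rightarrow> bool" where
  "rational_map J X K Y f \<longleftrightarrow>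
     openin (subtopology (zariski J) X) (dom f) \<and> dom f \<noteq> {} \<and> ran f \<subseteq> Y \<and>
     (\<forall>k\<in>K. regular_on J (dom f) (\<lambda>p. the (f p) k))"

definition rat_eq ::
    "'j set \<Rightarrow> ('j \<Rightarrow> complex) set \<Rightarrow> (('j \<Rightarrow> complex) \<rightharpoonup> 'b) \<Rightarrow> (('j \<Rightarrow> complex) \<rightharpoonup> 'b) \<Rightarrow> bool" where
  "rat_eq J X f g \<longleftrightarrow>
     (\<exists>U. openin (subtopology (zariski J) X) U \<and> U \<noteq> {} \<and> U \<subseteq> dom f \<inter> dom g \<and>
        (\<forall>p\<in>U. f p = g p))"

definition rat_dom ::
    "'j set \<Rightarrow> ('j \<Rightarrow> complex) set \<Rightarrow> 'k set \<Rightarrow> ('k \<Rightarrow> complex) set \<Rightarrow>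
     (('j \<Rightarrow> complex) \<rightharpoonup> ('k \<Rightarrow> complex)) \<Rightarrow> ('j \<Rightarrow> complex) set" where
  "rat_dom J X K Y f = \<Union>{dom g |g. rational_map J X K Y g \<and> rat_eq J X f g}"

definition birational_inverses ::
    "'j set \<Rightarrow> ('j \<Rightarrow> complex) set \<Rightarrow> 'k set \<Rightarrow> ('k \<Rightarrow> complex) set \<Rightarrow>
     (('j \<Rightarrow> complex) \<rightharpoonup> ('k \<Rightarrow> complex)) \<Rightarrow> (('k \<Rightarrow> complex) \<rightharpoonup> ('j \<Rightarrow> complex)) \<Rightarrow> bool" where
  "birational_inverses J X K Y f g \<longleftrightarrow>
     rational_map J X K Y f \<and> rational_map K Y J X g \<and>
     rat_eq J X (g \<circ>\<^sub>m f) Some \<and> rat_eq K Y (f \<circ>\<^sub>m g) Some"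

section \<open>Rational actions and geometric crystals\<close>

text \<open>The product of the multiplicative group with \<open>X\<close>: the coordinate \<open>None\<close> is the group
  element.\<close>

definition opt_index :: "'j set \<Rightarrow> 'j option set" where
  "opt_index J = insert None (Some ` J)"

definition Gm_times :: "('j \<Rightarrow> complex) set \<Rightarrow> ('j option \<Rightarrow> complex) set" where
  "Gm_times X = {case_option c x |c x. c \<noteq> 0 \<and> x \<in> X}"

definition joint_map ::
    "(complex \<Rightarrow> ('j \<Rightarrow> complex) \<rightharpoonup> 'b) \<Rightarrow> (('j option \<Rightarrow> complex) \<rightharpoonup> 'b)" where
  "joint_map e = (\<lambda>p. e (p None) (p \<circ> Some))"

text \<open>The laws are required for every fixed group element; in particular every slice \<open>e c\<close> is
  defined on a nonempty open set.\<close>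

definition rational_Gm_action ::
    "'j set \<Rightarrow> ('j \<Rightarrow> complex) set \<Rightarrow> (complex \<Rightarrow> ('j \<Rightarrow> complex) \<rightharpoonup> ('j \<Rightarrow> complex)) \<Rightarrow> bool" where
  "rational_Gm_action J X e \<longleftrightarrow>
     rational_map (opt_index J) (Gm_times X) J X (joint_map e) \<and>
     rat_eq J X (e 1) Some \<and>
     (\<forall>c d. c \<noteq> 0 \<longrightarrow> d \<noteq> 0 \<longrightarrow> rat_eq J X (e c \<circ>\<^sub>m e d) (e (c * d)))"

text \<open>The condition on the domain is that the largest domain of definition of the action meets
  \<open>{1} \<times> X\<close> in a dense open subset of \<open>{1} \<times> X\<close>, and that the rational map \<open>e 1\<close>, the
  restriction of the action to \<open>{1} \<times> X\<close>, is defined on all of \<open>X\<close>. The stronger demand that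
  \<open>{1} \<times> X\<close> be contained in the domain of the action as a rational map of both variables already
  fails for actions such as \<open>c * (p + q) / (c * p + q)\<close>, which is indeterminate at
  \<open>c = 1\<close>, \<open>p + q = 0\<close>.\<close>

definition unit_domain_condition ::
    "'j set \<Rightarrow> ('j \<Rightarrow> complex) set \<Rightarrow> (complex \<Rightarrow> ('j \<Rightarrow> complex) \<rightharpoonup> ('j \<Rightarrow> complex)) \<Rightarrow> bool" where
  "unit_domain_condition J X e \<longleftrightarrow>
     (let Z = zariski (opt_index J); X1 = case_option 1 ` X;
          D = X1 \<inter> rat_dom (opt_index J) (Gm_times X) J X (joint_map e)
      in openin (subtopology Z X1) D \<and> X1 \<subseteq> Z closure_of D) \<and>
     X \<subseteq> rat_dom J X J X (e 1)"

definition geometric_crystal ::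
    "nat set \<Rightarrow> (nat \<Rightarrow> nat \<Rightarrow> int) \<Rightarrow> 'j set \<Rightarrow> ('j \<Rightarrow> complex) set \<Rightarrow>
     (nat \<Rightarrow> complex \<Rightarrow> ('j \<Rightarrow> complex) \<rightharpoonup> ('j \<Rightarrow> complex)) \<Rightarrow>
     (nat \<Rightarrow> ('j \<Rightarrow> complex) \<rightharpoonup> complex) \<Rightarrow> (nat \<Rightarrow> ('j \<Rightarrow> complex) \<rightharpoonup> complex) \<Rightarrow> bool" where
  "geometric_crystal I a J X e \<gamma> \<epsilon> \<longleftrightarrow>
     variety J X \<and>
     (\<forall>i\<in>I. rational_Gm_action J X (e i) \<and> rational_function J X (\<gamma> i) \<and>
        rational_function J X (\<epsilon> i)) \<and>
     (\<forall>i\<in>I. unit_domain_condition J X (e i)) \<and>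
     (\<forall>i\<in>I. \<forall>j\<in>I. \<forall>c. c \<noteq> 0 \<longrightarrow>
        rat_eq J X (\<gamma> j \<circ>\<^sub>m e i c) (\<lambda>x. map_option (\<lambda>z. c powi a i j * z) (\<gamma> j x))) \<and>
     (\<forall>i\<in>I. \<forall>j\<in>I. \<forall>c1 c2. c1 \<noteq> 0 \<longrightarrow> c2 \<noteq> 0 \<longrightarrow> a i j = 0 \<longrightarrow> a j i = 0 \<longrightarrow>
        rat_eq J X (e i c1 \<circ>\<^sub>m e j c2) (e j c2 \<circ>\<^sub>m e i c1)) \<and>
     (\<forall>i\<in>I. \<forall>j\<in>I. \<forall>c1 c2. c1 \<noteq> 0 \<longrightarrow> c2 \<noteq> 0 \<longrightarrow> a i j = -1 \<longrightarrow> a j i = -1 \<longrightarrow>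
        rat_eq J X (e i c1 \<circ>\<^sub>m e j (c1 * c2) \<circ>\<^sub>m e i c2) (e j c2 \<circ>\<^sub>m e i (c1 * c2) \<circ>\<^sub>m e j c1)) \<and>
     (\<forall>i\<in>I. \<forall>c. c \<noteq> 0 \<longrightarrow>
        rat_eq J X (\<epsilon> i \<circ>\<^sub>m e i c) (\<lambda>x. map_option (\<lambda>z. inverse c * z) (\<epsilon> i x))) \<and>
     (\<forall>i\<in>I. \<forall>j\<in>I. \<forall>c. c \<noteq> 0 \<longrightarrow> a i j = 0 \<longrightarrow> a j i = 0 \<longrightarrow>
        rat_eq J X (\<epsilon> i \<circ>\<^sub>m e j c) (\<epsilon> i))"

section \<open>Positivity\<close>

definition character :: "'j set \<Rightarrow> ('j \<Rightarrow> int) \<Rightarrow> ('j \<Rightarrow> complex) \<Rightarrow> complex" where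
  "character J m t = (\<Prod>j\<in>J. t j powi m j)"

definition positive_combination :: "'j set \<Rightarrow> (('j \<Rightarrow> complex) \<Rightarrow> complex) \<Rightarrow> bool" where
  "positive_combination J g \<longleftrightarrow>
     (\<exists>M (a :: ('j \<Rightarrow> int) \<Rightarrow> real). finite M \<and> M \<noteq> {} \<and> (\<forall>m\<in>M. a m > 0) \<and>
        g = (\<lambda>t. \<Sum>m\<in>M. of_real (a m) * character J m t))"

text \<open>The requirement that the function be nonzero is automatic: a positive combination does not
  vanish at the identity of the torus.\<close>

definition positive_function :: "'j set \<Rightarrow> (('j \<Rightarrow> complex) \<rightharpoonup> complex) \<Rightarrow> bool" where
  "positive_function J f \<longleftrightarrow>
     rational_function J (torus J) f \<and>
     (\<exists>g h. positive_combination J g \<and> positive_combination J h \<and>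
        rat_eq J (torus J) f (\<lambda>t. if h t \<noteq> 0 then Some (g t / h t) else None))"

definition positive_map ::
    "'j set \<Rightarrow> 'k set \<Rightarrow> (('j \<Rightarrow> complex) \<rightharpoonup> ('k \<Rightarrow> complex)) \<Rightarrow> bool" where
  "positive_map J K f \<longleftrightarrow>
     rational_map J (torus J) K (torus K) f \<and>
     (\<forall>m. positive_function J (\<lambda>t. map_option (character K m) (f t)))"

definition positive_structure ::
    "nat set \<Rightarrow> 'j set \<Rightarrow> ('j \<Rightarrow> complex) set \<Rightarrow>
     (nat \<Rightarrow> complex \<Rightarrow> ('j \<Rightarrow> complex) \<rightharpoonup> ('j \<Rightarrow> complex)) \<Rightarrow>
     (nat \<Rightarrow> ('j \<Rightarrow> complex) \<rightharpoonup> complex) \<Rightarrow> (nat \<Rightarrow> ('j \<Rightarrow> complex) \<rightharpoonup> complex) \<Rightarrow>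
     'k set \<Rightarrow> (('k \<Rightarrow> complex) \<rightharpoonup> ('j \<Rightarrow> complex)) \<Rightarrow> bool" where
  "positive_structure I J X e \<gamma> \<epsilon> K \<theta> \<longleftrightarrow> finite K \<and>
     (\<exists>\<theta>'. birational_inverses K (torus K) J X \<theta> \<theta>' \<and>
        (\<forall>i\<in>I. positive_function K (\<gamma> i \<circ>\<^sub>m \<theta>) \<and> positive_function K (\<epsilon> i \<circ>\<^sub>m \<theta>) \<and>
           positive_map (opt_index K) K (joint_map (\<lambda>c. \<theta>' \<circ>\<^sub>m e i c \<circ>\<^sub>m \<theta>))))"

section \<open>The Cartan matrix and the module with highest weight \<open>\<varpi>\<^sub>2\<close>\<close>

definition cartan :: "nat \<Rightarrow> nat \<Rightarrow> nat \<Rightarrow> int" where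
  "cartan n i j =
     (if i = j then 2
      else if i mod (n + 1) = (j + 1) mod (n + 1) \<or> (i + 1) mod (n + 1) = j mod (n + 1) then -1
      else 0)"

type_synonym wvec = "nat \<times> nat \<Rightarrow> complex"

definition W_basis :: "nat \<Rightarrow> (nat \<times> nat) set" where
  "W_basis n = {(i, j). 1 \<le> i \<and> i < j \<and> j \<le> n + 1}"

definition basis_vec :: "nat \<times> nat \<Rightarrow> wvec" where
  "basis_vec b = (\<lambda>b'. if b' = b then 1 else 0)"

text \<open>\<open>f_basis n k b\<close> is the basis element \<open>f\<^sub>k b\<close>, or \<open>None\<close> if \<open>f\<^sub>k b = 0\<close>.\<close>

definition f_basis :: "nat \<Rightarrow> nat \<Rightarrow> nat \<times> nat \<Rightarrow> (nat \<times> nat) option" where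
  "f_basis n k = (\<lambda>(i, j).
     if k = 0 then (if j = n + 1 \<and> i \<noteq> 1 then Some (1, i) else None)
     else if i = k \<and> k < j - 1 then Some (i + 1, j)
     else if j = k then Some (i, j + 1)
     else None)"

definition f_op :: "nat \<Rightarrow> nat \<Rightarrow> wvec \<Rightarrow> wvec" where
  "f_op n k v = (\<lambda>b. \<Sum>b'\<in>W_basis n. if f_basis n k b' = Some b then v b' else 0)"

text \<open>Weights are given by their coefficients with respect to \<open>\<Lambda>\<^sub>0, \<dots>, \<Lambda>\<^sub>n\<close>; the coefficient
  of \<open>\<Lambda>\<^sub>k\<close> is the pairing with \<open>\<alpha>\<^sub>k\<^sup>\<or>\<close>.\<close>

definition fund_weight :: "nat \<Rightarrow> nat \<Rightarrow> nat \<Rightarrow> int" where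
  "fund_weight n m k = (if k = (if m = n + 1 then 0 else m) then 1 else 0)"

definition wt :: "nat \<Rightarrow> nat \<times> nat \<Rightarrow> nat \<Rightarrow> int" where
  "wt n = (\<lambda>(i, j) k. fund_weight n i k - fund_weight n (i - 1) k
                      + fund_weight n j k - fund_weight n (j - 1) k)"

definition alpha_op :: "nat \<Rightarrow> nat \<Rightarrow> complex \<Rightarrow> wvec \<Rightarrow> wvec" where
  "alpha_op n k c v = (\<lambda>b. c powi wt n b k * v b)"

definition Y_op :: "nat \<Rightarrow> nat \<Rightarrow> complex \<Rightarrow> wvec \<Rightarrow> wvec" where
  "Y_op n k c v = (\<lambda>b. alpha_op n k c v b + f_op n k (alpha_op n k c v) b / c)"

text \<open>\<open>Y_word n [k\<^sub>1, \<dots>, k\<^sub>r] [c\<^sub>1, \<dots>, c\<^sub>r] v\<close> is \<open>Y\<^sub>k\<^sub>1(c\<^sub>1) \<cdots> Y\<^sub>k\<^sub>r(c\<^sub>r) v\<close>; the last letter acts first.\<close>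

definition Y_word :: "nat \<Rightarrow> nat list \<Rightarrow> complex list \<Rightarrow> wvec \<Rightarrow> wvec" where
  "Y_word n w cs v = foldr (\<lambda>(k, c). Y_op n k c) (zip w cs) v"

text \<open>The words \<open>(n-1,\<dots>,1,n,\<dots>,2)\<close> and \<open>(n-2,\<dots>,0,n-1,\<dots>,1)\<close>, with the subscripts
  \<open>(2n-1,\<dots>,n+1,n,\<dots>,2)\<close> and \<open>(2n-2,\<dots>,n,n-1,\<dots>,1)\<close> of their parameters. The parameters are
  points of the tori with index sets \<open>{2..2*n-1}\<close> and \<open>{1..2*n-2}\<close>.\<close>

definition word1 :: "nat \<Rightarrow> nat list" where
  "word1 n = rev [1..<n] @ rev [2..<n+1]"

definition subs1 :: "nat \<Rightarrow> nat list" where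
  "subs1 n = rev [n+1..<2*n] @ rev [2..<n+1]"

definition word2 :: "nat \<Rightarrow> nat list" where
  "word2 n = rev [0..<n-1] @ rev [1..<n]"

definition subs2 :: "nat \<Rightarrow> nat list" where
  "subs2 n = rev [n..<2*n-1] @ rev [1..<n]"

definition V1 :: "nat \<Rightarrow> (nat \<Rightarrow> complex) \<Rightarrow> wvec" where
  "V1 n x = Y_word n (word1 n) (map x (subs1 n)) (basis_vec (1, 2))"

definition V2 :: "nat \<Rightarrow> (nat \<Rightarrow> complex) \<Rightarrow> wvec" where
  "V2 n y = Y_word n (word2 n) (map y (subs2 n)) (basis_vec (1, n + 1))"

definition T1 :: "nat \<Rightarrow> (nat \<Rightarrow> complex) set" where
  "T1 n = torus {2..2*n-1}"

definition T2 :: "nat \<Rightarrow> (nat \<Rightarrow> complex) set" where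
  "T2 n = torus {1..2*n-2}"

definition \<V>1 :: "nat \<Rightarrow> wvec set" where
  "\<V>1 n = V1 n ` T1 n"

definition \<V>2 :: "nat \<Rightarrow> wvec set" where
  "\<V>2 n = V2 n ` T2 n"

section \<open>Crystal data attached to a word\<close>

text \<open>Positions in words and parameter lists are counted from 0.\<close>

definition word_A :: "(nat \<Rightarrow> nat \<Rightarrow> int) \<Rightarrow> nat list \<Rightarrow> complex list \<Rightarrow> nat \<Rightarrow> nat \<Rightarrow> complex" where
  "word_A a w cs i m = inverse ((\<Prod>l<m. (cs ! l) powi a (w ! l) i) * cs ! m)"

definition occ :: "nat list \<Rightarrow> nat \<Rightarrow> nat set" where
  "occ w i = {m. m < length w \<and> w ! m = i}"

definition word_\<epsilon> :: "(nat \<Rightarrow> nat \<Rightarrow> int) \<Rightarrow> nat list \<Rightarrow> nat \<Rightarrow> complex list \<Rightarrow> complex" where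
  "word_\<epsilon> a w i cs = (\<Sum>m\<in>occ w i. word_A a w cs i m)"

definition word_\<gamma> :: "(nat \<Rightarrow> nat \<Rightarrow> int) \<Rightarrow> nat list \<Rightarrow> nat \<Rightarrow> complex list \<Rightarrow> complex" where
  "word_\<gamma> a w i cs = (\<Prod>l<length w. (cs ! l) powi a (w ! l) i)"

definition word_num ::
    "(nat \<Rightarrow> nat \<Rightarrow> int) \<Rightarrow> nat list \<Rightarrow> nat \<Rightarrow> complex \<Rightarrow> complex list \<Rightarrow> nat \<Rightarrow> complex" where
  "word_num a w i c cs j = (\<Sum>m\<in>occ w i \<inter> {..j}. c * word_A a w cs i m)
                           + (\<Sum>m\<in>occ w i \<inter> {j<..}. word_A a w cs i m)"

definition word_den ::
    "(nat \<Rightarrow> nat \<Rightarrow> int) \<Rightarrow> nat list \<Rightarrow> nat \<Rightarrow> complex \<Rightarrow> complex list \<Rightarrow> nat \<Rightarrow> complex" where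
  "word_den a w i c cs j = (\<Sum>m\<in>occ w i \<inter> {..<j}. c * word_A a w cs i m)
                           + (\<Sum>m\<in>occ w i \<inter> {j..}. word_A a w cs i m)"

text \<open>The denominators must not vanish for the formula to make sense, and the numerators must not
  vanish for the result to have nonzero parameters.\<close>

definition word_e ::
    "(nat \<Rightarrow> nat \<Rightarrow> int) \<Rightarrow> nat list \<Rightarrow> nat \<Rightarrow> complex \<Rightarrow> complex list \<rightharpoonup> complex list" where
  "word_e a w i c cs =
     (if \<forall>j<length w. word_num a w i c cs j \<noteq> 0 \<and> word_den a w i c cs j \<noteq> 0
      then Some (map (\<lambda>j. cs ! j * (word_num a w i c cs j / word_den a w i c cs j)) [0..<length w])
      else None)"

definition tuple_of :: "nat list \<Rightarrow> complex list \<Rightarrow> (nat \<Rightarrow> complex)" where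
  "tuple_of subs cs = (\<lambda>k. case map_of (zip subs cs) k of Some z \<Rightarrow> z | None \<Rightarrow> 0)"

text \<open>Transport to \<open>\<V>1\<close> and \<open>\<V>2\<close> along the parametrisations, which are injective on the tori.\<close>

definition params1 :: "nat \<Rightarrow> wvec \<Rightarrow> (nat \<Rightarrow> complex)" where
  "params1 n = the_inv_into (T1 n) (V1 n)"

definition params2 :: "nat \<Rightarrow> wvec \<Rightarrow> (nat \<Rightarrow> complex)" where
  "params2 n = the_inv_into (T2 n) (V2 n)"

definition e1 :: "nat \<Rightarrow> nat \<Rightarrow> complex \<Rightarrow> wvec \<rightharpoonup> wvec" where
  "e1 n i c v =
     (if v \<in> \<V>1 n \<and> c \<noteq> 0
      then map_option (\<lambda>cs. V1 n (tuple_of (subs1 n) cs))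
             (word_e (cartan n) (word1 n) i c (map (params1 n v) (subs1 n)))
      else None)"

definition \<gamma>1 :: "nat \<Rightarrow> nat \<Rightarrow> wvec \<rightharpoonup> complex" where
  "\<gamma>1 n i v =
     (if v \<in> \<V>1 n then Some (word_\<gamma> (cartan n) (word1 n) i (map (params1 n v) (subs1 n))) else None)"

definition \<epsilon>1 :: "nat \<Rightarrow> nat \<Rightarrow> wvec \<rightharpoonup> complex" where
  "\<epsilon>1 n i v =
     (if v \<in> \<V>1 n then Some (word_\<epsilon> (cartan n) (word1 n) i (map (params1 n v) (subs1 n))) else None)"

definition e2 :: "nat \<Rightarrow> nat \<Rightarrow> complex \<Rightarrow> wvec \<rightharpoonup> wvec" where
  "e2 n i c v =
     (if v \<in> \<V>2 n \<and> c \<noteq> 0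
      then map_option (\<lambda>cs. V2 n (tuple_of (subs2 n) cs))
             (word_e (cartan n) (word2 n) i c (map (params2 n v) (subs2 n)))
      else None)"

definition \<gamma>2 :: "nat \<Rightarrow> nat \<Rightarrow> wvec \<rightharpoonup> complex" where
  "\<gamma>2 n i v =
     (if v \<in> \<V>2 n then Some (word_\<gamma> (cartan n) (word2 n) i (map (params2 n v) (subs2 n))) else None)"

definition \<epsilon>2 :: "nat \<Rightarrow> nat \<Rightarrow> wvec \<rightharpoonup> complex" where
  "\<epsilon>2 n i v =
     (if v \<in> \<V>2 n then Some (word_\<epsilon> (cartan n) (word2 n) i (map (params2 n v) (subs2 n))) else None)"

section \<open>The map \<open>\<sigma>\<close> and the affine crystal data\<close>

definition tail_sum :: "nat \<Rightarrow> (nat \<Rightarrow> complex) \<Rightarrow> nat \<Rightarrow> complex" where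
  "tail_sum n x k = (\<Sum>j=k+1..n. x j / x (n + j - 1))"

definition sigma_params :: "nat \<Rightarrow> (nat \<Rightarrow> complex) \<Rightarrow> (nat \<Rightarrow> complex)" where
  "sigma_params n x = (\<lambda>k.
     if k = 1 then inverse (tail_sum n x 1)
     else if 2 \<le> k \<and> k \<le> n - 1 then x k * inverse (tail_sum n x k)
     else if k = n then 1 / x n
     else if n + 1 \<le> k \<and> k \<le> 2 * n - 2 then x k / x n * tail_sum n x (k - n)
     else 0)"

definition sigma :: "nat \<Rightarrow> wvec \<rightharpoonup> wvec" where
  "sigma n v =
     (if v \<in> \<V>1 n \<and> (\<forall>k\<in>{1..n-1}. tail_sum n (params1 n v) k \<noteq> 0)
      then Some (V2 n (sigma_params n (params1 n v))) else None)"

definition partial_inv :: "('a \<rightharpoonup> 'b) \<Rightarrow> ('b \<rightharpoonup> 'a)" where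
  "partial_inv f b = (if b \<in> ran f then Some (THE a. f a = Some b) else None)"

definition aff_e :: "nat \<Rightarrow> nat \<Rightarrow> complex \<Rightarrow> wvec \<rightharpoonup> wvec" where
  "aff_e n i c = (if i = 0 then partial_inv (sigma n) \<circ>\<^sub>m e2 n 0 c \<circ>\<^sub>m sigma n else e1 n i c)"

definition aff_\<gamma> :: "nat \<Rightarrow> nat \<Rightarrow> wvec \<rightharpoonup> complex" where
  "aff_\<gamma> n i = (if i = 0 then \<gamma>2 n 0 \<circ>\<^sub>m sigma n else \<gamma>1 n i)"

definition aff_\<epsilon> :: "nat \<Rightarrow> nat \<Rightarrow> wvec \<rightharpoonup> complex" where
  "aff_\<epsilon> n i = (if i = 0 then \<epsilon>2 n 0 \<circ>\<^sub>m sigma n else \<epsilon>1 n i)"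

definition theta :: "nat \<Rightarrow> (nat \<Rightarrow> complex) \<rightharpoonup> wvec" where
  "theta n x = (if x \<in> T1 n then Some (V1 n x) else None)"

end

theory Submission
  imports Defs "HOL-Computational_Algebra.Polynomial"
begin

text \<open>
  A point of \<open>\<V>\<^sub>1\<close> is the Pluecker vector of a configuration of \<open>n + 1\<close> columns in the plane,
  indexed cyclically by \<open>0, \<dots>, n\<close> (column \<open>0\<close> plays the role of column \<open>n + 1\<close>) and normalised by
  the last minor; points of \<open>\<V>\<^sub>2\<close> are the same vectors with a different normalisation, and
  \<open>\<sigma>\<close> is the change of normalisation. In this picture all the actions, \<open>e\<^sub>0\<close> included, are given by
  one cyclically symmetric formula: \<open>e\<^sub>i\<^sup>c\<close> adds to column \<open>i\<close> the multiple of column \<open>i + 1\<close> for which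
  the minor of the columns \<open>i - 1, i\<close> gets multiplied by \<open>c\<close>. With \<open>D\<^sub>i\<close> denoting that minor (up to
  sign), \<open>\<gamma>\<^sub>i\<close> is \<open>D\<^sub>i\<^sup>2 / (D\<^sub>i\<^sub>-\<^sub>1 D\<^sub>i\<^sub>+\<^sub>1)\<close>, and \<open>\<epsilon>\<^sub>i\<close> is, up to sign, the minor of the
  columns \<open>i - 1, i + 1\<close> divided by \<open>D\<^sub>i\<close>. The weight, commutation and \<open>\<epsilon>\<close> relations are then
  immediate, and the braid relation involves only four consecutive columns, where it follows from
  the Pluecker relation.
\<close>


section \<open>Quotients of polynomial functions\<close>

text \<open>Plane configurations arise because \<open>W_basis n\<close> indexes the second exterior
  power of an (n+1)-dimensional space and \<open>Y_op n k c\<close> is the exterior square of the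
  linear map \<open>Y_col n k c\<close>. The price is a sign: index 0 stands for n+1, so passing
  from it to index 1 reverses an order. This is the source of the minus signs in
  \<open>Y_col\<close>, \<open>cyc_minor\<close> and \<open>eps_conf\<close>. The obstacle is
  partiality. An action is undefined where a denominator or a new parameter vanishes, and
  \<open>aff_e n 0\<close> also where \<open>sigma\<close> or its inverse is undefined. Domains are
  therefore computed exactly, through \<open>act_dom\<close> and \<open>generic1\<close>, and a
  rational identity is checked only where both sides are defined. Irreducibility of
  \<open>\<V>1 n\<close> makes this sufficient once both domains are open and nonempty; for
  compositions, nonemptiness comes from inverting the actions. Positivity is invisible in minors,
  since the coefficient of a shear contains \<open>c - 1\<close>. For it the actions are rewritten
  as subtraction-free formulas in the torus coordinates.\<close>

definition quot_funs :: "'j set \<Rightarrow> ('j \<Rightarrow> complex) set \<Rightarrow> (('j \<Rightarrow> complex) \<Rightarrow> complex) set" where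
  "quot_funs J U = {f. \<exists>g\<in>poly_funs J. \<exists>h\<in>poly_funs J. \<forall>p\<in>U. h p \<noteq> 0 \<and> f p = g p / h p}"

lemma quot_funsI:
  assumes "g \<in> poly_funs J" "h \<in> poly_funs J" "\<And>p. p \<in> U \<Longrightarrow> h p \<noteq> 0 \<and> f p = g p / h p"
  shows "f \<in> quot_funs J U"
  using assms unfolding quot_funs_def by blast

lemma quot_funsE:
  assumes "f \<in> quot_funs J U"
  obtains g h where "g \<in> poly_funs J" "h \<in> poly_funs J" "\<And>p. p \<in> U \<Longrightarrow> h p \<noteq> 0"
    "\<And>p. p \<in> U \<Longrightarrow> f p = g p / h p"
  using assms unfolding quot_funs_def by blast

lemma poly_funs_minus: "f \<in> poly_funs J \<Longrightarrow> (\<lambda>p. - f p) \<in> poly_funs J"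
  using poly_funs.mult[OF poly_funs.const[of "-1"], of f J] by simp

lemma quot_funs_poly: "f \<in> poly_funs J \<Longrightarrow> f \<in> quot_funs J U"
  by (rule quot_funsI[where h = "\<lambda>_. 1"]) (auto intro: poly_funs.const)

lemma quot_funs_const [simp, intro]: "(\<lambda>_. a) \<in> quot_funs J U"
  by (intro quot_funs_poly poly_funs.const)

lemma quot_funs_cong:
  "f \<in> quot_funs J U \<Longrightarrow> (\<And>p. p \<in> U \<Longrightarrow> f p = f' p) \<Longrightarrow> f' \<in> quot_funs J U"
  by (metis (no_types, lifting) quot_funsE quot_funsI)

lemma quot_funs_mono: "f \<in> quot_funs J U \<Longrightarrow> V \<subseteq> U \<Longrightarrow> f \<in> quot_funs J V"
  unfolding quot_funs_def by blast

text \<open>A coordinate outside \<open>J\<close> is constantly 0 on affine space.\<close>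

lemma quot_funs_coord: "U \<subseteq> aff_space J \<Longrightarrow> (\<lambda>p. p j) \<in> quot_funs J U"
proof (cases "j \<in> J")
  case False
  assume "U \<subseteq> aff_space J"
  then show ?thesis
    using False by (intro quot_funs_cong[OF quot_funs_const[of 0]]) (auto simp: aff_space_def)
qed (auto intro: quot_funs_poly poly_funs.coord)

lemma quot_funs_add [intro]:
  assumes "f \<in> quot_funs J U" "f' \<in> quot_funs J U"
  shows "(\<lambda>p. f p + f' p) \<in> quot_funs J U"
proof -
  obtain g h where 1: "g \<in> poly_funs J" "h \<in> poly_funs J" "\<And>p. p \<in> U \<Longrightarrow> h p \<noteq> 0"
    "\<And>p. p \<in> U \<Longrightarrow> f p = g p / h p" by (rule quot_funsE[OF assms(1)]) blast
  obtain g' h' where 2: "g' \<in> poly_funs J" "h' \<in> poly_funs J" "\<And>p. p \<in> U \<Longrightarrow> h' p \<noteq> 0"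
    "\<And>p. p \<in> U \<Longrightarrow> f' p = g' p / h' p" by (rule quot_funsE[OF assms(2)]) blast
  show ?thesis
    using 1 2 by (intro quot_funsI[where g = "\<lambda>p. g p * h' p + g' p * h p" and h = "\<lambda>p. h p * h' p"])
      (auto intro!: poly_funs.add poly_funs.mult simp: field_simps)
qed

lemma quot_funs_mult [intro]:
  assumes "f \<in> quot_funs J U" "f' \<in> quot_funs J U"
  shows "(\<lambda>p. f p * f' p) \<in> quot_funs J U"
proof -
  obtain g h where 1: "g \<in> poly_funs J" "h \<in> poly_funs J" "\<And>p. p \<in> U \<Longrightarrow> h p \<noteq> 0"
    "\<And>p. p \<in> U \<Longrightarrow> f p = g p / h p" by (rule quot_funsE[OF assms(1)]) blast
  obtain g' h' where 2: "g' \<in> poly_funs J" "h' \<in> poly_funs J" "\<And>p. p \<in> U \<Longrightarrow> h' p \<noteq> 0"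
    "\<And>p. p \<in> U \<Longrightarrow> f' p = g' p / h' p" by (rule quot_funsE[OF assms(2)]) blast
  show ?thesis
    using 1 2 by (intro quot_funsI[where g = "\<lambda>p. g p * g' p" and h = "\<lambda>p. h p * h' p"])
      (auto intro!: poly_funs.mult)
qed

lemma quot_funs_minus [intro]: "f \<in> quot_funs J U \<Longrightarrow> (\<lambda>p. - f p) \<in> quot_funs J U"
  using quot_funs_mult[OF quot_funs_const[of "-1"], of f J U] by simp

lemma quot_funs_diff [intro]:
  "f \<in> quot_funs J U \<Longrightarrow> g \<in> quot_funs J U \<Longrightarrow> (\<lambda>p. f p - g p) \<in> quot_funs J U"
  using quot_funs_add[of f J U "\<lambda>p. - g p"] by auto

lemma quot_funs_inverse:
  assumes "f \<in> quot_funs J U" "\<And>p. p \<in> U \<Longrightarrow> f p \<noteq> 0"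
  shows "(\<lambda>p. inverse (f p)) \<in> quot_funs J U"
proof -
  obtain g h where "g \<in> poly_funs J" "h \<in> poly_funs J" "\<And>p. p \<in> U \<Longrightarrow> h p \<noteq> 0"
    "\<And>p. p \<in> U \<Longrightarrow> f p = g p / h p" by (rule quot_funsE[OF assms(1)]) blast
  then show ?thesis
    using assms(2) by (intro quot_funsI[where g = h and h = g]) (force simp: field_simps)+
qed

lemma quot_funs_divide:
  assumes "f \<in> quot_funs J U" "g \<in> quot_funs J U" "\<And>p. p \<in> U \<Longrightarrow> g p \<noteq> 0"
  shows "(\<lambda>p. f p / g p) \<in> quot_funs J U"
  unfolding divide_inverse by (intro quot_funs_mult assms quot_funs_inverse)

lemma quot_funs_prod [intro]:
  "(\<And>a. a \<in> A \<Longrightarrow> f a \<in> quot_funs J U) \<Longrightarrow> (\<lambda>p. \<Prod>a\<in>A. f a p) \<in> quot_funs J U"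
  by (induction A rule: infinite_finite_induct) auto

lemma quot_funs_sum [intro]:
  "(\<And>a. a \<in> A \<Longrightarrow> f a \<in> quot_funs J U) \<Longrightarrow> (\<lambda>p. \<Sum>a\<in>A. f a p) \<in> quot_funs J U"
  by (induction A rule: infinite_finite_induct) auto

lemma quot_funs_power_int:
  assumes "f \<in> quot_funs J U" "\<And>p. p \<in> U \<Longrightarrow> f p \<noteq> 0"
  shows "(\<lambda>p. f p powi k) \<in> quot_funs J U"
proof -
  have *: "(\<lambda>p. g p ^ m) \<in> quot_funs J U" if "g \<in> quot_funs J U" for g m
    using that by (induction m) auto
  show ?thesis
  proof (cases "k \<ge> 0")
    case True
    then show ?thesis using *[OF assms(1)] by (simp add: power_int_def)
  next
    case False
    then show ?thesis using *[OF quot_funs_inverse[OF assms]] by (simp add: power_int_def)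
  qed
qed

lemma poly_funs_compose:
  assumes "f \<in> poly_funs K" "\<And>k. k \<in> K \<Longrightarrow> (\<lambda>p. \<phi> p k) \<in> quot_funs J U"
  shows "(\<lambda>p. f (\<phi> p)) \<in> quot_funs J U"
  using assms(1) by induction (auto simp: assms(2))

lemma quot_funs_compose:
  assumes "f \<in> quot_funs K V" "\<phi> ` U \<subseteq> V" "\<And>k. k \<in> K \<Longrightarrow> (\<lambda>p. \<phi> p k) \<in> quot_funs J U"
  shows "(\<lambda>p. f (\<phi> p)) \<in> quot_funs J U"
proof -
  obtain g h where *: "g \<in> poly_funs K" "h \<in> poly_funs K" "\<And>p. p \<in> V \<Longrightarrow> h p \<noteq> 0"
    "\<And>p. p \<in> V \<Longrightarrow> f p = g p / h p" by (rule quot_funsE[OF assms(1)]) blast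
  have "(\<lambda>p. g (\<phi> p) / h (\<phi> p)) \<in> quot_funs J U"
    using * assms(2) by (intro quot_funs_divide poly_funs_compose[OF _ assms(3)]) auto
  then show ?thesis
    by (rule quot_funs_cong) (use * assms(2) in auto)
qed

section \<open>Open sets and irreducibility\<close>

definition ropen :: "'j set \<Rightarrow> ('j \<Rightarrow> complex) set \<Rightarrow> ('j \<Rightarrow> complex) set \<Rightarrow> bool" where
  "ropen J X U \<longleftrightarrow> openin (subtopology (zariski J) X) U"

lemma topspace_zariski: "topspace (zariski J) = aff_space J"
proof -
  have "zariski_open J (aff_space J)"
    unfolding zariski_open_def
    by (rule exI[of _ "{\<lambda>_. 1}"]) (auto intro: poly_funs.const)
  then have "aff_space J \<subseteq> topspace (zariski J)"
    by (metis openin_zariski openin_subset)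
  moreover have "topspace (zariski J) \<subseteq> aff_space J"
    using openin_topspace[of "zariski J"] unfolding openin_zariski zariski_open_def by auto
  ultimately show ?thesis by blast
qed

lemma ropen_iff:
  assumes "X \<subseteq> aff_space J"
  shows "ropen J X U \<longleftrightarrow> (\<exists>S\<subseteq>poly_funs J. U = {p \<in> X. \<exists>f\<in>S. f p \<noteq> 0})"
proof -
  have "ropen J X U \<longleftrightarrow> (\<exists>S\<subseteq>poly_funs J. U = {p \<in> aff_space J. \<exists>f\<in>S. f p \<noteq> 0} \<inter> X)"
    unfolding ropen_def openin_subtopology openin_zariski zariski_open_def by blast
  also have "\<dots> \<longleftrightarrow> (\<exists>S\<subseteq>poly_funs J. U = {p \<in> X. \<exists>f\<in>S. f p \<noteq> 0})"
    using assms by (intro ex_cong1 conj_cong refl) blast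
  finally show ?thesis .
qed

lemma ropen_subset: "ropen J X U \<Longrightarrow> U \<subseteq> X"
  unfolding ropen_def using openin_subset by fastforce

lemma ropen_Int: "ropen J X U \<Longrightarrow> ropen J X V \<Longrightarrow> ropen J X (U \<inter> V)"
  unfolding ropen_def by (rule openin_Int)

lemma ropen_self: "X \<subseteq> aff_space J \<Longrightarrow> ropen J X X"
  by (subst ropen_iff) (auto intro!: exI[of _ "{\<lambda>_. 1}"] poly_funs.const)

lemma ropen_trans: "ropen J X U \<Longrightarrow> ropen J U V \<Longrightarrow> ropen J X V"
  unfolding ropen_def openin_subtopology
  by (metis Int_assoc openin_Int)

lemma ropen_Ball:
  "finite A \<Longrightarrow> ropen J X X \<Longrightarrow> (\<And>a. a \<in> A \<Longrightarrow> ropen J X {p \<in> X. P a p}) \<Longrightarrow> ropen J X {p \<in> X. \<forall>a\<in>A. P a p}"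
proof (induction A rule: finite_induct)
  case (insert a A)
  have "{p \<in> X. \<forall>a\<in>insert a A. P a p} = {p \<in> X. P a p} \<inter> {p \<in> X. \<forall>a\<in>A. P a p}" by auto
  then show ?case using insert by (auto intro: ropen_Int)
qed auto

lemma ropen_conj:
  "ropen J X {p \<in> X. P p} \<Longrightarrow> ropen J X {p \<in> X. Q p} \<Longrightarrow> ropen J X {p \<in> X. P p \<and> Q p}"
  using ropen_Int[of J X "{p \<in> X. P p}" "{p \<in> X. Q p}"] by (simp add: Collect_conj_eq[symmetric] Int_def conj_ac)

lemma ropen_nonzero:
  assumes "X \<subseteq> aff_space J" "f \<in> quot_funs J X"
  shows "ropen J X {p \<in> X. f p \<noteq> 0}"
proof -
  obtain g h where *: "g \<in> poly_funs J" "h \<in> poly_funs J" "\<And>p. p \<in> X \<Longrightarrow> h p \<noteq> 0"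
    "\<And>p. p \<in> X \<Longrightarrow> f p = g p / h p" by (rule quot_funsE[OF assms(2)]) blast
  have "{p \<in> X. f p \<noteq> 0} = {p \<in> X. \<exists>f\<in>{g}. f p \<noteq> 0}" using * by auto
  then show ?thesis
    unfolding ropen_iff[OF assms(1)] using * by blast
qed

text \<open>Zariski continuity: composing a polynomial with quotient coordinates gives a quotient
  function, and its nonvanishing set is open.\<close>

lemma ropen_vimage:
  assumes "X \<subseteq> aff_space J" "Y \<subseteq> aff_space K" "\<phi> ` X \<subseteq> Y"
    "\<And>k. k \<in> K \<Longrightarrow> (\<lambda>p. \<phi> p k) \<in> quot_funs J X" "ropen K Y V"
  shows "ropen J X {p \<in> X. \<phi> p \<in> V}"
proof -
  obtain S where S: "S \<subseteq> poly_funs K" "V = {p \<in> Y. \<exists>f\<in>S. f p \<noteq> 0}"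
    using assms(5) unfolding ropen_iff[OF assms(2)] by blast
  have "ropen J X {p \<in> X. f (\<phi> p) \<noteq> 0}" if "f \<in> S" for f
    using S(1) that by (intro ropen_nonzero assms(1) poly_funs_compose[of f K] assms(4)) auto
  then have "ropen J X (\<Union>f\<in>S. {p \<in> X. f (\<phi> p) \<noteq> 0})"
    unfolding ropen_def by (intro openin_Union) auto
  also have "(\<Union>f\<in>S. {p \<in> X. f (\<phi> p) \<noteq> 0}) = {p \<in> X. \<phi> p \<in> V}"
    using S(2) assms(3) by auto
  finally show ?thesis .
qed

section \<open>Irreducibility, in the form that nonempty open sets meet\<close>

definition irred :: "'j set \<Rightarrow> ('j \<Rightarrow> complex) set \<Rightarrow> bool" where
  "irred J X \<longleftrightarrow> X \<subseteq> aff_space J \<and> X \<noteq> {} \<and>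
     (\<forall>U V. ropen J X U \<longrightarrow> ropen J X V \<longrightarrow> U \<noteq> {} \<longrightarrow> V \<noteq> {} \<longrightarrow> U \<inter> V \<noteq> {})"

lemma irredD: "irred J X \<Longrightarrow> ropen J X U \<Longrightarrow> ropen J X V \<Longrightarrow> U \<noteq> {} \<Longrightarrow> V \<noteq> {} \<Longrightarrow> U \<inter> V \<noteq> {}"
  unfolding irred_def by blast

lemma irreducible_space_irred:
  assumes "irred J X"
  shows "irreducible_space (subtopology (zariski J) X)"
proof -
  let ?T = "subtopology (zariski J) X"
  have X: "topspace ?T = X"
    using assms by (auto simp: topspace_subtopology topspace_zariski irred_def)
  show ?thesis
    unfolding irreducible_space_def X
  proof (intro conjI allI impI)
    show "X \<noteq> {}" using assms by (simp add: irred_def)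
    fix A B assume *: "closedin ?T A" "closedin ?T B" "X \<subseteq> A \<union> B"
    then have "ropen J X (X - A)" "ropen J X (X - B)"
      unfolding ropen_def closedin_def X by auto
    with irredD[OF assms, of "X - A" "X - B"] *(3) show "X \<subseteq> A \<or> X \<subseteq> B" by blast
  qed
qed

lemma poly_funs_line:
  assumes "f \<in> poly_funs J"
  shows "\<exists>F :: complex poly. \<forall>s. f (\<lambda>j. p j + s * (q j - p j)) = poly F s"
  using assms
proof induction
  case (const a)
  show ?case by (rule exI[of _ "[:a:]"]) simp
next
  case (coord j)
  show ?case by (rule exI[of _ "[:p j, q j - p j:]"]) simp
next
  case (add f g)
  then show ?case by (metis poly_add)
next
  case (mult f g)
  then show ?case by (metis poly_mult)
qed

text \<open>Join a point of one open set to a point of the other by a line. On it polynomials become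
  polynomials in one variable, and a product of finitely many nonzero ones has a non-root.\<close>

lemma irred_torus:
  assumes "finite J"
  shows "irred J (torus J)"
  unfolding irred_def
proof (intro conjI allI impI)
  show sub: "torus J \<subseteq> aff_space J" by (auto simp: torus_def)
  have "(\<lambda>j. if j \<in> J then 1 else 0) \<in> torus J" by (auto simp: torus_def aff_space_def)
  then show "torus J \<noteq> {}" by blast
  fix U V assume "ropen J (torus J) U" "ropen J (torus J) V" "U \<noteq> {}" "V \<noteq> {}"
  then obtain S T p q where S: "S \<subseteq> poly_funs J" "U = {p \<in> torus J. \<exists>f\<in>S. f p \<noteq> 0}" "p \<in> U"
    and T: "T \<subseteq> poly_funs J" "V = {p \<in> torus J. \<exists>f\<in>T. f p \<noteq> 0}" "q \<in> V"
    unfolding ropen_iff[OF sub] by blast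
  obtain f g where f: "f \<in> S" "f p \<noteq> 0" and g: "g \<in> T" "g q \<noteq> 0" using S T by auto
  have pq: "p \<in> torus J" "q \<in> torus J" using S T by auto
  define l where "l s = (\<lambda>j. p j + s * (q j - p j))" for s
  obtain F where F: "\<And>s. f (l s) = poly F s"
    using poly_funs_line[of f J p q] f S unfolding l_def by blast
  obtain G where G: "\<And>s. g (l s) = poly G s"
    using poly_funs_line[of g J p q] g T unfolding l_def by blast
  have "l 0 = p" "l 1 = q" by (auto simp: l_def)
  then have "F \<noteq> 0" "G \<noteq> 0" using F[of 0] G[of 1] f g by auto
  \<comment> \<open>These linear factors are the coordinates along the line; their nonvanishing
    keeps the chosen point inside the torus.\<close>
  moreover have "[:p j, q j - p j:] \<noteq> 0" if "j \<in> J" for j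
    using pq that by (auto simp: torus_def)
  ultimately have "F * G * (\<Prod>j\<in>J. [:p j, q j - p j:]) \<noteq> 0" using assms by auto
  then obtain s where "poly (F * G * (\<Prod>j\<in>J. [:p j, q j - p j:])) s \<noteq> 0"
    by (metis poly_all_0_iff_0)
  then have s: "f (l s) \<noteq> 0" "g (l s) \<noteq> 0" "\<And>j. j \<in> J \<Longrightarrow> l s j \<noteq> 0"
    using assms F G by (auto simp: poly_prod l_def mult.commute)
  have "l s \<in> torus J"
    using s pq by (auto simp: torus_def aff_space_def l_def)
  then show "U \<inter> V \<noteq> {}" using s S T f g by blast
qed

text \<open>Preimages of nonempty open sets are nonempty by surjectivity and open by continuity, so
  they meet.\<close>

lemma irred_image:
  assumes "irred J X" "Y \<subseteq> aff_space K" "\<phi> ` X = Y"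
    "\<And>k. k \<in> K \<Longrightarrow> (\<lambda>p. \<phi> p k) \<in> quot_funs J X"
  shows "irred K Y"
  unfolding irred_def
proof (intro conjI allI impI)
  show "Y \<noteq> {}" using assms by (auto simp: irred_def)
  fix U V assume *: "ropen K Y U" "ropen K Y V" "U \<noteq> {}" "V \<noteq> {}"
  have X: "X \<subseteq> aff_space J" using assms by (auto simp: irred_def)
  have "{p \<in> X. \<phi> p \<in> W} \<noteq> {}" if "ropen K Y W" "W \<noteq> {}" for W
    using that ropen_subset[of K Y W] assms(3) by blast
  moreover have "ropen J X {p \<in> X. \<phi> p \<in> W}" if "ropen K Y W" for W
    using that by (intro ropen_vimage[OF X assms(2) _ assms(4)]) (auto simp: assms(3)[symmetric])
  ultimately have "{p \<in> X. \<phi> p \<in> U} \<inter> {p \<in> X. \<phi> p \<in> V} \<noteq> {}"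
    using * by (intro irredD[OF assms(1)])
  then show "U \<inter> V \<noteq> {}" by blast
qed (rule assms)

section \<open>Rational maps\<close>

text \<open>Regularity asks for local quotients only. The functions below all have a single quotient
  on their whole domain, so nothing has to be glued.\<close>

lemma regular_on_quot_funs:
  assumes "U \<subseteq> aff_space J" "f \<in> quot_funs J U"
  shows "regular_on J U f"
  using assms ropen_self[OF assms(1)]
  unfolding regular_on_def quot_funs_def ropen_def by blast

lemma rational_mapI:
  assumes "X \<subseteq> aff_space J" "ropen J X (dom f)" "dom f \<noteq> {}" "ran f \<subseteq> Y"
    "\<And>k. k \<in> K \<Longrightarrow> (\<lambda>p. the (f p) k) \<in> quot_funs J (dom f)"
  shows "rational_map J X K Y f"
  unfolding rational_map_def
  using assms ropen_subset[OF assms(2)]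
  by (auto simp: ropen_def intro!: regular_on_quot_funs)

lemma rational_functionI:
  assumes "X \<subseteq> aff_space J" "ropen J X (dom f)" "dom f \<noteq> {}"
    "(\<lambda>p. the (f p)) \<in> quot_funs J (dom f)"
  shows "rational_function J X f"
  unfolding rational_function_def
  using assms ropen_subset[OF assms(2)]
  by (auto simp: ropen_def intro!: regular_on_quot_funs)

text \<open>On an irreducible space two nonempty open domains overlap in a nonempty open set, so
  pointwise comparison on the overlap decides. Intersecting with \<open>X\<close> admits total
  functions such as \<open>Some\<close>.\<close>

lemma rat_eqI:
  assumes "irred J X" "ropen J X (X \<inter> dom f)" "ropen J X (X \<inter> dom g)" "X \<inter> dom f \<noteq> {}" "X \<inter> dom g \<noteq> {}"
    "\<And>p a b. p \<in> X \<Longrightarrow> f p = Some a \<Longrightarrow> g p = Some b \<Longrightarrow> a = b"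
  shows "rat_eq J X f g"
  unfolding rat_eq_def
proof (rule exI[of _ "(X \<inter> dom f) \<inter> (X \<inter> dom g)"], intro conjI ballI)
  show "openin (subtopology (zariski J) X) ((X \<inter> dom f) \<inter> (X \<inter> dom g))"
    using ropen_Int[OF assms(2,3)] by (simp add: ropen_def)
  show "(X \<inter> dom f) \<inter> (X \<inter> dom g) \<noteq> {}" using irredD[OF assms(1-5)] .
  fix p assume "p \<in> (X \<inter> dom f) \<inter> (X \<inter> dom g)"
  then show "f p = g p" using assms(6) by fastforce
qed auto

lemma dom_map_comp: "dom (f \<circ>\<^sub>m g) = {p. \<exists>q. g p = Some q \<and> q \<in> dom f}"
  by (auto simp: map_comp_def split: option.splits)

lemma ropen_dom_map_comp:
  assumes "X \<subseteq> aff_space J" "Y \<subseteq> aff_space K" "ropen J X (dom g)" "ran g \<subseteq> Y"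
    "\<And>k. k \<in> K \<Longrightarrow> (\<lambda>p. the (g p) k) \<in> quot_funs J (dom g)" "ropen K Y (dom f)"
  shows "ropen J X (dom (f \<circ>\<^sub>m g))"
proof -
  have "ropen J (dom g) {p \<in> dom g. the (g p) \<in> dom f}"
    using assms ropen_subset[OF assms(3)]
    by (intro ropen_vimage[of _ _ Y K]) (auto intro: ranI)
  then have "ropen J X {p \<in> dom g. the (g p) \<in> dom f}" by (rule ropen_trans[OF assms(3)])
  also have "{p \<in> dom g. the (g p) \<in> dom f} = dom (f \<circ>\<^sub>m g)"
    unfolding dom_map_comp by auto
  finally show ?thesis .
qed

section \<open>Column configurations and their minors\<close>

type_synonym config = "(nat \<Rightarrow> complex) \<times> (nat \<Rightarrow> complex)"

definition minor :: "config \<Rightarrow> nat \<Rightarrow> nat \<Rightarrow> complex" where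
  "minor M i j = fst M i * snd M j - fst M j * snd M i"

definition next_idx :: "nat \<Rightarrow> nat \<Rightarrow> nat" where
  "next_idx n i = (if i = n then 0 else i + 1)"

definition prev_idx :: "nat \<Rightarrow> nat \<Rightarrow> nat" where
  "prev_idx n i = (if i = 0 then n else i - 1)"

definition shear :: "nat \<Rightarrow> complex \<Rightarrow> nat \<Rightarrow> config \<Rightarrow> config" where
  "shear i t j M = ((fst M)(i := fst M i + t * fst M j), (snd M)(i := snd M i + t * snd M j))"

text \<open>With cyclic indices the coefficient \<open>t\<close> solves \<open>minor M (i - 1) i + t
  * minor M (i - 1) (i + 1) = c * minor M (i - 1) i\<close>. If the denominator vanishes, division
  yields 0 and the map is the identity; the scaling by \<open>c\<close> is claimed only away from
  this case.\<close>

definition col_action :: "nat \<Rightarrow> nat \<Rightarrow> complex \<Rightarrow> config \<Rightarrow> config" where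
  "col_action n i c M = shear i
     ((c - 1) * minor M (prev_idx n i) i / minor M (prev_idx n i) (next_idx n i)) (next_idx n i) M"

lemma minor_self [simp]: "minor M i i = 0"
  by (simp add: minor_def)

lemma minor_swap: "minor M i j = - minor M j i"
  by (simp add: minor_def)

lemma plucker: "minor M i j * minor M k l = minor M i k * minor M j l - minor M i l * minor M j k"
  by (simp add: minor_def algebra_simps)

lemma minor_shear:
  "minor (shear i t j M) k l = minor M k l + (if k = i then t * minor M j l else 0)
     + (if l = i then t * minor M k j else 0)"
  by (auto simp: minor_def shear_def algebra_simps)

lemma next_idx_le [simp]: "i \<le> n \<Longrightarrow> next_idx n i \<le> n"
  by (auto simp: next_idx_def)

lemma prev_idx_le [simp]: "i \<le> n \<Longrightarrow> prev_idx n i \<le> n"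
  by (auto simp: prev_idx_def)

lemma prev_next [simp]: "i \<le> n \<Longrightarrow> prev_idx n (next_idx n i) = i"
  by (auto simp: next_idx_def prev_idx_def)

lemma next_prev [simp]: "i \<le> n \<Longrightarrow> next_idx n (prev_idx n i) = i"
  by (auto simp: next_idx_def prev_idx_def)

lemma idx_distinct:
  assumes "n \<ge> 2" "i \<le> n"
  shows "next_idx n i \<noteq> i" "prev_idx n i \<noteq> i" "next_idx n i \<noteq> prev_idx n i"
  using assms by (auto simp: next_idx_def prev_idx_def)

text \<open>What remains of a configuration up to invertible 2x2 row operations: these multiply all
  minors by the determinant.\<close>

definition minors_prop :: "nat \<Rightarrow> complex \<Rightarrow> config \<Rightarrow> config \<Rightarrow> bool" where
  "minors_prop n s M M' \<longleftrightarrow> s \<noteq> 0 \<and> (\<forall>k\<le>n. \<forall>l\<le>n. minor M' k l = s * minor M k l)"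

section \<open>Effect of column actions on minors, and the relations between column actions\<close>

lemma minor_col_action:
  assumes "n \<ge> 2" "i \<le> n"
  shows "minor (col_action n i c M) k l =
    (let t = (c - 1) * minor M (prev_idx n i) i / minor M (prev_idx n i) (next_idx n i)
     in minor M k l + (if k = i then t * minor M (next_idx n i) l else 0)
          + (if l = i then t * minor M k (next_idx n i) else 0))"
  using idx_distinct[OF assms] by (simp add: col_action_def minor_shear Let_def)

lemma minor_col_action_other [simp]:
  "k \<noteq> i \<Longrightarrow> l \<noteq> i \<Longrightarrow> minor (col_action n i c M) k l = minor M k l"
  by (simp add: col_action_def minor_shear)

lemma minor_col_action_next [simp]:
  assumes "n \<ge> 2" "i \<le> n"
  shows "minor (col_action n i c M) i (next_idx n i) = minor M i (next_idx n i)"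
    "minor (col_action n i c M) (next_idx n i) i = minor M (next_idx n i) i"
  using idx_distinct[OF assms] by (simp_all add: minor_col_action assms Let_def)

lemma minor_col_action_prev:
  assumes "n \<ge> 2" "i \<le> n" "minor M (prev_idx n i) (next_idx n i) \<noteq> 0"
  shows "minor (col_action n i c M) (prev_idx n i) i = c * minor M (prev_idx n i) i"
  using idx_distinct[OF assms(1,2)] assms
  by (simp add: minor_col_action Let_def field_simps)

lemma shear_shear: "i \<noteq> j \<Longrightarrow> shear i t j (shear i u j M) = shear i (t + u) j M"
  by (auto simp: shear_def fun_eq_iff algebra_simps)

lemma col_action_one [simp]: "col_action n i 1 M = M"
  by (simp add: col_action_def shear_def)

text \<open>The first shear keeps the minor in the denominator and multiplies the one in the
  numerator by \<open>d\<close>, so the coefficients add up as (c - 1) d + (d - 1) = c d -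
  1.\<close>

lemma col_action_mult:
  assumes "n \<ge> 2" "i \<le> n" "minor M (prev_idx n i) (next_idx n i) \<noteq> 0"
  shows "col_action n i c (col_action n i d M) = col_action n i (c * d) M"
proof -
  note d = idx_distinct[OF assms(1,2)]
  let ?N = "col_action n i d M"
  have "col_action n i c ?N = shear i ((c - 1) * (d * minor M (prev_idx n i) i)
      / minor M (prev_idx n i) (next_idx n i)) (next_idx n i) ?N"
    unfolding col_action_def[of n i c] using d assms by (simp add: minor_col_action_prev)
  also have "\<dots> = shear i ((c * d - 1) * minor M (prev_idx n i) i
      / minor M (prev_idx n i) (next_idx n i)) (next_idx n i) M"
    unfolding col_action_def using d
    by (subst shear_shear) (auto simp: add_divide_distrib[symmetric] algebra_simps)
  finally show ?thesis by (simp only: col_action_def)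
qed

text \<open>An action moves one column and reads that column and its two neighbours. For distinct,
  non-adjacent indices neither action changes what the other reads; a common neighbour is moved by
  neither.\<close>

lemma col_action_commute:
  assumes "j \<noteq> i" "j \<noteq> next_idx n i" "j \<noteq> prev_idx n i" "i \<noteq> next_idx n j" "i \<noteq> prev_idx n j"
  shows "col_action n i c (col_action n j d M) = col_action n j d (col_action n i c M)"
proof -
  have "minor (col_action n j d M) (prev_idx n i) i = minor M (prev_idx n i) i"
    "minor (col_action n j d M) (prev_idx n i) (next_idx n i) = minor M (prev_idx n i) (next_idx n i)"
    "minor (col_action n i c M) (prev_idx n j) j = minor M (prev_idx n j) j"
    "minor (col_action n i c M) (prev_idx n j) (next_idx n j) = minor M (prev_idx n j) (next_idx n j)"
    using assms by (metis minor_col_action_other)+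
  then have "col_action n i c (col_action n j d M) = shear i ((c - 1) * minor M (prev_idx n i) i
        / minor M (prev_idx n i) (next_idx n i)) (next_idx n i) (col_action n j d M)"
    "col_action n j d (col_action n i c M) = shear j ((d - 1) * minor M (prev_idx n j) j
        / minor M (prev_idx n j) (next_idx n j)) (next_idx n j) (col_action n i c M)"
    unfolding col_action_def[of n i c "col_action n j d M"]
      col_action_def[of n j d "col_action n i c M"] by simp_all
  then show ?thesis
    using assms unfolding col_action_def by (auto simp: shear_def fun_eq_iff)
qed

text \<open>In the braid relation only the columns \<open>A, B, C, D\<close> with indices \<open>i - 1, \<dots>, i + 2\<close>
  enter, where \<open>A = D\<close> is possible; the identities below compare the coefficients of \<open>C\<close> and \<open>D\<close>
  in the new columns.\<close>

lemma braid_coefficients: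
  fixes AB AC AD BC BD CD c d :: complex
  assumes P: "AB * CD = AC * BD - AD * BC"
    and nz: "AC \<noteq> 0" "BD \<noteq> 0"
  defines "a \<equiv> (d - 1) * AB / AC"
  defines "b \<equiv> (c * d - 1) * BC / (BD + a * CD)"
  defines "a' \<equiv> (c - 1) * (d * AB) / (AC + b * AD)"
  defines "\<beta> \<equiv> (c - 1) * BC / BD"
  defines "\<alpha> \<equiv> (c * d - 1) * AB / (AC + \<beta> * AD)"
  defines "\<beta>' \<equiv> (d - 1) * (c * BC) / (BD + \<alpha> * CD)"
  assumes nz': "BD + a * CD \<noteq> 0" "AC + b * AD \<noteq> 0" "AC + \<beta> * AD \<noteq> 0" "BD + \<alpha> * CD \<noteq> 0"
  shows "a' + a = \<alpha>" "a' * b = \<alpha> * \<beta>" "b = \<beta>' + \<beta>"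
proof -
  \<comment> \<open>\<open>X\<close> and \<open>Z\<close> are the two inner denominators cleared:
    \<open>X = AC * (BD + a * CD)\<close> and \<open>Z = BD * (AC + \<beta> * AD)\<close>. The other
    two denominators become quotients of monomials in these, \<open>AC\<close>, \<open>BD\<close>,
    \<open>c\<close> and \<open>d\<close>.\<close>
  define X where "X = AC * BD + (d - 1) * (AB * CD)"
  define Z where "Z = AC * BD + (c - 1) * (BC * AD)"
  have X: "BD + a * CD = X / AC" using nz by (simp add: a_def X_def field_simps)
  have Z: "AC + \<beta> * AD = Z / BD" using nz by (simp add: \<beta>_def Z_def field_simps)
  have "X \<noteq> 0" "Z \<noteq> 0" using nz' X Z nz by auto
  have b: "b = (c * d - 1) * BC * AC / X" unfolding b_def X by simp
  have \<alpha>: "\<alpha> = (c * d - 1) * AB * BD / Z" unfolding \<alpha>_def Z by simp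
  have BCAD: "BC * AD = AC * BD - AB * CD" using P by (simp add: algebra_simps)
  \<comment> \<open>Here the Pluecker relation enters: it turns one of \<open>X\<close>,
    \<open>Z\<close> into a multiple of the other, which makes the two sides of the braid relation
    comparable.\<close>
  have XZ: "X + (c * d - 1) * (BC * AD) = d * Z" "Z + (c * d - 1) * (AB * CD) = c * X"
    unfolding X_def Z_def BCAD by (simp_all add: algebra_simps)
  have "AC + b * AD = AC * (X + (c * d - 1) * (BC * AD)) / X"
    using \<open>X \<noteq> 0\<close> unfolding b by (simp add: field_simps)
  then have 1: "AC + b * AD = AC * (d * Z) / X" unfolding XZ .
  have "BD + \<alpha> * CD = BD * (Z + (c * d - 1) * (AB * CD)) / Z"
    using \<open>Z \<noteq> 0\<close> unfolding \<alpha> by (simp add: field_simps)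
  then have 2: "BD + \<alpha> * CD = BD * (c * X) / Z" unfolding XZ .
  have cd: "d \<noteq> 0" "c \<noteq> 0" using nz' 1 2 by auto
  have a': "a' = (c - 1) * AB * X / (AC * Z)"
    unfolding a'_def 1 using cd by simp
  have \<beta>': "\<beta>' = (d - 1) * BC * Z / (BD * X)"
    unfolding \<beta>'_def 2 using cd by simp
  show "a' * b = \<alpha> * \<beta>"
    unfolding a' b \<alpha> \<beta>_def using nz \<open>X \<noteq> 0\<close> \<open>Z \<noteq> 0\<close> by (simp add: field_simps)
  have "(c - 1) * X + (d - 1) * Z = (c * d - 1) * (AC * BD)"
    unfolding X_def Z_def BCAD by (simp add: algebra_simps)
  note K = this
  have "a' + a = AB * ((c - 1) * X + (d - 1) * Z) / (AC * Z)"
    unfolding a' a_def using nz \<open>Z \<noteq> 0\<close> by (simp add: field_simps)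
  then show "a' + a = \<alpha>" unfolding K \<alpha> using nz by simp
  have "\<beta>' + \<beta> = BC * ((c - 1) * X + (d - 1) * Z) / (BD * X)"
    unfolding \<beta>' \<beta>_def using nz \<open>X \<noteq> 0\<close> by (simp add: field_simps)
  then show "b = \<beta>' + \<beta>" unfolding K b using nz by simp
qed

text \<open>The six nonvanishing hypotheses are the denominators of the three actions on either
  side. Both sides add multiples of columns \<open>j\<close> and \<open>k\<close> to column
  \<open>i\<close> and a multiple of \<open>k\<close> to column \<open>j\<close>; the coefficients
  agree by the preceding lemma.\<close>

lemma col_action_braid:
  assumes n: "n \<ge> 2" "i \<le> n" and j: "j = next_idx n i"
    and "minor M (prev_idx n i) (next_idx n i) \<noteq> 0"
    "minor (col_action n i d M) (prev_idx n j) (next_idx n j) \<noteq> 0"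
    "minor (col_action n j (c * d) (col_action n i d M)) (prev_idx n i) (next_idx n i) \<noteq> 0"
    "minor M (prev_idx n j) (next_idx n j) \<noteq> 0"
    "minor (col_action n j c M) (prev_idx n i) (next_idx n i) \<noteq> 0"
    "minor (col_action n i (c * d) (col_action n j c M)) (prev_idx n j) (next_idx n j) \<noteq> 0"
  shows "col_action n i c (col_action n j (c * d) (col_action n i d M)) =
    col_action n j d (col_action n i (c * d) (col_action n j c M))"
proof -
  define h k where "h = prev_idx n i" and "k = next_idx n j"
  have jn: "j \<le> n" and pj: "prev_idx n j = i" using n j by auto
  have ne: "i \<noteq> j" "h \<noteq> i" "h \<noteq> j" "k \<noteq> j" "k \<noteq> i"
    using idx_distinct[OF n] idx_distinct[OF n(1) jn] pj j by (auto simp: h_def k_def)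
  have act_i: "col_action n i x N = shear i ((x - 1) * minor N h i / minor N h j) j N" for x N
    by (simp add: col_action_def h_def j)
  have act_j: "col_action n j x N = shear j ((x - 1) * minor N i j / minor N i k) k N" for x N
    by (simp add: col_action_def k_def pj)
  note nz = assms(4-9)[folded h_def k_def, unfolded pj j[symmetric], folded h_def k_def]
  define a where "a = (d - 1) * minor M h i / minor M h j"
  define b where "b = (c * d - 1) * minor M i j / (minor M i k + a * minor M j k)"
  define a' where "a' = (c - 1) * (d * minor M h i) / (minor M h j + b * minor M h k)"
  define \<beta> where "\<beta> = (c - 1) * minor M i j / minor M i k"
  define \<alpha> where "\<alpha> = (c * d - 1) * minor M h i / (minor M h j + \<beta> * minor M h k)"
  define \<beta>' where "\<beta>' = (d - 1) * (c * minor M i j) / (minor M i k + \<alpha> * minor M j k)"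
  have L1: "col_action n i d M = shear i a j M" by (simp add: act_i a_def)
  have ai: "minor M h i + a * minor M h j = d * minor M h i"
    using nz(1) by (simp add: a_def field_simps)
  have L2: "col_action n j (c * d) (shear i a j M) = shear j b k (shear i a j M)"
    unfolding act_j b_def using ne by (simp add: minor_shear)
  have L3: "col_action n i c (shear j b k (shear i a j M)) = shear i a' j (shear j b k (shear i a j M))"
    unfolding act_i a'_def using ne ai by (simp add: minor_shear algebra_simps)
  have R1: "col_action n j c M = shear j \<beta> k M" by (simp add: act_j \<beta>_def)
  have bi: "minor M i j + \<beta> * minor M i k = c * minor M i j"
    using nz(4) by (simp add: \<beta>_def field_simps)
  have R2: "col_action n i (c * d) (shear j \<beta> k M) = shear i \<alpha> j (shear j \<beta> k M)"
    unfolding act_i \<alpha>_def using ne by (simp add: minor_shear)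
  have R3: "col_action n j d (shear i \<alpha> j (shear j \<beta> k M)) = shear j \<beta>' k (shear i \<alpha> j (shear j \<beta> k M))"
    unfolding act_j \<beta>'_def using ne bi by (simp add: minor_shear algebra_simps)
  have P: "minor M h i * minor M j k = minor M h j * minor M i k - minor M h k * minor M i j"
    by (rule plucker)
  have "minor M i k + a * minor M j k \<noteq> 0"
    using nz(2) ne unfolding L1 by (simp add: minor_shear)
  moreover have "minor M h j + b * minor M h k \<noteq> 0"
    using nz(3) ne unfolding L1 L2 by (simp add: minor_shear)
  moreover have "minor M h j + \<beta> * minor M h k \<noteq> 0"
    using nz(5) ne unfolding R1 by (simp add: minor_shear)
  moreover have "minor M i k + \<alpha> * minor M j k \<noteq> 0"
    using nz(6) ne unfolding R1 R2 by (simp add: minor_shear)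
  ultimately have co: "a' + a = \<alpha>" "a' * b = \<alpha> * \<beta>" "b = \<beta>' + \<beta>"
    using braid_coefficients[OF P nz(1) nz(4), of d c, folded a_def \<beta>_def, folded b_def \<alpha>_def,
        folded a'_def \<beta>'_def] by blast+
  have "shear i a' j (shear j b k (shear i a j M)) = shear j \<beta>' k (shear i \<alpha> j (shear j \<beta> k M))"
  proof -
    have b: "b * f k = \<beta> * f k + \<beta>' * f k" for f :: "nat \<Rightarrow> complex"
      unfolding co(3) by (simp add: algebra_simps)
    have "a * f j + a' * (f j + (\<beta> * f k + \<beta>' * f k)) = \<alpha> * (f j + \<beta> * f k)"
      for f :: "nat \<Rightarrow> complex"
    proof -
      have "a * f j + a' * (f j + b * f k) = (a' + a) * f j + (a' * b) * f k"
        by (simp add: algebra_simps)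
      then show ?thesis unfolding co(1,2) b by (simp add: algebra_simps)
    qed
    then show ?thesis
      using ne by (auto simp: shear_def fun_eq_iff add.assoc b)
  qed
  then show ?thesis unfolding L1 L2 L3 R1 R2 R3 .
qed

section \<open>The parametrised vectors as Pluecker vectors\<close>

text \<open>The wedge of the two rows of \<open>M\<close>, divided by a normalising scalar. Column n
  + 1 of the module is stored as column 0.\<close>

definition plvec :: "nat \<Rightarrow> complex \<Rightarrow> config \<Rightarrow> wvec" where
  "plvec n s M = (\<lambda>(i, j). if (i, j) \<in> W_basis n
     then minor M i (if j = n + 1 then 0 else j) / s else 0)"

text \<open>\<open>Y_op n k c\<close> on the natural (n+1)-dimensional representation. The sign for
  \<open>k = 0\<close> is forced by f_0 (i, n+1) = (1, i): replacing n+1 by 1 reverses the order of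
  the wedge.\<close>

definition Y_col :: "nat \<Rightarrow> nat \<Rightarrow> complex \<Rightarrow> (nat \<Rightarrow> complex) \<Rightarrow> nat \<Rightarrow> complex" where
  "Y_col n k c a = a(k := c * a k,
     next_idx n k := (if k = 0 then - a k else a k) + a (next_idx n k) / c)"

lemma finite_W_basis [simp]: "finite (W_basis n)"
  by (rule finite_subset[of _ "{..n+1} \<times> {..n+1}"]) (auto simp: W_basis_def)

text \<open>On basis pairs \<open>f_basis n k\<close> is injective where it is defined, so the sum
  for one coordinate has at most one term; the cases locate the preimage.\<close>

lemma f_op_eq:
  assumes "k \<le> n" "(i, j) \<in> W_basis n"
  shows "f_op n k v (i, j) =
    (if k = 0 then (if i = 1 \<and> j \<le> n then v (j, n + 1) else 0)
     else if i = k + 1 then v (k, j) else if j = k + 1 \<and> i < k then v (i, k) else 0)"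
proof -
  have delta: "f_op n k v (i, j) = v b0"
    if "b0 \<in> W_basis n" "\<And>b. b \<in> W_basis n \<Longrightarrow> f_basis n k b = Some (i, j) \<longleftrightarrow> b = b0" for b0
  proof -
    have "f_op n k v (i, j) = (\<Sum>b\<in>W_basis n. if b = b0 then v b else 0)"
      unfolding f_op_def by (intro sum.cong) (auto simp: that(2))
    then show ?thesis using that(1) by simp
  qed
  have zero: "f_op n k v (i, j) = 0"
    if "\<And>b. b \<in> W_basis n \<Longrightarrow> f_basis n k b \<noteq> Some (i, j)"
    unfolding f_op_def using that by (intro sum.neutral) auto
  consider "k = 0" "i = 1" "j \<le> n" | "k = 0" "\<not> (i = 1 \<and> j \<le> n)" | "k > 0" "i = k + 1"
    | "k > 0" "i \<noteq> k + 1" "j = k + 1" "i < k" | "k > 0" "i \<noteq> k + 1" "\<not> (j = k + 1 \<and> i < k)"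
    by blast
  then show ?thesis
  proof cases
    case 1
    then show ?thesis
      using assms by (subst delta[of "(j, n + 1)"]) (auto simp: W_basis_def f_basis_def split: if_splits)
  next
    case 2
    then show ?thesis
      using assms by (subst zero) (auto simp: W_basis_def f_basis_def split: if_splits)
  next
    case 3
    then show ?thesis
      using assms by (subst delta[of "(k, j)"]) (auto simp: W_basis_def f_basis_def split: if_splits)
  next
    case 4
    then show ?thesis
      using assms by (subst delta[of "(i, k)"]) (auto simp: W_basis_def f_basis_def split: if_splits)
  next
    case 5
    then show ?thesis
      using assms by (subst zero) (auto simp: W_basis_def f_basis_def split: if_splits)
  qed
qed

lemma f_op_outside: "k \<le> n \<Longrightarrow> b \<notin> W_basis n \<Longrightarrow> f_op n k v b = 0"
  unfolding f_op_def
  by (intro sum.neutral) (auto simp: W_basis_def f_basis_def split: if_splits)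

text \<open>A weight is a sum over the two members of the pair, so its power factors column by
  column.\<close>

lemma powi_wt:
  fixes c :: complex
  assumes "1 \<le> i" "i < j" "j \<le> n + 1" "c \<noteq> 0" "k \<le> n" "n \<ge> 2"
  shows "c powi wt n (i, j) k = (if k = i then c else if k + 1 = i then 1 / c else 1) *
    (if k = (if j = n + 1 then 0 else j) then c else if k + 1 = j then 1 / c else 1)"
proof -
  have "c powi (fund_weight n m k - fund_weight n (m - 1) k) =
    (if k = (if m = n + 1 then 0 else m) then c else if k + 1 = m then 1 / c else 1)"
    if "1 \<le> m" "m \<le> n + 1" for m
    using that assms(5,6) by (auto simp: fund_weight_def field_simps)
  from this[of i] this[of j] show ?thesis
    using assms by (simp add: wt_def add_diff_eq[symmetric] power_int_add)
qed

text \<open>An exterior square applied to a wedge is the wedge of the images. What matters is only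
  how \<open>k\<close> and \<open>k + 1\<close> lie relative to the pair, hence the case
  split.\<close>

lemma Y_op_plvec:
  assumes n: "n \<ge> 2" "k \<le> n" and c: "c \<noteq> 0"
  shows "Y_op n k c (plvec n 1 M) = plvec n 1 (Y_col n k c (fst M), Y_col n k c (snd M))"
proof
  fix b :: "nat \<times> nat"
  obtain i j where b: "b = (i, j)" by fastforce
  show "Y_op n k c (plvec n 1 M) b = plvec n 1 (Y_col n k c (fst M), Y_col n k c (snd M)) b"
  proof (cases "(i, j) \<in> W_basis n")
    case False
    then show ?thesis
      using n False by (simp add: b Y_op_def alpha_op_def plvec_def f_op_outside)
  next
    case True
    note W_ij = True
    from True have ij: "1 \<le> i" "i < j" "j \<le> n + 1" by (auto simp: W_basis_def)
    have al: "alpha_op n k c (plvec n 1 M) (p, q) =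
      (if k = p then c else if k + 1 = p then 1 / c else 1) *
      (if k = (if q = n + 1 then 0 else q) then c else if k + 1 = q then 1 / c else 1) *
      minor M p (if q = n + 1 then 0 else q)" if "1 \<le> p" "p < q" "q \<le> n + 1" for p q
      unfolding alpha_op_def powi_wt[OF that c n(2,1)] plvec_def using that by (simp add: W_basis_def)
    have rhs: "plvec n 1 (Y_col n k c (fst M), Y_col n k c (snd M)) (i, j) =
      Y_col n k c (fst M) i * Y_col n k c (snd M) (if j = n + 1 then 0 else j)
        - Y_col n k c (fst M) (if j = n + 1 then 0 else j) * Y_col n k c (snd M) i"
      using True by (simp add: plvec_def minor_def)
    show ?thesis
      unfolding b rhs Y_op_def
    proof (cases "k = 0")
      case True
      show "alpha_op n k c (plvec n 1 M) (i, j) + f_op n k (alpha_op n k c (plvec n 1 M)) (i, j) / c =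
        Y_col n k c (fst M) i * Y_col n k c (snd M) (if j = n + 1 then 0 else j)
        - Y_col n k c (fst M) (if j = n + 1 then 0 else j) * Y_col n k c (snd M) i"
        unfolding f_op_eq[OF n(2) W_ij] al[OF ij] using True ij n c al[of j "n + 1"]
        by (simp add: Y_col_def next_idx_def minor_def) (auto simp: divide_simps, (simp add: algebra_simps)+)
    next
      case False
      then consider "i = k" "j = k + 1" | "i = k" "j > k + 1" | "i = k + 1" | "j = k" "i < k"
        | "j = k + 1" "i < k" | "i \<noteq> k" "i \<noteq> k + 1" "j \<noteq> k" "j \<noteq> k + 1"
        using ij by linarith
      then show "alpha_op n k c (plvec n 1 M) (i, j) + f_op n k (alpha_op n k c (plvec n 1 M)) (i, j) / c =
        Y_col n k c (fst M) i * Y_col n k c (snd M) (if j = n + 1 then 0 else j)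
        - Y_col n k c (fst M) (if j = n + 1 then 0 else j) * Y_col n k c (snd M) i"
        unfolding f_op_eq[OF n(2) W_ij] al[OF ij] using False ij n c al[of k j] al[of i k]
        by cases (simp_all add: Y_col_def next_idx_def minor_def, (auto simp: divide_simps algebra_simps)?)
    qed
  qed
qed

lemma Y_word_plvec:
  assumes "n \<ge> 2" "\<forall>(k, c)\<in>set (zip w cs). k \<le> n \<and> c \<noteq> 0"
  shows "Y_word n w cs (plvec n 1 M) = plvec n 1
    (foldr (\<lambda>(k, c). Y_col n k c) (zip w cs) (fst M), foldr (\<lambda>(k, c). Y_col n k c) (zip w cs) (snd M))"
proof -
  have "foldr (\<lambda>(k, c). Y_op n k c) ps (plvec n 1 M) = plvec n 1
    (foldr (\<lambda>(k, c). Y_col n k c) ps (fst M), foldr (\<lambda>(k, c). Y_col n k c) ps (snd M))"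
    if "\<forall>(k, c)\<in>set ps. k \<le> n \<and> c \<noteq> 0" for ps
    using that by (induction ps) (auto simp: Y_op_plvec assms(1))
  then show ?thesis using assms(2) by (simp add: Y_word_def)
qed

text \<open>The words of both charts have the shape
  \<open>(s + n - 2, \<dots>, s, s + n - 1, \<dots>, s + 1)\<close> with \<open>s = 1\<close> and \<open>s = 0\<close>; the parameter of a letter
  \<open>l\<close> has subscript \<open>n + l\<close> in the first half and \<open>l\<close> in the second.\<close>

definition chart_word :: "nat \<Rightarrow> nat \<Rightarrow> nat list" where
  "chart_word s n = rev [s..<s+n-1] @ rev [s+1..<s+n]"

definition chart_subs :: "nat \<Rightarrow> nat \<Rightarrow> nat list" where
  "chart_subs s n = rev [s+1..<s+2*n-1]"

lemma chart_subs_split: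
  assumes "n \<ge> 1"
  shows "chart_subs s n = rev [n+s..<n+s+(n-1)] @ rev [s+1..<s+n]"
proof -
  have "[s+1..<s+2*n-1] = [s+1..<s+n] @ [s+n..<s+n+(n-1)]"
    using assms upt_add_eq_append[of "s+1" "s+n" "n-1"] by (simp add: mult_2 add.assoc)
  then show ?thesis by (simp add: chart_subs_def add.commute)
qed

lemma word1_chart: "n \<ge> 1 \<Longrightarrow> word1 n = chart_word 1 n" "n \<ge> 1 \<Longrightarrow> subs1 n = chart_subs 1 n"
proof -
  show "n \<ge> 1 \<Longrightarrow> word1 n = chart_word 1 n" by (simp add: word1_def chart_word_def numeral_2_eq_2)
  show "n \<ge> 1 \<Longrightarrow> subs1 n = chart_subs 1 n"
    by (simp add: subs1_def chart_subs_split numeral_2_eq_2 add.commute)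
qed

lemma word2_chart: "n \<ge> 1 \<Longrightarrow> word2 n = chart_word 0 n" "n \<ge> 1 \<Longrightarrow> subs2 n = chart_subs 0 n"
proof -
  show "n \<ge> 1 \<Longrightarrow> word2 n = chart_word 0 n" by (simp add: word2_def chart_word_def)
  show "n \<ge> 1 \<Longrightarrow> subs2 n = chart_subs 0 n"
    by (simp add: subs2_def chart_subs_split mult_2)
qed

lemma foldr_chart_word:
  assumes "n \<ge> 1"
  shows "foldr (\<lambda>(k, c). Y_col n k c) (zip (chart_word s n) (map x (chart_subs s n))) a =
    fold (\<lambda>l. Y_col n l (x (n + l))) [s..<s+(n-1)] (fold (\<lambda>l. Y_col n l (x l)) [s+1..<s+n] a)"
proof -
  have "[n+s..<n+s+(n-1)] = map (\<lambda>l. n + l) [s..<s+(n-1)]"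
    by (rule nth_equalityI) auto
  then have "zip (chart_word s n) (map x (chart_subs s n)) =
    rev (map (\<lambda>l. (l, x (n + l))) [s..<s+(n-1)]) @ rev (map (\<lambda>l. (l, x l)) [s+1..<s+n])"
    using assms
    by (simp add: chart_subs_split chart_word_def rev_map[symmetric] zip_rev zip_map2 comp_def
        zip_same_conv_map)
  then show ?thesis by (simp add: foldr_conv_fold fold_map comp_def)
qed

text \<open>Each letter hands the partial sum on to the next column, which keeps it up to the factor
  of its own letter. The last column \<open>r\<close> has no letter of its own, so it gets factor 1.
  The bounds avoid letter 0 with its sign and the wrap-around from \<open>n\<close> to 0.\<close>

lemma fold_Y_col:
  assumes "1 \<le> p" "p \<le> r" "r \<le> n"
  shows "fold (\<lambda>l. Y_col n l (z l)) [p..<r] a = (\<lambda>l. if l < p \<or> r < l then a l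
    else (if l < r then z l else 1) * (a p + (\<Sum>m=p+1..l. a m / z (m - 1))))"
  using assms(2,3)
proof (induction r rule: dec_induct)
  case base
  then show ?case using assms(1) by (auto simp: fun_eq_iff)
next
  case (step r)
  then have IH: "fold (\<lambda>l. Y_col n l (z l)) [p..<r] a = (\<lambda>l. if l < p \<or> r < l then a l
    else (if l < r then z l else 1) * (a p + (\<Sum>m=p+1..l. a m / z (m - 1))))" by simp
  have nx: "next_idx n r = Suc r" using step by (simp add: next_idx_def)
  show ?case
    using step assms(1) by (auto simp: IH fun_eq_iff Y_col_def nx less_Suc_eq)
qed

section \<open>The columns of the two parametrised configurations\<close>

definition unit_col :: "nat \<Rightarrow> nat \<Rightarrow> complex" where
  "unit_col m = (\<lambda>l. if l = m then 1 else 0)"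

text \<open>The representative of \<open>V1 n x\<close> whose column 0 is (0, 1); the value 1 at
  \<open>l = n\<close> is the convention for x_{2n}.\<close>

definition frame1 :: "nat \<Rightarrow> (nat \<Rightarrow> complex) \<Rightarrow> config" where
  "frame1 n x = (\<lambda>l. if l = 0 then 0 else if l < n then x (n + l) else 1,
     \<lambda>l. if l = 0 then 1 else (if l < n then x (n + l) else 1) * (\<Sum>m=2..l. x m / x (n + m - 1)))"

text \<open>The representative of \<open>V2 n y\<close> whose column \<open>n\<close> is (1, 0); the
  value 1 at \<open>l = n - 1\<close> is the convention for y_{2n-1}. The minus sign in the second
  row is that of letter 0.\<close>

definition frame2 :: "nat \<Rightarrow> (nat \<Rightarrow> complex) \<Rightarrow> config" where
  "frame2 n y = (\<lambda>l. if l = 0 then 0 else if l = n then 1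
       else (if l < n - 1 then y (n + l) else 1) * (y 1 / y n + (\<Sum>m=2..l. y m / y (n + m - 1))),
     \<lambda>l. if l = 0 then y n else if l = n then 0 else - (if l < n - 1 then y (n + l) else 1))"

lemma plvec_cong:
  assumes "\<And>l. l \<le> n \<Longrightarrow> fst M l = fst M' l" "\<And>l. l \<le> n \<Longrightarrow> snd M l = snd M' l"
  shows "plvec n s M = plvec n s M'"
  using assms by (auto simp: plvec_def minor_def W_basis_def fun_eq_iff)

lemma basis_vec_plvec:
  assumes "n \<ge> 2"
  shows "basis_vec (1, 2) = plvec n 1 (unit_col 1, unit_col 2)"
    "basis_vec (1, n + 1) = plvec n 1 (unit_col 1, unit_col 0)"
  using assms
  by (auto simp: basis_vec_def plvec_def unit_col_def minor_def W_basis_def fun_eq_iff)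

lemma chart_word_letters:
  assumes "s \<le> 1" "n \<ge> 2" "\<And>k. k \<in> {s+1..s+2*n-2} \<Longrightarrow> x k \<noteq> 0"
  shows "\<forall>(k, c)\<in>set (zip (chart_word s n) (map x (chart_subs s n))). k \<le> n \<and> c \<noteq> 0"
proof (rule ballI)
  fix p assume p: "p \<in> set (zip (chart_word s n) (map x (chart_subs s n)))"
  obtain k c where kc: "p = (k, c)" by fastforce
  have "k \<in> set (chart_word s n)" "c \<in> x ` set (chart_subs s n)"
    using p unfolding kc by (auto dest: set_zip_leftD set_zip_rightD)
  then show "case p of (k, c) \<Rightarrow> k \<le> n \<and> c \<noteq> 0"
    using assms unfolding kc by (auto simp: chart_word_def chart_subs_def)
qed

lemma V1_plvec:
  assumes n: "n \<ge> 2" and x: "\<And>k. k \<in> {2..2*n-1} \<Longrightarrow> x k \<noteq> 0"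
  shows "V1 n x = plvec n 1 (frame1 n x)"
proof -
  let ?F = "foldr (\<lambda>(k, c). Y_col n k c) (zip (chart_word 1 n) (map x (chart_subs 1 n)))"
  have "V1 n x = plvec n 1 (?F (unit_col 1), ?F (unit_col 2))"
    unfolding V1_def basis_vec_plvec(1)[OF n]
    using n x Y_word_plvec[OF n chart_word_letters[of 1 n x]] by (simp add: word1_chart)
  also have "\<dots> = plvec n 1 (frame1 n x)"
  proof (rule plvec_cong)
    \<comment> \<open>Letter \<open>n\<close> is split off because it feeds column 0, outside the
      range of \<open>fold_Y_col\<close>.\<close>
    have "[2..<Suc n] = [2..<n] @ [n]" using n by simp
    then have F: "?F a = fold (\<lambda>l. Y_col n l (x (n + l))) [1..<n]
      (Y_col n n (x n) (fold (\<lambda>l. Y_col n l (x l)) [2..<n] a))" for a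
      using n by (subst foldr_chart_word) (simp_all add: numeral_2_eq_2)
    have 1: "Y_col n n (x n) (fold (\<lambda>l. Y_col n l (x l)) [2..<n] (unit_col 1)) = unit_col 1"
      using n x[of n] by (subst fold_Y_col) (auto simp: fun_eq_iff Y_col_def unit_col_def next_idx_def)
    have 2: "Y_col n n (x n) (fold (\<lambda>l. Y_col n l (x l)) [2..<n] (unit_col 2)) =
      (\<lambda>l. if l = 0 then 1 else if 2 \<le> l \<and> l \<le> n then x l else 0)"
      using n x[of n] by (subst fold_Y_col) (auto simp: fun_eq_iff Y_col_def unit_col_def next_idx_def)
    define b where "b = (\<lambda>l. if l = 0 then 1 else if 2 \<le> l \<and> l \<le> n then x l else 0)"
    have A: "?F (unit_col 1) = (\<lambda>l. if l < 1 \<or> n < l then unit_col 1 l else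
      (if l < n then x (n + l) else 1) * (unit_col 1 1 + (\<Sum>m=1+1..l. unit_col 1 m / x (n + (m - 1)))))"
      unfolding F 1 using n by (intro fold_Y_col) auto
    have B: "?F (unit_col 2) = (\<lambda>l. if l < 1 \<or> n < l then b l else
      (if l < n then x (n + l) else 1) * (b 1 + (\<Sum>m=1+1..l. b m / x (n + (m - 1)))))"
      unfolding F 2 b_def[symmetric] using n by (intro fold_Y_col) auto
    show "fst (?F (unit_col 1), ?F (unit_col 2)) l = fst (frame1 n x) l" if "l \<le> n" for l
      unfolding fst_conv A using n that by (auto simp: unit_col_def frame1_def)
    show "snd (?F (unit_col 1), ?F (unit_col 2)) l = snd (frame1 n x) l" if "l \<le> n" for l
      unfolding snd_conv B b_def using n that
      by (auto simp: frame1_def numeral_2_eq_2 intro!: sum.cong)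
  qed
  finally show ?thesis .
qed

lemma V2_plvec:
  assumes n: "n \<ge> 2" and y: "\<And>k. k \<in> {1..2*n-2} \<Longrightarrow> y k \<noteq> 0"
  shows "V2 n y = plvec n 1 (frame2 n y)"
proof -
  let ?F = "foldr (\<lambda>(k, c). Y_col n k c) (zip (chart_word 0 n) (map y (chart_subs 0 n)))"
  have "V2 n y = plvec n 1 (?F (unit_col 1), ?F (unit_col 0))"
    unfolding V2_def basis_vec_plvec(2)[OF n]
    using n y Y_word_plvec[OF n chart_word_letters[of 0 n y]] by (simp add: word2_chart)
  also have "\<dots> = plvec n 1 (frame2 n y)"
  proof (rule plvec_cong)
    \<comment> \<open>Letter 0 is split off because of its sign.\<close>
    have "[0..<n-1] = 0 # [1..<n-1]" using n by (simp add: upt_conv_Cons)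
    then have F: "?F a = fold (\<lambda>l. Y_col n l (y (n + l))) [1..<n-1]
      (Y_col n 0 (y n) (fold (\<lambda>l. Y_col n l (y l)) [1..<n] a))" for a
      using n by (subst foldr_chart_word) simp_all
    have 1: "Y_col n 0 (y n) (fold (\<lambda>l. Y_col n l (y l)) [1..<n] (unit_col 1)) =
      (\<lambda>l. if l = 0 \<or> n < l then 0 else if l = n then 1 else if l = 1 then y 1 / y n else y l)"
      using n by (subst fold_Y_col) (auto simp: fun_eq_iff Y_col_def unit_col_def next_idx_def)
    have 2: "Y_col n 0 (y n) (fold (\<lambda>l. Y_col n l (y l)) [1..<n] (unit_col 0)) =
      (\<lambda>l. if l = 0 then y n else if l = 1 then -1 else 0)"
      using n by (subst fold_Y_col) (auto simp: fun_eq_iff Y_col_def unit_col_def next_idx_def)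
    define a where "a = (\<lambda>l. if l = 0 \<or> n < l then 0 else if l = n then 1 else if l = 1 then y 1 / y n else y l)"
    define b where "b = (\<lambda>l::nat. if l = 0 then y n else if l = 1 then -1 else (0::complex))"
    have A: "?F (unit_col 1) = (\<lambda>l. if l < 1 \<or> n - 1 < l then a l else
      (if l < n - 1 then y (n + l) else 1) * (a 1 + (\<Sum>m=1+1..l. a m / y (n + (m - 1)))))"
      unfolding F 1 a_def[symmetric] using n by (intro fold_Y_col) auto
    have B: "?F (unit_col 0) = (\<lambda>l. if l < 1 \<or> n - 1 < l then b l else
      (if l < n - 1 then y (n + l) else 1) * (b 1 + (\<Sum>m=1+1..l. b m / y (n + (m - 1)))))"
      unfolding F 2 b_def[symmetric] using n by (intro fold_Y_col) auto
    show "fst (?F (unit_col 1), ?F (unit_col 0)) l = fst (frame2 n y) l" if "l \<le> n" for l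
      unfolding fst_conv A a_def using n that
      by (auto simp: frame2_def numeral_2_eq_2 intro!: sum.cong)
    show "snd (?F (unit_col 1), ?F (unit_col 0)) l = snd (frame2 n y) l" if "l \<le> n" for l
      unfolding snd_conv B b_def using n that by (auto simp: frame2_def)
  qed
  finally show ?thesis .
qed

section \<open>The two charts\<close>

text \<open>The minors that occur in the fractions of \<open>coords1\<close>. The condition
  \<open>generic2\<close> below is its rotation by one column, with column \<open>n\<close>
  distinguished in place of 0.\<close>

definition generic1 :: "nat \<Rightarrow> config \<Rightarrow> bool" where
  "generic1 n M \<longleftrightarrow> (\<forall>l\<in>{1..n}. minor M l 0 \<noteq> 0) \<and> (\<forall>l\<in>{2..n}. minor M (l - 1) l \<noteq> 0)"

definition generic2 :: "nat \<Rightarrow> config \<Rightarrow> bool" where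
  "generic2 n M \<longleftrightarrow> (\<forall>l\<in>{1..<n}. minor M l n \<noteq> 0) \<and> (\<forall>l\<in>{2..<n}. minor M (l - 1) l \<noteq> 0)
     \<and> minor M n 0 \<noteq> 0 \<and> minor M 1 0 \<noteq> 0"

definition point1 :: "nat \<Rightarrow> config \<Rightarrow> wvec" where
  "point1 n M = plvec n (minor M n 0) M"

definition point2 :: "nat \<Rightarrow> config \<Rightarrow> wvec" where
  "point2 n M = plvec n (minor M (n - 1) n) M"

text \<open>Ratios of minors that recover \<open>x\<close> from \<open>frame1 n x\<close>. They
  ignore a common factor of all minors, hence depend only on the point.\<close>

definition coords1 :: "nat \<Rightarrow> config \<Rightarrow> nat \<Rightarrow> complex" where
  "coords1 n M k = (if 2 \<le> k \<and> k \<le> n then minor M (k - 1) k / minor M k 0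
     else if n + 1 \<le> k \<and> k \<le> 2 * n - 1 then minor M (k - n) 0 / minor M n 0 else 0)"

definition coords2 :: "nat \<Rightarrow> config \<Rightarrow> nat \<Rightarrow> complex" where
  "coords2 n M k = (if k = 1 then minor M 1 0 / minor M 1 n
     else if 2 \<le> k \<and> k \<le> n - 1 then minor M (k - 1) k / minor M k n
     else if k = n then minor M n 0 / minor M (n - 1) n
     else if n + 1 \<le> k \<and> k \<le> 2 * n - 2 then minor M (k - n) n / minor M (n - 1) n else 0)"

text \<open>The right-hand side is a difference of slopes once column \<open>r\<close> is moved to a
  coordinate axis, so it is additive along a chain of columns; additivity is the Pluecker
  relation.\<close>

lemma minor_telescope:
  assumes "a \<le> b" "\<And>l. a \<le> l \<Longrightarrow> l \<le> b \<Longrightarrow> minor M l r \<noteq> 0"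
  shows "(\<Sum>m=a+1..b. minor M (m - 1) m / (minor M m r * minor M (m - 1) r)) =
    minor M a b / (minor M a r * minor M b r)"
  using assms
proof (induction b rule: dec_induct)
  case (step b)
  then have nz: "minor M a r \<noteq> 0" "minor M b r \<noteq> 0" "minor M (Suc b) r \<noteq> 0" by auto
  have "minor M a b * minor M (Suc b) r + minor M b (Suc b) * minor M a r =
    minor M a (Suc b) * minor M b r"
    by (simp add: minor_def algebra_simps)
  moreover have "minor M a b / (minor M a r * minor M b r) + minor M b (Suc b) / (minor M (Suc b) r * minor M b r)
    = (minor M a b * minor M (Suc b) r + minor M b (Suc b) * minor M a r) /
      (minor M a r * minor M b r * minor M (Suc b) r)"
    using nz by (simp add: field_simps)
  ultimately show ?case using step nz by simp
qed simp

text \<open>The vector records each pair of columns in one order; antisymmetry supplies the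
  other.\<close>

lemma plvec_eq_imp_prop:
  assumes "s \<noteq> 0" "s' \<noteq> 0" "plvec n s M = plvec n s' M'"
  shows "minors_prop n (s' / s) M M'"
proof -
  have up: "minor M' i (if j = n + 1 then 0 else j) = s' / s * minor M i (if j = n + 1 then 0 else j)"
    if "1 \<le> i" "i < j" "j \<le> n + 1" for i j
    using fun_cong[OF assms(3), of "(i, j)"] that assms(1,2)
    by (simp add: plvec_def W_basis_def field_simps split: if_splits)
  have "minor M' k l = s' / s * minor M k l" if "k \<le> n" "l \<le> n" for k l
  proof -
    have z: "minor M' i 0 = s' / s * minor M i 0" if "1 \<le> i" "i \<le> n" for i
      using up[of i "n + 1"] that by simp
    have p: "minor M' i j = s' / s * minor M i j" if "1 \<le> i" "i < j" "j \<le> n" for i j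
      using up[of i j] that by simp
    consider "k = l" | "l = 0" "k > 0" | "k = 0" "l > 0" | "1 \<le> k" "k < l" | "1 \<le> l" "l < k" by linarith
    then show ?thesis
    proof cases
      case 3 then show ?thesis using z[of l] that minor_swap[of M k l] minor_swap[of M' k l] by simp
    next
      case 5 then show ?thesis using p[of l k] that minor_swap[of M k l] minor_swap[of M' k l] by simp
    qed (use that z p in auto)
  qed
  then show ?thesis using assms(1,2) by (simp add: minors_prop_def)
qed

lemma plvec_minors_prop: "minors_prop n r M M' \<Longrightarrow> plvec n (r * s) M' = plvec n s M"
  by (auto simp: minors_prop_def plvec_def W_basis_def fun_eq_iff)

lemma minors_propD: "minors_prop n r M M' \<Longrightarrow> k \<le> n \<Longrightarrow> l \<le> n \<Longrightarrow> minor M' k l = r * minor M k l"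
  by (auto simp: minors_prop_def)

lemma minors_prop_nz: "minors_prop n r M M' \<Longrightarrow> r \<noteq> 0"
  by (auto simp: minors_prop_def)

context
  fixes n :: nat
  assumes n: "n \<ge> 2"
begin

lemma minors_prop_invariants:
  assumes "minors_prop n r M M'"
  shows "generic1 n M' \<longleftrightarrow> generic1 n M" "generic2 n M' \<longleftrightarrow> generic2 n M"
    "coords1 n M' = coords1 n M" "coords2 n M' = coords2 n M"
    "point1 n M' = point1 n M" "point2 n M' = point2 n M"
proof -
  note r = minors_prop_nz[OF assms] and m = minors_propD[OF assms]
  show "generic1 n M' \<longleftrightarrow> generic1 n M" "generic2 n M' \<longleftrightarrow> generic2 n M"
    unfolding generic1_def generic2_def
    by (intro conj_cong ball_cong refl; use n r in \<open>subst m; auto\<close>)+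
  show "coords1 n M' = coords1 n M" "coords2 n M' = coords2 n M"
    using n r by (auto simp: coords1_def coords2_def m fun_eq_iff)
  show "point1 n M' = point1 n M" "point2 n M' = point2 n M"
    using n by (auto simp: point1_def point2_def m plvec_minors_prop[OF assms])
qed

lemma point1_eq_imp:
  assumes "generic1 n M" "generic1 n M'" "point1 n M = point1 n M'"
  obtains r where "minors_prop n r M M'"
proof -
  have "minor M n 0 \<noteq> 0" "minor M' n 0 \<noteq> 0" using assms n by (auto simp: generic1_def)
  from plvec_eq_imp_prop[OF this] that assms(3) show thesis unfolding point1_def by blast
qed

lemma point2_eq_imp:
  assumes "generic2 n M" "generic2 n M'" "point2 n M = point2 n M'"
  obtains r where "minors_prop n r M M'"
proof -
  have "minor M (n - 1) n \<noteq> 0" "minor M' (n - 1) n \<noteq> 0" using assms n by (auto simp: generic2_def)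
  from plvec_eq_imp_prop[OF this] that assms(3) show thesis unfolding point2_def by blast
qed

lemma T1_nz: "x \<in> T1 n \<Longrightarrow> 2 \<le> k \<Longrightarrow> k \<le> 2 * n - 1 \<Longrightarrow> x k \<noteq> 0"
  by (auto simp: T1_def torus_def)

lemma T1_zero: "x \<in> T1 n \<Longrightarrow> \<not> (2 \<le> k \<and> k \<le> 2 * n - 1) \<Longrightarrow> x k = 0"
  by (auto simp: T1_def torus_def aff_space_def)

lemma T2_nz: "y \<in> T2 n \<Longrightarrow> 1 \<le> k \<Longrightarrow> k \<le> 2 * n - 2 \<Longrightarrow> y k \<noteq> 0"
  by (auto simp: T2_def torus_def)

lemma T2_zero: "y \<in> T2 n \<Longrightarrow> \<not> (1 \<le> k \<and> k \<le> 2 * n - 2) \<Longrightarrow> y k = 0"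
  by (auto simp: T2_def torus_def aff_space_def)

section \<open>The first chart: \<open>V1\<close> is a bijection between the torus and the generic
  configurations up to proportionality\<close>

lemma frame1_minors:
  assumes "x \<in> T1 n"
  shows "1 \<le> l \<Longrightarrow> l \<le> n \<Longrightarrow> minor (frame1 n x) l 0 = (if l < n then x (n + l) else 1)"
    "2 \<le> l \<Longrightarrow> l \<le> n \<Longrightarrow> minor (frame1 n x) (l - 1) l = x l * (if l < n then x (n + l) else 1)"
proof -
  show "1 \<le> l \<Longrightarrow> l \<le> n \<Longrightarrow> minor (frame1 n x) l 0 = (if l < n then x (n + l) else 1)"
    by (simp add: minor_def frame1_def)
  assume l: "2 \<le> l" "l \<le> n"
  then obtain m where m: "l = Suc m" "1 \<le> m" by (cases l) auto
  have "x (n + m) \<noteq> 0" using T1_nz[OF assms, of "n + m"] l m n by auto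
  then show "minor (frame1 n x) (l - 1) l = x l * (if l < n then x (n + l) else 1)"
    using l m by (auto simp: minor_def frame1_def field_simps)
qed

lemma frame1_chart:
  assumes "x \<in> T1 n"
  shows "generic1 n (frame1 n x)" "coords1 n (frame1 n x) = x" "point1 n (frame1 n x) = V1 n x"
proof -
  show "generic1 n (frame1 n x)"
    using n T1_nz[OF assms] by (auto simp: generic1_def frame1_minors[OF assms, simplified])
  show "coords1 n (frame1 n x) = x"
  proof
    fix k
    consider "2 \<le> k" "k \<le> n" | "n + 1 \<le> k" "k \<le> 2 * n - 1" | "\<not> (2 \<le> k \<and> k \<le> 2 * n - 1)" by linarith
    then show "coords1 n (frame1 n x) k = x k"
    proof cases
      case 1
      then have "(if k < n then x (n + k) else 1) \<noteq> 0" using n T1_nz[OF assms, of "n + k"] by auto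
      then show ?thesis
        using frame1_minors[OF assms, of k] 1 by (simp add: coords1_def)
    next
      case 2
      then show ?thesis
        using frame1_minors(1)[OF assms, of "k - n"] frame1_minors(1)[OF assms, of n] n
        by (auto simp: coords1_def)
    next
      case 3
      then show ?thesis using T1_zero[OF assms 3] n by (auto simp: coords1_def)
    qed
  qed
  show "point1 n (frame1 n x) = V1 n x"
    using n frame1_minors(1)[OF assms, of n] V1_plvec[OF n, of x] T1_nz[OF assms]
    by (simp add: point1_def)
qed

text \<open>By telescoping, the columns of \<open>frame1 n (coords1 n M)\<close> are
  \<open>minor M l 0 / minor M n 0\<close> and \<open>minor M 1 l / minor M 1 0\<close>. That is
  \<open>M\<close> after a row operation taking column 0 to (0, 1), so all minors change by one
  scalar.\<close>

lemma coords1_chart: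
  assumes "generic1 n M"
  shows "coords1 n M \<in> T1 n" "V1 n (coords1 n M) = point1 n M"
    "minors_prop n (1 / minor M n 0) M (frame1 n (coords1 n M))"
proof -
  have z: "minor M l 0 \<noteq> 0" if "1 \<le> l" "l \<le> n" for l using assms that by (auto simp: generic1_def)
  have d: "minor M (l - 1) l \<noteq> 0" if "2 \<le> l" "l \<le> n" for l using assms that by (auto simp: generic1_def)
  show T: "coords1 n M \<in> T1 n"
    using n z d[simplified] by (auto simp: T1_def torus_def aff_space_def coords1_def)
  have f: "fst (frame1 n (coords1 n M)) l = minor M l 0 / minor M n 0" if "l \<le> n" for l
    using that n z[of n] by (auto simp: frame1_def coords1_def)
  have s: "snd (frame1 n (coords1 n M)) l = minor M 1 l / minor M 1 0" if l: "l \<le> n" for l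
  proof (cases "l = 0")
    case True
    then show ?thesis using z[of 1] n by (simp add: frame1_def)
  next
    case False
    have "(\<Sum>m=2..l. coords1 n M m / coords1 n M (n + m - 1)) =
      (\<Sum>m=1+1..l. minor M (m - 1) m / (minor M m 0 * minor M (m - 1) 0)) * minor M n 0"
      unfolding sum_distrib_right using l n z
      by (intro sum.cong) (auto simp: coords1_def numeral_2_eq_2)
    also have "\<dots> = minor M 1 l / (minor M 1 0 * minor M l 0) * minor M n 0"
      using False l z by (subst minor_telescope) auto
    finally show ?thesis
      using False l z[of l] z[of n] n by (auto simp: frame1_def coords1_def field_simps)
  qed
  show P: "minors_prop n (1 / minor M n 0) M (frame1 n (coords1 n M))"
    unfolding minors_prop_def
  proof (intro conjI allI impI)
    fix k l assume kl: "k \<le> n" "l \<le> n"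
    have nz: "minor M n 0 \<noteq> 0" "minor M 1 0 \<noteq> 0" using z[of n] z[of 1] n by auto
    have "minor (frame1 n (coords1 n M)) k l =
      (minor M k 0 * minor M 1 l - minor M l 0 * minor M 1 k) / (minor M n 0 * minor M 1 0)"
      unfolding minor_def[of "frame1 n (coords1 n M)"] f[OF kl(1)] f[OF kl(2)] s[OF kl(1)] s[OF kl(2)]
      using nz by (simp add: field_simps)
    also have "minor M k 0 * minor M 1 l - minor M l 0 * minor M 1 k = minor M k l * minor M 1 0"
      by (simp add: minor_def algebra_simps)
    finally show "minor (frame1 n (coords1 n M)) k l = 1 / minor M n 0 * minor M k l"
      using nz by simp
  qed (use z[of n] n in simp)
  show "V1 n (coords1 n M) = point1 n M"
    using frame1_chart(3)[OF T] minors_prop_invariants(5)[OF P] by simp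
qed

lemma \<V>1_eq: "\<V>1 n = point1 n ` {M. generic1 n M}"
proof (intro equalityI subsetI)
  fix v assume "v \<in> \<V>1 n"
  then obtain x where "x \<in> T1 n" "v = V1 n x" by (auto simp: \<V>1_def)
  then show "v \<in> point1 n ` {M. generic1 n M}" using frame1_chart[of x] by (metis imageI mem_Collect_eq)
next
  fix v assume "v \<in> point1 n ` {M. generic1 n M}"
  then obtain M where "generic1 n M" "v = point1 n M" by blast
  then show "v \<in> \<V>1 n" unfolding \<V>1_def using coords1_chart[of M] by (metis imageI)
qed

text \<open>Equal points have proportional configurations, and \<open>coords1\<close> returns the
  same value on those.\<close>

lemma inj_V1: "inj_on (V1 n) (T1 n)"
proof (rule inj_onI)
  fix x x' assume *: "x \<in> T1 n" "x' \<in> T1 n" "V1 n x = V1 n x'"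
  then obtain r where "minors_prop n r (frame1 n x) (frame1 n x')"
    by (metis frame1_chart(1,3) point1_eq_imp)
  then show "x = x'" using minors_prop_invariants(3) frame1_chart(2) * by metis
qed

lemma params1_V1: "x \<in> T1 n \<Longrightarrow> params1 n (V1 n x) = x"
  unfolding params1_def by (rule the_inv_into_f_f[OF inj_V1])

lemma params1_point1: "generic1 n M \<Longrightarrow> params1 n (point1 n M) = coords1 n M"
  using params1_V1 coords1_chart by metis

section \<open>The second chart, with column \<open>n\<close> distinguished\<close>

lemma frame2_minors:
  assumes "y \<in> T2 n"
  shows "1 \<le> l \<Longrightarrow> l < n \<Longrightarrow> minor (frame2 n y) l n = (if l < n - 1 then y (n + l) else 1)"
    "2 \<le> l \<Longrightarrow> l < n \<Longrightarrow> minor (frame2 n y) (l - 1) l = y l * (if l < n - 1 then y (n + l) else 1)"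
    "minor (frame2 n y) n 0 = y n"
    "minor (frame2 n y) 1 0 = y 1 * (if n = 2 then 1 else y (n + 1))"
proof -
  show "1 \<le> l \<Longrightarrow> l < n \<Longrightarrow> minor (frame2 n y) l n = (if l < n - 1 then y (n + l) else 1)"
    by (simp add: minor_def frame2_def)
  show "minor (frame2 n y) n 0 = y n" using n by (simp add: minor_def frame2_def)
  show "minor (frame2 n y) 1 0 = y 1 * (if n = 2 then 1 else y (n + 1))"
    using n T2_nz[OF assms, of n] by (auto simp: minor_def frame2_def)
  assume l: "2 \<le> l" "l < n"
  then obtain m where m: "l = Suc m" "1 \<le> m" by (cases l) auto
  have "y (n + m) \<noteq> 0" using T2_nz[OF assms, of "n + m"] l m n by auto
  then show "minor (frame2 n y) (l - 1) l = y l * (if l < n - 1 then y (n + l) else 1)"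
    using l m by (auto simp: minor_def frame2_def field_simps)
qed

lemma frame2_chart:
  assumes "y \<in> T2 n"
  shows "generic2 n (frame2 n y)" "coords2 n (frame2 n y) = y" "point2 n (frame2 n y) = V2 n y"
proof -
  show "generic2 n (frame2 n y)"
    using n T2_nz[OF assms] by (auto simp: generic2_def frame2_minors[OF assms, simplified])
  have n1: "minor (frame2 n y) (n - 1) n = 1" using frame2_minors(1)[OF assms, of "n - 1"] n by simp
  show "coords2 n (frame2 n y) = y"
  proof
    fix k
    consider "k = 1" | "2 \<le> k" "k \<le> n - 1" | "k = n" | "n + 1 \<le> k" "k \<le> 2 * n - 2"
      | "\<not> (1 \<le> k \<and> k \<le> 2 * n - 2)" by linarith
    then show "coords2 n (frame2 n y) k = y k"
    proof cases
      case 1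
      then show ?thesis
        using frame2_minors(4)[OF assms] frame2_minors(1)[OF assms, of 1] n T2_nz[OF assms, of "n + 1"]
        by (auto simp: coords2_def)
    next
      case 2
      then have "(if k < n - 1 then y (n + k) else 1) \<noteq> 0" using n T2_nz[OF assms, of "n + k"] by auto
      then show ?thesis
        using frame2_minors(1,2)[OF assms, of k] 2 by (simp add: coords2_def)
    next
      case 3
      then show ?thesis using n n1 frame2_minors(3)[OF assms] by (auto simp: coords2_def)
    next
      case 4
      then show ?thesis
        using frame2_minors(1)[OF assms, of "k - n"] n n1 by (auto simp: coords2_def)
    next
      case 5
      then show ?thesis using T2_zero[OF assms 5] n by (auto simp: coords2_def)
    qed
  qed
  show "point2 n (frame2 n y) = V2 n y"
    using n n1 V2_plvec[OF n, of y] T2_nz[OF assms] by (simp add: point2_def)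
qed

text \<open>As in the first chart, now with columns \<open>minor M l 0 / minor M n 0\<close> and
  \<open>minor M n l / minor M (n - 1) n\<close>.\<close>

lemma coords2_chart:
  assumes "generic2 n M"
  shows "coords2 n M \<in> T2 n" "V2 n (coords2 n M) = point2 n M"
proof -
  have z: "minor M l n \<noteq> 0" if "1 \<le> l" "l < n" for l using assms that by (auto simp: generic2_def)
  have d: "minor M (l - 1) l \<noteq> 0" if "2 \<le> l" "l < n" for l using assms that by (auto simp: generic2_def)
  have e: "minor M n 0 \<noteq> 0" "minor M 1 0 \<noteq> 0" using assms by (auto simp: generic2_def)
  show T: "coords2 n M \<in> T2 n"
    using n z d[simplified] e by (auto simp: T2_def torus_def aff_space_def coords2_def)
  have s: "snd (frame2 n (coords2 n M)) l = minor M n l / minor M (n - 1) n" if "l \<le> n" for l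
  proof -
    consider "l = 0" | "l = n" | "l = n - 1" "l > 0" | "1 \<le> l" "l < n - 1" using \<open>l \<le> n\<close> by linarith
    then show ?thesis
      by cases (use n z[of "n - 1"] minor_swap[of M n l] in \<open>auto simp: frame2_def coords2_def\<close>)
  qed
  \<comment> \<open>The telescoped sum starts at column 1; the term \<open>y 1 / y n\<close> brings
    in the minor of columns 1 and 0, and the Pluecker relation merges the two.\<close>
  have f: "fst (frame2 n (coords2 n M)) l = minor M l 0 / minor M n 0" if l: "l \<le> n" for l
  proof -
    consider "l = 0" | "l = n" | "1 \<le> l" "l < n" using l by linarith
    then show ?thesis
    proof cases
      case 3
      have nz: "minor M l n \<noteq> 0" "minor M 1 n \<noteq> 0" "minor M (n - 1) n \<noteq> 0"
        using z[of l] z[of 1] z[of "n - 1"] 3 n by auto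
      have w: "(if l < n - 1 then coords2 n M (n + l) else 1) = minor M l n / minor M (n - 1) n"
      proof (cases "l < n - 1")
        case False
        then have "l = n - 1" using 3 by simp
        then show ?thesis using nz by simp
      qed (use 3 n in \<open>auto simp: coords2_def\<close>)
      have "(\<Sum>m=2..l. coords2 n M m / coords2 n M (n + m - 1)) =
        (\<Sum>m=1+1..l. minor M (m - 1) m / (minor M m n * minor M (m - 1) n)) * minor M (n - 1) n"
        unfolding sum_distrib_right using 3 n z
        by (intro sum.cong) (auto simp: coords2_def numeral_2_eq_2)
      also have "\<dots> = minor M 1 l / (minor M 1 n * minor M l n) * minor M (n - 1) n"
        using 3 z by (subst minor_telescope) auto
      finally have "fst (frame2 n (coords2 n M)) l = minor M l n / minor M (n - 1) n *
        ((minor M 1 0 / minor M 1 n) / (minor M n 0 / minor M (n - 1) n)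
          + minor M 1 l / (minor M 1 n * minor M l n) * minor M (n - 1) n)"
        using 3 n w by (simp add: frame2_def coords2_def[of n M "Suc 0"] coords2_def[of n M n])
      also have "\<dots> = (minor M l n * minor M 1 0 + minor M 1 l * minor M n 0) / (minor M 1 n * minor M n 0)"
        using nz e by (simp add: field_simps)
      also have "minor M l n * minor M 1 0 + minor M 1 l * minor M n 0 = minor M l 0 * minor M 1 n"
        by (simp add: minor_def algebra_simps)
      finally show ?thesis using nz by simp
    qed (use n e in \<open>auto simp: frame2_def\<close>)
  qed
  have nz: "minor M n 0 \<noteq> 0" "minor M (n - 1) n \<noteq> 0" using z[of "n - 1"] n e by auto
  have P: "minors_prop n (1 / minor M (n - 1) n) M (frame2 n (coords2 n M))"
    unfolding minors_prop_def
  proof (intro conjI allI impI)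
    fix k l assume kl: "k \<le> n" "l \<le> n"
    have "minor (frame2 n (coords2 n M)) k l =
      (minor M k 0 * minor M n l - minor M l 0 * minor M n k) / (minor M (n - 1) n * minor M n 0)"
      unfolding minor_def[of "frame2 n (coords2 n M)"] f[OF kl(1)] f[OF kl(2)] s[OF kl(1)] s[OF kl(2)]
      using nz by (simp add: field_simps)
    also have "minor M k 0 * minor M n l - minor M l 0 * minor M n k = minor M k l * minor M n 0"
      by (simp add: minor_def algebra_simps)
    finally show "minor (frame2 n (coords2 n M)) k l = 1 / minor M (n - 1) n * minor M k l"
      using nz by simp
  qed (use nz in simp)
  show "V2 n (coords2 n M) = point2 n M"
    using frame2_chart(3)[OF T] minors_prop_invariants(6)[OF P] by simp
qed

lemma inj_V2: "inj_on (V2 n) (T2 n)"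
proof (rule inj_onI)
  fix y y' assume *: "y \<in> T2 n" "y' \<in> T2 n" "V2 n y = V2 n y'"
  then obtain r where "minors_prop n r (frame2 n y) (frame2 n y')"
    by (metis frame2_chart(1,3) point2_eq_imp)
  then show "y = y'" using minors_prop_invariants(4) frame2_chart(2) * by metis
qed

lemma params2_V2: "y \<in> T2 n \<Longrightarrow> params2 n (V2 n y) = y"
  unfolding params2_def by (rule the_inv_into_f_f[OF inj_V2])

section \<open>The map \<open>sigma\<close> on configurations\<close>

lemma tail_sum_coords1:
  assumes "generic1 n M" "1 \<le> k" "k \<le> n"
  shows "tail_sum n (coords1 n M) k = minor M k n / minor M k 0"
proof -
  have z: "minor M l 0 \<noteq> 0" if "1 \<le> l" "l \<le> n" for l using assms that by (auto simp: generic1_def)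
  have "tail_sum n (coords1 n M) k =
    (\<Sum>m=k+1..n. minor M (m - 1) m / (minor M m 0 * minor M (m - 1) 0)) * minor M n 0"
    unfolding sum_distrib_right tail_sum_def using assms n z
    by (intro sum.cong) (auto simp: coords1_def)
  also have "\<dots> = minor M k n / (minor M k 0 * minor M n 0) * minor M n 0"
    using assms z by (subst minor_telescope) auto
  finally show ?thesis using z[of n] n by simp
qed

text \<open>A tail sum equals \<open>minor M k n / minor M k 0\<close>, so it replaces a denominator
  against column 0 by one against column \<open>n\<close>. Hence \<open>sigma\<close> only changes
  the distinguished column and is the identity on configurations.\<close>

lemma sigma_params_coords1:
  assumes "generic1 n M"
  shows "sigma_params n (coords1 n M) = coords2 n M"
proof
  fix k
  have z: "minor M l 0 \<noteq> 0" if "1 \<le> l" "l \<le> n" for l using assms that by (auto simp: generic1_def)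
  note ts = tail_sum_coords1[OF assms]
  consider "k = 1" | "2 \<le> k" "k \<le> n - 1" | "k = n" | "n + 1 \<le> k" "k \<le> 2 * n - 2"
    | "\<not> (1 \<le> k \<and> k \<le> 2 * n - 2)" by linarith
  then show "sigma_params n (coords1 n M) k = coords2 n M k"
  proof cases
    case 1
    then show ?thesis using ts[of 1] n by (simp add: sigma_params_def coords2_def)
  next
    case 2
    then show ?thesis using ts[of k] n z[of k] by (simp add: sigma_params_def coords2_def coords1_def)
  next
    case 3
    then show ?thesis using n by (simp add: sigma_params_def coords2_def coords1_def)
  next
    case 4
    then show ?thesis
      using ts[of "k - n"] n z[of "k - n"] z[of n] by (auto simp: sigma_params_def coords2_def coords1_def)
  next
    case 5
    then show ?thesis using n by (auto simp: sigma_params_def coords2_def)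
  qed
qed

lemma generic12: "generic1 n M \<Longrightarrow> \<forall>k\<in>{1..<n}. minor M k n \<noteq> 0 \<Longrightarrow> generic2 n M"
  using n by (auto simp: generic1_def generic2_def)

lemma sigma_point1:
  assumes "generic1 n M"
  shows "sigma n (point1 n M) =
    (if \<forall>k\<in>{1..<n}. minor M k n \<noteq> 0 then Some (point2 n M) else None)"
proof -
  have "point1 n M \<in> \<V>1 n" using assms by (auto simp: \<V>1_eq)
  moreover have "(\<forall>k\<in>{1..n-1}. tail_sum n (coords1 n M) k \<noteq> 0) \<longleftrightarrow> (\<forall>k\<in>{1..<n}. minor M k n \<noteq> 0)"
  proof -
    have "{1..n-1} = {1..<n}" using n by auto
    moreover have "tail_sum n (coords1 n M) k \<noteq> 0 \<longleftrightarrow> minor M k n \<noteq> 0" if "k \<in> {1..<n}" for k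
      using tail_sum_coords1[OF assms, of k] that assms by (auto simp: generic1_def)
    ultimately show ?thesis by simp
  qed
  ultimately show ?thesis
    using coords2_chart(2)[OF generic12[OF assms]]
    by (simp add: sigma_def params1_point1[OF assms] sigma_params_coords1[OF assms])
qed

lemma sigma_dom: "sigma n v \<noteq> None \<Longrightarrow> v \<in> \<V>1 n"
  by (auto simp: sigma_def split: if_splits)

text \<open>Any preimage comes from a configuration proportional to \<open>N\<close>. This gives
  injectivity of \<open>sigma\<close> and at the same time shows that \<open>N\<close> lies in the
  first chart.\<close>

lemma sigma_Some_point2:
  assumes "generic2 n N" "sigma n v = Some (point2 n N)"
  shows "generic1 n N" "v = point1 n N"
proof -
  obtain M where M: "generic1 n M" "v = point1 n M"
    using sigma_dom[of v] assms(2) by (auto simp: \<V>1_eq)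
  then have *: "\<forall>k\<in>{1..<n}. minor M k n \<noteq> 0" "point2 n M = point2 n N"
    using sigma_point1[of M] assms(2) by (auto split: if_splits)
  obtain r where "minors_prop n r M N"
    using point2_eq_imp[OF generic12[OF M(1) *(1)] assms(1) *(2)] by blast
  then show "generic1 n N" "v = point1 n N" using minors_prop_invariants M by auto
qed

text \<open>The domain of the inverse is determined exactly, because it is part of the domain of
  \<open>aff_e n 0\<close>.\<close>

lemma partial_inv_sigma:
  assumes "generic2 n N"
  shows "partial_inv (sigma n) (point2 n N) = (if generic1 n N then Some (point1 n N) else None)"
proof (cases "generic1 n N")
  case True
  have s: "sigma n (point1 n N) = Some (point2 n N)"
    using sigma_point1[OF True] assms by (auto simp: generic2_def)
  moreover have "(THE v. sigma n v = Some (point2 n N)) = point1 n N"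
    using s sigma_Some_point2(2)[OF assms] by blast
  ultimately show ?thesis using True by (auto simp: partial_inv_def intro: ranI)
next
  case False
  then have "point2 n N \<notin> ran (sigma n)"
    using sigma_Some_point2(1)[OF assms] by (auto simp: ran_def)
  then show ?thesis using False by (simp add: partial_inv_def)
qed

end

section \<open>Crystal data of the charts\<close>

lemma cartan_eq:
  assumes "i \<le> n" "j \<le> n"
  shows "cartan n j i = (if j = i then 2 else if j = next_idx n i \<or> j = prev_idx n i then -1 else 0)"
proof -
  have "j mod (n + 1) = j" "i mod (n + 1) = i" "(i + 1) mod (n + 1) = next_idx n i"
    "(j + 1) mod (n + 1) = next_idx n j"
    using assms by (auto simp: next_idx_def)
  moreover have "i = next_idx n j \<longleftrightarrow> j = prev_idx n i"
    using assms by (auto simp: next_idx_def prev_idx_def)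
  ultimately show ?thesis unfolding cartan_def by auto
qed

text \<open>Encodes the convention that a letter absent from \<open>A\<close> has parameter
  1.\<close>

definition ext_one :: "nat set \<Rightarrow> (nat \<Rightarrow> complex) \<Rightarrow> nat \<Rightarrow> complex" where
  "ext_one A z j = (if j \<in> A then z j else 1)"

text \<open>Only \<open>i\<close> and its two cyclic neighbours contribute, and for n \<ge> 2 these
  are three different indices.\<close>

lemma prod_cartan:
  assumes "n \<ge> 2" "i \<le> n" "A \<subseteq> {..n}" "\<And>j. j \<in> A \<Longrightarrow> z j \<noteq> 0"
  shows "(\<Prod>j\<in>A. z j powi cartan n j i) =
    (ext_one A z i)\<^sup>2 / (ext_one A z (prev_idx n i) * ext_one A z (next_idx n i))"
proof -
  note d = idx_distinct[OF assms(1,2)]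
  have fin: "finite A" using assms(3) finite_subset by blast
  have "(\<Prod>j\<in>A. z j powi cartan n j i) =
    (\<Prod>j\<in>A. (if j = i then (z j)\<^sup>2 else 1) * ((if j = prev_idx n i then 1 / z j else 1) *
       (if j = next_idx n i then 1 / z j else 1)))"
    using d assms(2,3) by (intro prod.cong refl) (auto simp: cartan_eq power_int_minus field_simps)
  then show ?thesis using fin by (simp add: prod.distrib ext_one_def)
qed

section \<open>Positions and prefix products in the chart words\<close>

lemma chart_length [simp]: "length (chart_subs s n) = 2 * n - 2" "length (chart_word s n) = 2 * n - 2"
  by (auto simp: chart_subs_def chart_word_def)

lemma chart_subs_nth: "m < 2 * n - 2 \<Longrightarrow> chart_subs s n ! m = s + 2 * n - 2 - m"
  by (auto simp: chart_subs_def rev_nth)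

lemma chart_word_nth:
  "m < 2 * n - 2 \<Longrightarrow> chart_word s n ! m = (if m < n - 1 then s + n - 2 - m else s + 2 * n - 2 - m)"
  by (auto simp: chart_word_def nth_append rev_nth)

text \<open>The alternatives are the occurrences in the first and the second half. For
  \<open>s = 1\<close> the letters 1 and \<open>n\<close> occur once and those between them twice;
  for \<open>s = 0\<close> the letter 0 occurs once.\<close>

lemma occ_chart:
  "occ (chart_word s n) i = {m. (s \<le> i \<and> i + 2 \<le> s + n \<and> m = s + n - 2 - i) \<or>
    (s + 1 \<le> i \<and> i < s + n \<and> m = s + 2 * n - 2 - i)}"
proof (rule set_eqI)
  fix m
  show "m \<in> occ (chart_word s n) i \<longleftrightarrow> m \<in> {m. (s \<le> i \<and> i + 2 \<le> s + n \<and> m = s + n - 2 - i) \<or>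
    (s + 1 \<le> i \<and> i < s + n \<and> m = s + 2 * n - 2 - i)}"
  proof -
    consider "m < n - 1" | "n - 1 \<le> m" "m < 2 * n - 2" | "2 * n - 2 \<le> m" by linarith
    then show ?thesis
      by cases (auto simp: occ_def chart_word_nth)
  qed
qed

lemma prefix_prod1:
  assumes "m \<le> n - 1"
  shows "(\<Prod>l<m. (map x (chart_subs s n) ! l) powi a (chart_word s n ! l) i) =
    (\<Prod>j\<in>{s+n-1-m..<s+n-1}. x (n + j) powi a j i)"
proof (rule prod.reindex_bij_witness[where i = "\<lambda>j. s + n - 2 - j" and j = "\<lambda>l. s + n - 2 - l"])
  fix l assume "l \<in> {..<m}"
  then have l: "l < n - 1" "l < 2 * n - 2" "n + (s + n - 2 - l) = s + 2 * n - 2 - l" using assms by auto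
  show "x (n + (s + n - 2 - l)) powi a (s + n - 2 - l) i =
    (map x (chart_subs s n) ! l) powi a (chart_word s n ! l) i"
    using l by (simp add: chart_subs_nth chart_word_nth)
qed (use assms in auto)

lemma prefix_prod2:
  assumes "r \<le> n - 1"
  shows "(\<Prod>l<n-1+r. (map x (chart_subs s n) ! l) powi a (chart_word s n ! l) i) =
    (\<Prod>j\<in>{s..<s+n-1}. x (n + j) powi a j i) * (\<Prod>j\<in>{s+n-r..<s+n}. x j powi a j i)"
proof -
  let ?f = "\<lambda>l. (map x (chart_subs s n) ! l) powi a (chart_word s n ! l) i"
  have U: "{..<n-1+r} = {..<n-1} \<union> {n-1..<n-1+r}" by auto
  have "prod ?f {..<n-1+r} = prod ?f {..<n-1} * prod ?f {n-1..<n-1+r}"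
    unfolding U by (rule prod.union_disjoint) auto
  \<comment> \<open>The alternative \<open>n = 0\<close> accounts for truncated subtraction.\<close>
  moreover have "s + n - 1 - (n - 1) = s \<or> n = 0" by auto
  then have "prod ?f {..<n-1} = (\<Prod>j\<in>{s..<s+n-1}. x (n + j) powi a j i)"
    using prefix_prod1[of "n - 1" n x s a i] by (cases "n = 0") auto
  moreover have "prod ?f {n-1..<n-1+r} = (\<Prod>j\<in>{s+n-r..<s+n}. x j powi a j i)"
  proof (rule prod.reindex_bij_witness[where i = "\<lambda>j. s + 2 * n - 2 - j" and j = "\<lambda>l. s + 2 * n - 2 - l"])
    fix l assume "l \<in> {n-1..<n-1+r}"
    then have l: "\<not> l < n - 1" "l < 2 * n - 2" using assms by auto
    show "x (s + 2 * n - 2 - l) powi a (s + 2 * n - 2 - l) i = ?f l"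
      using l by (simp add: chart_subs_nth chart_word_nth)
  qed (use assms in auto)
  ultimately show ?thesis by simp
qed

text \<open>With one occurrence, numerator and denominator cancel at every position except
  \<open>m\<close>.\<close>

lemma word_e_single:
  assumes "occ w i = {m}" "word_A a w cs i m \<noteq> 0" "c \<noteq> 0"
  shows "word_e a w i c cs =
    Some (map (\<lambda>j. cs ! j * (if j = m then c else 1)) [0..<length w])"
proof -
  have num: "word_num a w i c cs j = (if m \<le> j then c else 1) * word_A a w cs i m" for j
    by (auto simp: word_num_def assms(1))
  have den: "word_den a w i c cs j = (if m < j then c else 1) * word_A a w cs i m" for j
    by (auto simp: word_den_def assms(1))
  show ?thesis using assms(2,3) by (auto simp: word_e_def num den)
qed

text \<open>Numerator and denominator are the same step function of the position, except that the
  numerator jumps at \<open>m\<close> and \<open>m'\<close> and the denominator right after them.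
  They differ at these two positions only.\<close>

lemma word_e_double:
  fixes a :: "nat \<Rightarrow> nat \<Rightarrow> int" and cs :: "complex list"
  assumes "occ w i = {m, m'}" "m < m'" "m' < length w" "c \<noteq> 0"
  defines "A \<equiv> word_A a w cs i m" and "B \<equiv> word_A a w cs i m'"
  shows "word_e a w i c cs = (if A + B \<noteq> 0 \<and> c * A + B \<noteq> 0 then
    Some (map (\<lambda>j. cs ! j * (if j = m then (c * A + B) / (A + B)
       else if j = m' then c * (A + B) / (c * A + B) else 1)) [0..<length w]) else None)"
proof -
  have num: "word_num a w i c cs j =
    (if j < m then A + B else if j < m' then c * A + B else c * (A + B))" for j
    using assms(2) by (auto simp: word_num_def assms(1) A_def B_def algebra_simps)
  have den: "word_den a w i c cs j =
    (if j \<le> m then A + B else if j \<le> m' then c * A + B else c * (A + B))" for j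
    using assms(2) by (auto simp: word_den_def assms(1) A_def B_def algebra_simps)
  have iff: "(\<forall>j<length w. word_num a w i c cs j \<noteq> 0 \<and> word_den a w i c cs j \<noteq> 0) \<longleftrightarrow>
    A + B \<noteq> 0 \<and> c * A + B \<noteq> 0"
  proof safe
    assume *: "\<forall>j<length w. word_num a w i c cs j \<noteq> 0 \<and> word_den a w i c cs j \<noteq> 0"
    have "word_num a w i c cs m \<noteq> 0" "word_den a w i c cs m \<noteq> 0"
      using *[rule_format, of m] assms(2,3) by auto
    then show "A + B = 0 \<Longrightarrow> False" "c * A + B = 0 \<Longrightarrow> False"
      using assms(2) by (auto simp: num den)
  qed (use assms(4) in \<open>auto simp: num den split: if_splits\<close>)
  show ?thesis
    unfolding word_e_def iff
    using assms(2,4) by (auto simp: num den)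
qed

lemma tuple_of_chart:
  assumes "n \<ge> 1"
  shows "tuple_of (chart_subs s n) (map h [0..<2*n-2]) =
    (\<lambda>k. if s + 1 \<le> k \<and> k \<le> s + 2 * n - 2 then h (s + 2 * n - 2 - k) else 0)"
proof
  fix k
  show "tuple_of (chart_subs s n) (map h [0..<2*n-2]) k =
    (if s + 1 \<le> k \<and> k \<le> s + 2 * n - 2 then h (s + 2 * n - 2 - k) else 0)"
  proof (cases "s + 1 \<le> k \<and> k \<le> s + 2 * n - 2")
    case True
    let ?m = "s + 2 * n - 2 - k"
    have m: "?m < 2 * n - 2" using True by auto
    have "map_of (zip (chart_subs s n) (map h [0..<2*n-2])) (chart_subs s n ! ?m) =
      Some (map h [0..<2*n-2] ! ?m)"
      using m by (intro map_of_zip_nth) (auto simp: chart_subs_def)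
    moreover have "chart_subs s n ! ?m = k" using True chart_subs_nth[OF m] by auto
    ultimately show ?thesis using True m by (simp add: tuple_of_def)
  next
    case False
    then have "k \<notin> set (chart_subs s n)" by (auto simp: chart_subs_def)
    then have N: "map_of (zip (chart_subs s n) (map h [0..<2*n-2])) k = None"
      by (subst map_of_zip_is_None) auto
    show ?thesis unfolding tuple_of_def N using False by auto
  qed
qed

lemma tuple_of_chart_mult:
  assumes "n \<ge> 1"
  shows "tuple_of (chart_subs s n) (map (\<lambda>j. map x (chart_subs s n) ! j * F j) [0..<2*n-2]) =
    (\<lambda>k. if s + 1 \<le> k \<and> k \<le> s + 2 * n - 2 then x k * F (s + 2 * n - 2 - k) else 0)"
proof -
  have "map x (chart_subs s n) ! (s + 2 * n - 2 - k) = x k" if "s + 1 \<le> k" "k \<le> s + 2 * n - 2" for k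
  proof -
    have "chart_subs s n ! (s + 2 * n - 2 - k) = k"
      by (subst chart_subs_nth) (use that in linarith)+
    then show ?thesis by (subst nth_map) (use that in auto)
  qed
  then show ?thesis unfolding tuple_of_chart[OF assms] by (auto simp: fun_eq_iff)
qed

section \<open>Crystal data of the two charts in coordinates\<close>

context
  fixes n :: nat
  assumes n: "n \<ge> 2"
begin

text \<open>The only neighbour of \<open>i\<close> that can precede its first occurrence is
  \<open>i + 1\<close>, and it enters the prefix with exponent -1.\<close>

lemma first_A:
  assumes "s \<le> 1" "s \<le> i" "i + 2 \<le> s + n" "\<And>k. s + 1 \<le> k \<Longrightarrow> k \<le> s + 2 * n - 2 \<Longrightarrow> x k \<noteq> 0"
  shows "word_A (cartan n) (chart_word s n) (map x (chart_subs s n)) i (s + n - 2 - i) =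
    (if i + 2 < s + n then x (n + i + 1) else 1) / x (n + i)"
proof -
  have eq: "s + n - 1 - (s + n - 2 - i) = i + 1" using assms by auto
  have "(\<Prod>l<s+n-2-i. (map x (chart_subs s n) ! l) powi cartan n (chart_word s n ! l) i) =
    (\<Prod>j\<in>{i+1..<s+n-1}. x (n + j) powi cartan n j i)"
    using assms by (subst prefix_prod1) (auto simp: eq)
  also have "\<dots> = 1 / (if i + 2 < s + n then x (n + i + 1) else 1)"
    using assms n by (subst prod_cartan) (auto simp: ext_one_def next_idx_def prev_idx_def)
  finally have P: "(\<Prod>l<s+n-2-i. (map x (chart_subs s n) ! l) powi cartan n (chart_word s n ! l) i) =
    1 / (if i + 2 < s + n then x (n + i + 1) else 1)" .
  have "chart_subs s n ! (s + n - 2 - i) = n + i"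
    by (subst chart_subs_nth) (use assms n in auto)
  then have N: "map x (chart_subs s n) ! (s + n - 2 - i) = x (n + i)"
    by (subst nth_map) (use assms n in auto)
  show ?thesis unfolding word_A_def P N by simp
qed

lemma first_A1:
  assumes "1 \<le> i" "i < n" "x \<in> T1 n"
  shows "word_A (cartan n) (chart_word 1 n) (map x (chart_subs 1 n)) i (n - 1 - i) =
    (if i + 1 < n then x (n + i + 1) else 1) / x (n + i)"
proof -
  have "1 + n - 2 - i = n - 1 - i" "i + 2 < 1 + n \<longleftrightarrow> i + 1 < n" by auto
  then show ?thesis
    using first_A[of 1 i x] assms(1,2) T1_nz[OF n assms(3)] by auto
qed

text \<open>The first half contributes \<open>i\<close> and both neighbours, the second half before
  \<open>i\<close> only \<open>i + 1\<close>. The conditionals give absent letters the factor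
  1.\<close>

lemma second_A:
  assumes "2 \<le> i" "i \<le> n" "x \<in> T1 n"
  shows "word_A (cartan n) (chart_word 1 n) (map x (chart_subs 1 n)) i (2 * n - 1 - i) =
    (if i + 1 \<le> n then x (i + 1) else 1) * x (n + i - 1) * (if i + 1 < n then x (n + i + 1) else 1) /
    (x i * (if i < n then x (n + i) else 1)\<^sup>2)"
proof -
  have nz: "x k \<noteq> 0" if "2 \<le> k" "k \<le> 2 * n - 1" for k using T1_nz[OF n assms(3) that] .
  have eq: "2 * n - 1 - i = n - 1 + (n - i)" "1 + n - (n - i) = i + 1" using assms by auto
  have "(\<Prod>l<2*n-1-i. (map x (chart_subs 1 n) ! l) powi cartan n (chart_word 1 n ! l) i) =
    (\<Prod>j\<in>{1..<1+n-1}. x (n + j) powi cartan n j i) * (\<Prod>j\<in>{i+1..<1+n}. x j powi cartan n j i)"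
    unfolding eq(1) using assms by (subst prefix_prod2) (auto simp: eq(2))
  also have "(\<Prod>j\<in>{1..<1+n-1}. x (n + j) powi cartan n j i) =
    (if i < n then x (n + i) else 1)\<^sup>2 / (x (n + i - 1) * (if i + 1 < n then x (n + i + 1) else 1))"
    using assms n nz by (subst prod_cartan) (auto simp: ext_one_def next_idx_def prev_idx_def)
  also have "(\<Prod>j\<in>{i+1..<1+n}. x j powi cartan n j i) = 1 / (if i + 1 \<le> n then x (i + 1) else 1)"
    using assms n nz by (subst prod_cartan) (auto simp: ext_one_def next_idx_def prev_idx_def)
  finally have P: "(\<Prod>l<2*n-1-i. (map x (chart_subs 1 n) ! l) powi cartan n (chart_word 1 n ! l) i) =
    (if i < n then x (n + i) else 1)\<^sup>2 / (x (n + i - 1) * (if i + 1 < n then x (n + i + 1) else 1)) *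
    (1 / (if i + 1 \<le> n then x (i + 1) else 1))" .
  have "chart_subs 1 n ! (2 * n - 1 - i) = i"
    by (subst chart_subs_nth) (use assms n in auto)
  then have N: "map x (chart_subs 1 n) ! (2 * n - 1 - i) = x i"
    by (subst nth_map) (use assms n in auto)
  show ?thesis unfolding word_A_def P N by (simp add: mult_ac)
qed

lemma chart_gamma:
  assumes "s \<le> 1" "i \<le> n" "\<And>k. s + 1 \<le> k \<Longrightarrow> k \<le> s + 2 * n - 2 \<Longrightarrow> x k \<noteq> 0"
  defines "z \<equiv> ext_one {s..<s+n-1} (\<lambda>j. x (n + j))" and "w \<equiv> ext_one {s+1..<s+n} x"
  shows "word_\<gamma> (cartan n) (chart_word s n) i (map x (chart_subs s n)) =
    (z i)\<^sup>2 / (z (prev_idx n i) * z (next_idx n i)) * ((w i)\<^sup>2 / (w (prev_idx n i) * w (next_idx n i)))"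
proof -
  have eq: "length (chart_word s n) = n - 1 + (n - 1)" "s + n - (n - 1) = s + 1" using n by auto
  have "word_\<gamma> (cartan n) (chart_word s n) i (map x (chart_subs s n)) =
    (\<Prod>j\<in>{s..<s+n-1}. x (n + j) powi cartan n j i) * (\<Prod>j\<in>{s+1..<s+n}. x j powi cartan n j i)"
    unfolding word_\<gamma>_def eq(1)
    by (rule prefix_prod2[of "n-1" n x s "cartan n" i, OF order_refl, unfolded eq(2)])
  also have "(\<Prod>j\<in>{s..<s+n-1}. x (n + j) powi cartan n j i) =
    (z i)\<^sup>2 / (z (prev_idx n i) * z (next_idx n i))"
    unfolding z_def by (rule prod_cartan[OF n assms(2)]) (use assms(1,3) n in auto)
  also have "(\<Prod>j\<in>{s+1..<s+n}. x j powi cartan n j i) =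
    (w i)\<^sup>2 / (w (prev_idx n i) * w (next_idx n i))"
    unfolding w_def by (rule prod_cartan[OF n assms(2)]) (use assms(1,3) n in auto)
  finally show ?thesis .
qed

lemma word1_single:
  assumes "x \<in> T1 n" "c \<noteq> 0" "occ (chart_word 1 n) i = {m}" "m < 2 * n - 2"
    "word_A (cartan n) (chart_word 1 n) (map x (chart_subs 1 n)) i m \<noteq> 0" "k = 2 * n - 1 - m"
  shows "e1 n i c (V1 n x) = Some (V1 n (x(k := c * x k)))"
proof -
  have "tuple_of (chart_subs 1 n) (map (\<lambda>j. map x (chart_subs 1 n) ! j * (if j = m then c else 1))
      [0..<2 * n - 2]) = x(k := c * x k)"
    unfolding tuple_of_chart_mult[OF le_trans[OF one_le_numeral n]]
  proof
    fix l
    have "1 + 2 * n - 2 - l = m \<longleftrightarrow> l = k" if "2 \<le> l" "l \<le> 2 * n - 1"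
      using that assms(4,6) by linarith
    then show "(if 1 + 1 \<le> l \<and> l \<le> 1 + 2 * n - 2
        then x l * (if 1 + 2 * n - 2 - l = m then c else 1) else 0) = (x(k := c * x k)) l"
      using assms(4,6) T1_zero[OF n assms(1), of l] by auto
  qed
  moreover have "V1 n x \<in> \<V>1 n" using assms(1) by (simp add: \<V>1_def)
  ultimately show ?thesis
    using n assms(2) word_e_single[OF assms(3,5,2)]
    by (simp add: e1_def params1_V1[OF n assms(1)] word1_chart)
qed

lemma e1_first:
  assumes "x \<in> T1 n" "c \<noteq> 0"
  shows "e1 n 1 c (V1 n x) = Some (V1 n (x(n + 1 := c * x (n + 1))))"
proof (rule word1_single[where m = "n - 1 - 1", OF assms])
  show "occ (chart_word 1 n) 1 = {n - 1 - 1}" using n by (auto simp: occ_chart)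
  show "word_A (cartan n) (chart_word 1 n) (map x (chart_subs 1 n)) 1 (n - 1 - 1) \<noteq> 0"
    using n T1_nz[OF n assms(1)]
    by (subst first_A1[OF order_refl _ assms(1)]) auto
qed (use n in auto)

lemma e1_last:
  assumes "x \<in> T1 n" "c \<noteq> 0"
  shows "e1 n n c (V1 n x) = Some (V1 n (x(n := c * x n)))"
proof (rule word1_single[where m = "n - 1", OF assms])
  show "occ (chart_word 1 n) n = {n - 1}" using n by (auto simp: occ_chart)
  have "2 * n - 1 - n = n - 1" by simp
  then show "word_A (cartan n) (chart_word 1 n) (map x (chart_subs 1 n)) n (n - 1) \<noteq> 0"
    using second_A[of n x] n T1_nz[OF n assms(1)] assms(1) by auto
qed (use n in auto)

lemma e1_middle:
  assumes "x \<in> T1 n" "c \<noteq> 0" "2 \<le> i" "i < n"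
  defines "p \<equiv> x i * x (n + i)" and "q \<equiv> x (i + 1) * x (n + i - 1)"
  defines "ci \<equiv> c * (p + q) / (c * p + q)"
  shows "e1 n i c (V1 n x) = (if p + q \<noteq> 0 \<and> c * p + q \<noteq> 0
    then Some (V1 n (x(i := ci * x i, n + i := c / ci * x (n + i)))) else None)"
proof -
  let ?w = "chart_word 1 n" and ?cs = "map x (chart_subs 1 n)"
  let ?m = "n - 1 - i" and ?m' = "2 * n - 1 - i"
  define A B where "A = word_A (cartan n) ?w ?cs i ?m" and "B = word_A (cartan n) ?w ?cs i ?m'"
  \<comment> \<open>The common factor of the two terms: \<open>A = t * p\<close> and
    \<open>B = t * q\<close>, so it cancels from all quotients.\<close>
  define t where "t = (if i + 1 < n then x (n + i + 1) else 1) / (x i * (x (n + i))\<^sup>2)"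
  note nz = T1_nz[OF n assms(1)]
  have t: "t \<noteq> 0" using nz assms(3,4) by (auto simp: t_def)
  have A: "A = t * p"
    using first_A1[of i x] assms(1,3,4) nz by (simp add: A_def t_def p_def power2_eq_square)
  have B: "B = t * q"
    using second_A[of i x] assms(1,3,4) nz by (simp add: B_def t_def q_def power2_eq_square)
  have AB: "A + B = t * (p + q)" "c * A + B = t * (c * p + q)"
    by (simp_all add: A B algebra_simps)
  have e: "word_e (cartan n) ?w i c ?cs = (if A + B \<noteq> 0 \<and> c * A + B \<noteq> 0 then
    Some (map (\<lambda>j. ?cs ! j * (if j = ?m then (c * A + B) / (A + B)
       else if j = ?m' then c * (A + B) / (c * A + B) else 1)) [0..<length ?w]) else None)"
    unfolding A_def B_def
    by (rule word_e_double) (use assms(2-4) in \<open>auto simp: occ_chart\<close>)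
  have tup: "tuple_of (chart_subs 1 n) (map (\<lambda>j. ?cs ! j * (if j = ?m then (c * A + B) / (A + B)
       else if j = ?m' then c * (A + B) / (c * A + B) else 1)) [0..<2 * n - 2]) =
       x(i := ci * x i, n + i := c / ci * x (n + i))"
    if nz: "p + q \<noteq> 0" "c * p + q \<noteq> 0"
  proof -
    \<comment> \<open>The earlier position carries \<open>x (n + i)\<close> and the later one
      \<open>x i\<close>, hence the factors \<open>c / ci\<close> and \<open>ci\<close> in this
      order.\<close>
    have "(c * A + B) / (A + B) = c / ci" "c * (A + B) / (c * A + B) = ci"
      using t nz assms(2) by (simp_all add: AB ci_def)
    note r = this
    show ?thesis
      unfolding tuple_of_chart_mult[OF le_trans[OF one_le_numeral n]] r
    proof
      fix l
      have "1 + 2 * n - 2 - l = ?m \<longleftrightarrow> l = n + i" "1 + 2 * n - 2 - l = ?m' \<longleftrightarrow> l = i"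
        if "2 \<le> l" "l \<le> 2 * n - 1"
        using that assms(3,4) by linarith+
      then show "(if 1 + 1 \<le> l \<and> l \<le> 1 + 2 * n - 2
          then x l * (if 1 + 2 * n - 2 - l = ?m then c / ci else if 1 + 2 * n - 2 - l = ?m' then ci else 1)
          else 0) = (x(i := ci * x i, n + i := c / ci * x (n + i))) l"
        using assms(3,4) T1_zero[OF n assms(1), of l] by auto
    qed
  qed
  have "V1 n x \<in> \<V>1 n" using assms(1) by (simp add: \<V>1_def)
  then have V: "e1 n i c (V1 n x) =
    map_option (\<lambda>cs. V1 n (tuple_of (chart_subs 1 n) cs)) (word_e (cartan n) ?w i c ?cs)"
    using n assms(2) by (simp add: e1_def params1_V1[OF n assms(1)] word1_chart)
  have iff: "A + B \<noteq> 0 \<longleftrightarrow> p + q \<noteq> 0" "c * A + B \<noteq> 0 \<longleftrightarrow> c * p + q \<noteq> 0"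
    unfolding AB using t by auto
  show ?thesis
  proof (cases "p + q \<noteq> 0 \<and> c * p + q \<noteq> 0")
    case True
    note T = tup[OF conjunct1[OF True] conjunct2[OF True]]
    show ?thesis unfolding V e iff chart_length if_P[OF True] option.map T ..
  next
    case False
    then show ?thesis unfolding V e iff by auto
  qed
qed

lemma gamma1_V1:
  assumes "x \<in> T1 n"
  shows "\<gamma>1 n i (V1 n x) = Some (word_\<gamma> (cartan n) (chart_word 1 n) i (map x (chart_subs 1 n)))"
  using assms n by (simp add: \<gamma>1_def \<V>1_def params1_V1[OF n] word1_chart)

lemma epsilon1_V1:
  assumes "x \<in> T1 n"
  shows "\<epsilon>1 n i (V1 n x) = Some (word_\<epsilon> (cartan n) (chart_word 1 n) i (map x (chart_subs 1 n)))"
  using assms n by (simp add: \<epsilon>1_def \<V>1_def params1_V1[OF n] word1_chart)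

text \<open>The convention x_1 = x_{2n} = 1. Points of \<open>T1 n\<close> have the value 0 at these
  two indices, so they must be overwritten.\<close>

definition pad :: "(nat \<Rightarrow> complex) \<Rightarrow> nat \<Rightarrow> complex" where
  "pad x = x(1 := 1, 2 * n := 1)"

lemma gamma1_explicit:
  assumes x: "x \<in> T1 n"
  shows "\<gamma>1 n 1 (V1 n x) = Some ((pad x (n+1))\<^sup>2 / (pad x 2 * pad x (n+2)))"
    "2 \<le> i \<Longrightarrow> i < n \<Longrightarrow> \<gamma>1 n i (V1 n x) = Some ((pad x i)\<^sup>2 * (pad x (n+i))\<^sup>2 /
        (pad x (i-1) * pad x (i+1) * pad x (n+i-1) * pad x (n+i+1)))"
    "\<gamma>1 n n (V1 n x) = Some ((pad x n)\<^sup>2 / (pad x (n-1) * pad x (2*n-1)))"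
proof -
  define z w where "z = ext_one {1..<1+n-1} (\<lambda>j. x (n + j))" and "w = ext_one {1+1..<1+n} x"
  have g: "\<gamma>1 n i (V1 n x) = Some
      ((z i)\<^sup>2 / (z (prev_idx n i) * z (next_idx n i)) * ((w i)\<^sup>2 / (w (prev_idx n i) * w (next_idx n i))))"
    if "i \<le> n" for i
    unfolding gamma1_V1[OF x] z_def w_def
    by (subst chart_gamma) (use T1_nz[OF n x] that in auto)
  show "\<gamma>1 n 1 (V1 n x) = Some ((pad x (n+1))\<^sup>2 / (pad x 2 * pad x (n+2)))"
  proof -
    have v: "z 1 = pad x (n + 1)" "z 2 = pad x (n + 2)" "z 0 = 1" "w 0 = 1" "w 1 = 1" "w 2 = pad x 2"
      using n by (auto simp: z_def w_def pad_def ext_one_def)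
    have idx: "next_idx n 1 = 2" "prev_idx n 1 = 0" using n by (auto simp: next_idx_def prev_idx_def)
    have "1 \<le> n" using n by simp
    from g[OF this, unfolded idx v] show ?thesis by (simp add: mult.commute)
  qed
  show "\<gamma>1 n i (V1 n x) = Some ((pad x i)\<^sup>2 * (pad x (n+i))\<^sup>2 /
        (pad x (i-1) * pad x (i+1) * pad x (n+i-1) * pad x (n+i+1)))" if i: "2 \<le> i" "i < n" for i
  proof -
    have d: "n + (i - 1) = n + i - 1" using i by simp
    have z: "z i = pad x (n + i)" "z (i - 1) = pad x (n + i - 1)" "z (i + 1) = pad x (n + i + 1)"
      using i d by (auto simp: z_def pad_def ext_one_def)
    have w: "w i = pad x i" "w (i - 1) = pad x (i - 1)" "w (i + 1) = pad x (i + 1)"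
      using i by (auto simp: w_def pad_def ext_one_def)
    have idx: "next_idx n i = i + 1" "prev_idx n i = i - 1" using i by (auto simp: next_idx_def prev_idx_def)
    have "i \<le> n" using i by simp
    from g[OF this, unfolded idx z w] show ?thesis by (simp add: mult_ac)
  qed
  show "\<gamma>1 n n (V1 n x) = Some ((pad x n)\<^sup>2 / (pad x (n-1) * pad x (2*n-1)))"
  proof -
    have d: "n + (n - 1) = 2 * n - 1" by simp
    have z: "z n = 1" "z (n - 1) = pad x (2 * n - 1)" "z 0 = 1"
      using n d by (auto simp: z_def pad_def ext_one_def)
    have w: "w n = pad x n" "w (n - 1) = pad x (n - 1)" "w 0 = 1"
      using n by (auto simp: w_def pad_def ext_one_def)
    have idx: "next_idx n n = 0" "prev_idx n n = n - 1" using n by (auto simp: next_idx_def prev_idx_def)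
    from g[OF order_refl, unfolded idx z w] show ?thesis by (simp add: mult_ac)
  qed
qed

lemma epsilon1_explicit:
  assumes x: "x \<in> T1 n"
  shows "\<epsilon>1 n 1 (V1 n x) = Some (pad x (n+2) / pad x (n+1))"
    "2 \<le> i \<Longrightarrow> i < n \<Longrightarrow> \<epsilon>1 n i (V1 n x) = Some (pad x (n+i+1) / pad x (n+i)
        + pad x (i+1) * pad x (n+i-1) * pad x (n+i+1) / (pad x i * (pad x (n+i))\<^sup>2))"
    "\<epsilon>1 n n (V1 n x) = Some (pad x (2*n-1) / pad x n)"
proof -
  note nz = T1_nz[OF n x]
  have o1: "occ (chart_word 1 n) 1 = {n - 1 - 1}" using n by (auto simp: occ_chart)
  show "\<epsilon>1 n 1 (V1 n x) = Some (pad x (n+2) / pad x (n+1))"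
    unfolding epsilon1_V1[OF x] word_\<epsilon>_def o1 using n first_A1[of 1 x] x
    by (auto simp: pad_def)
  have o2: "occ (chart_word 1 n) n = {n - 1}" using n by (auto simp: occ_chart)
  have d: "2 * n - 1 - n = n - 1" "n + n - 1 = 2 * n - 1" by auto
  show "\<epsilon>1 n n (V1 n x) = Some (pad x (2*n-1) / pad x n)"
    unfolding epsilon1_V1[OF x] word_\<epsilon>_def o2 using second_A[of n x, unfolded d] n x
    by (auto simp: pad_def)
  show "\<epsilon>1 n i (V1 n x) = Some (pad x (n+i+1) / pad x (n+i)
        + pad x (i+1) * pad x (n+i-1) * pad x (n+i+1) / (pad x i * (pad x (n+i))\<^sup>2))"
    if "2 \<le> i" "i < n" for i
  proof -
    have "occ (chart_word 1 n) i = {n - 1 - i, 2 * n - 1 - i}" using that by (auto simp: occ_chart)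
    moreover have "n - 1 - i \<noteq> 2 * n - 1 - i" using that by auto
    ultimately show ?thesis
      unfolding epsilon1_V1[OF x] word_\<epsilon>_def
      using first_A1[of i x] second_A[of i x] that x nz
      by (auto simp: pad_def)
  qed
qed

text \<open>Letter 0 occurs once, so its action rescales a single parameter. For n = 2 the index
  \<open>n + 1\<close> lies outside the torus and its parameter is read as 1.\<close>

lemma chart2_zero:
  assumes y: "y \<in> T2 n"
  shows "c \<noteq> 0 \<Longrightarrow> e2 n 0 c (V2 n y) = Some (V2 n (y(n := c * y n)))"
    "\<gamma>2 n 0 (V2 n y) = Some ((y n)\<^sup>2 / (y 1 * (if n = 2 then 1 else y (n + 1))))"
    "\<epsilon>2 n 0 (V2 n y) = Some ((if n = 2 then 1 else y (n + 1)) / y n)"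
proof -
  note nz = T2_nz[OF n y]
  have V: "V2 n y \<in> \<V>2 n" using y by (simp add: \<V>2_def)
  have o: "occ (chart_word 0 n) 0 = {n - 2}" using n by (auto simp: occ_chart)
  have A: "word_A (cartan n) (chart_word 0 n) (map y (chart_subs 0 n)) 0 (n - 2) =
    (if n = 2 then 1 else y (n + 1)) / y n"
    using first_A[of 0 0 y] n nz by auto
  show "\<epsilon>2 n 0 (V2 n y) = Some ((if n = 2 then 1 else y (n + 1)) / y n)"
    using V n A by (simp add: \<epsilon>2_def word_\<epsilon>_def params2_V2[OF n y] word2_chart o)
  have "word_\<gamma> (cartan n) (chart_word 0 n) 0 (map y (chart_subs 0 n)) =
    (let z = ext_one {0..<0+n-1} (\<lambda>j. y (n + j)); w = ext_one {0+1..<0+n} y in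
      (z 0)\<^sup>2 / (z (prev_idx n 0) * z (next_idx n 0)) * ((w 0)\<^sup>2 / (w (prev_idx n 0) * w (next_idx n 0))))"
    unfolding Let_def by (rule chart_gamma) (use nz in auto)
  then show "\<gamma>2 n 0 (V2 n y) = Some ((y n)\<^sup>2 / (y 1 * (if n = 2 then 1 else y (n + 1))))"
    using V n by (auto simp: \<gamma>2_def params2_V2[OF n y] word2_chart ext_one_def next_idx_def prev_idx_def)
  assume c: "c \<noteq> 0"
  have A0: "word_A (cartan n) (chart_word 0 n) (map y (chart_subs 0 n)) 0 (n - 2) \<noteq> 0"
    unfolding A using n nz by auto
  have "tuple_of (chart_subs 0 n) (map (\<lambda>j. map y (chart_subs 0 n) ! j * (if j = n - 2 then c else 1))
      [0..<2 * n - 2]) = y(n := c * y n)"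
    unfolding tuple_of_chart_mult[OF le_trans[OF one_le_numeral n]]
  proof
    fix l
    have "0 + 2 * n - 2 - l = n - 2 \<longleftrightarrow> l = n" if "1 \<le> l" "l \<le> 2 * n - 2"
      using that n by linarith
    then show "(if 0 + 1 \<le> l \<and> l \<le> 0 + 2 * n - 2
        then y l * (if 0 + 2 * n - 2 - l = n - 2 then c else 1) else 0) = (y(n := c * y n)) l"
      using n T2_zero[OF n y, of l] by auto
  qed
  then show "e2 n 0 c (V2 n y) = Some (V2 n (y(n := c * y n)))"
    using n c V word_e_single[OF o A0 c]
    by (simp add: e2_def params2_V2[OF n y] word2_chart)
qed

end

section \<open>The affine crystal on configurations\<close>

context
  fixes n :: nat
  assumes n: "n \<ge> 2"
begin

text \<open>The first condition is the denominator of \<open>col_action\<close>, the second the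
  domain of \<open>sigma\<close>.\<close>

definition act_dom :: "nat \<Rightarrow> config \<Rightarrow> bool" where
  "act_dom i M \<longleftrightarrow> minor M (prev_idx n i) (next_idx n i) \<noteq> 0 \<and>
     (i = 0 \<longrightarrow> (\<forall>k\<in>{1..<n}. minor M k n \<noteq> 0))"

text \<open>The minors D_i of cyclically consecutive columns. At \<open>i = 1\<close> the order is
  reversed, since column 0 stands for column n + 1.\<close>

definition cyc_minor :: "config \<Rightarrow> nat \<Rightarrow> complex" where
  "cyc_minor M i = (if i = 1 then minor M 1 0 else minor M (prev_idx n i) i)"

definition gamma_conf :: "nat \<Rightarrow> config \<Rightarrow> complex" where
  "gamma_conf i M = (cyc_minor M i)\<^sup>2 / (cyc_minor M (prev_idx n i) * cyc_minor M (next_idx n i))"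

text \<open>The sign makes the value at \<open>i = 0\<close> the quotient of
  \<open>minor M 1 n\<close> by \<open>minor M n 0\<close>, both with columns in increasing order
  when 0 is read as n + 1.\<close>

definition eps_conf :: "nat \<Rightarrow> config \<Rightarrow> complex" where
  "eps_conf i M = (if i = 0 then -1 else 1) * minor M (prev_idx n i) (next_idx n i) / minor M (prev_idx n i) i"

lemma generic1_nz:
  assumes "generic1 n M"
  shows "1 \<le> l \<Longrightarrow> l \<le> n \<Longrightarrow> minor M l 0 \<noteq> 0" "2 \<le> l \<Longrightarrow> l \<le> n \<Longrightarrow> minor M (l - 1) l \<noteq> 0"
  using assms by (auto simp: generic1_def)

lemma cyc_minor_nz: "generic1 n M \<Longrightarrow> i \<le> n \<Longrightarrow> cyc_minor M i \<noteq> 0"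
  using generic1_nz[of M i] generic1_nz[of M n] n
  by (cases "i = 0"; cases "i = 1") (auto simp: cyc_minor_def prev_idx_def)

text \<open>Only two of these minors contain column \<open>i\<close>: D_i is scaled by construction,
  and the next one is unchanged because column i + 1 has minor 0 with itself.\<close>

lemma cyc_minor_col_action:
  assumes "i \<le> n" "j \<le> n" "minor M (prev_idx n i) (next_idx n i) \<noteq> 0"
  shows "cyc_minor (col_action n i c M) j = (if j = i then c else 1) * cyc_minor M j"
proof -
  let ?N = "col_action n i c M"
  have m: "minor ?N (prev_idx n j) j = (if j = i then c else 1) * minor M (prev_idx n j) j"
  proof -
    consider "j = i" | "prev_idx n j = i" "j \<noteq> i" | "j \<noteq> i" "prev_idx n j \<noteq> i" by blast
    then show ?thesis
    proof cases
      case 1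
      then show ?thesis using minor_col_action_prev[OF n assms(1,3)] by simp
    next
      case 2
      then have "j = next_idx n i" using assms(2) by auto
      then show ?thesis using 2 minor_col_action_next(1)[OF n assms(1)] by simp
    next
      case 3
      then show ?thesis by simp
    qed
  qed
  show ?thesis
  proof (cases "j = 1")
    case True
    then show ?thesis
      using m minor_swap[of ?N 0 1] minor_swap[of M 0 1] by (auto simp: cyc_minor_def prev_idx_def)
  next
    case False
    then show ?thesis using m by (simp add: cyc_minor_def)
  qed
qed

lemma generic1_alt:
  "generic1 n M \<longleftrightarrow> (\<forall>j\<le>n. cyc_minor M j \<noteq> 0) \<and> (\<forall>l\<in>{1..n}. minor M l 0 \<noteq> 0)"
proof -
  have "minor M (l - 1) l = cyc_minor M l" if "2 \<le> l" for l
    using that by (simp add: cyc_minor_def prev_idx_def)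
  then show ?thesis
    using cyc_minor_nz[of M] unfolding generic1_def by (metis atLeastAtMost_iff)
qed

text \<open>Minors against column 0 are the part of \<open>generic1\<close> that an action can
  destroy. The right-hand side of the third claim is the denominator \<open>c * p + q\<close> of the
  coordinate formula, up to a factor.\<close>

lemma minor_col_action_zero:
  assumes "1 \<le> i" "i \<le> n" "1 \<le> l" "l \<le> n" "minor M (prev_idx n i) (next_idx n i) \<noteq> 0"
  shows "l \<noteq> i \<or> i = n \<Longrightarrow> minor (col_action n i c M) l 0 = minor M l 0 \<or> (i = 1 \<and> l = 1)"
    "i = 1 \<Longrightarrow> l = i \<Longrightarrow> minor (col_action n i c M) l 0 = c * minor M l 0"
    "2 \<le> i \<Longrightarrow> i < n \<Longrightarrow> l = i \<Longrightarrow> minor (col_action n i c M) l 0 * minor M (i - 1) (i + 1) =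
       c * (minor M (i - 1) i * minor M (i + 1) 0) + minor M i (i + 1) * minor M (i - 1) 0"
proof -
  show "l \<noteq> i \<or> i = n \<Longrightarrow> minor (col_action n i c M) l 0 = minor M l 0 \<or> (i = 1 \<and> l = 1)"
    using assms minor_col_action_next(1)[OF n assms(2), of c M] by (cases "l = i") (auto simp: next_idx_def)
  show "i = 1 \<Longrightarrow> l = i \<Longrightarrow> minor (col_action n i c M) l 0 = c * minor M l 0"
    using cyc_minor_col_action[of i 1 M c] assms by (simp add: cyc_minor_def)
  assume *: "2 \<le> i" "i < n" "l = i"
  then have idx: "prev_idx n i = i - 1" "next_idx n i = i + 1" by (auto simp: prev_idx_def next_idx_def)
  have "minor (col_action n i c M) i 0 * minor M (i - 1) (i + 1) =
    minor M i 0 * minor M (i - 1) (i + 1) + (c - 1) * minor M (i - 1) i * minor M (i + 1) 0"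
    using * assms(5) unfolding minor_col_action[OF n assms(2)] idx Let_def by (simp add: field_simps)
  also have "minor M i 0 * minor M (i - 1) (i + 1) =
    minor M (i - 1) i * minor M (i + 1) 0 + minor M i (i + 1) * minor M (i - 1) 0"
    by (simp add: minor_def algebra_simps)
  finally show "minor (col_action n i c M) l 0 * minor M (i - 1) (i + 1) =
       c * (minor M (i - 1) i * minor M (i + 1) 0) + minor M i (i + 1) * minor M (i - 1) 0"
    using * by (simp add: algebra_simps)
qed

lemma generic1_col_action:
  assumes "generic1 n M" "i \<le> n" "c \<noteq> 0" "minor M (prev_idx n i) (next_idx n i) \<noteq> 0"
    "\<And>l. 1 \<le> l \<Longrightarrow> l \<le> n \<Longrightarrow> minor (col_action n i c M) l 0 \<noteq> 0"
  shows "generic1 n (col_action n i c M)"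
  unfolding generic1_alt
  using assms(5) cyc_minor_nz[OF assms(1)] assms(3) by (simp add: cyc_minor_col_action[OF assms(2) _ assms(4)])

lemma coords1_eqI:
  assumes "\<And>k. 2 \<le> k \<Longrightarrow> k \<le> n \<Longrightarrow> x k = minor M (k - 1) k / minor M k 0"
    "\<And>l. 1 \<le> l \<Longrightarrow> l < n \<Longrightarrow> x (n + l) = minor M l 0 / minor M n 0"
    "\<And>k. \<not> (2 \<le> k \<and> k \<le> 2 * n - 1) \<Longrightarrow> x k = 0"
  shows "coords1 n M = x"
proof
  fix k
  show "coords1 n M k = x k"
    using assms(1)[of k] assms(2)[of "k - n"] assms(3)[of k] by (auto simp: coords1_def)
qed

lemma coords1_simps:
  "2 \<le> k \<Longrightarrow> k \<le> n \<Longrightarrow> coords1 n M k = minor M (k - 1) k / minor M k 0"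
  "1 \<le> l \<Longrightarrow> l < n \<Longrightarrow> coords1 n M (n + l) = minor M l 0 / minor M n 0"
  "\<not> (2 \<le> k \<and> k \<le> 2 * n - 1) \<Longrightarrow> coords1 n M k = 0"
  using n by (auto simp: coords1_def)

lemma step_minor_col_action:
  assumes "i \<le> n" "2 \<le> k" "k \<le> n" "minor M (prev_idx n i) (next_idx n i) \<noteq> 0"
  shows "minor (col_action n i c M) (k - 1) k = (if k = i then c else 1) * minor M (k - 1) k"
  using cyc_minor_col_action[OF assms(1,3,4), of c] assms(2) by (auto simp: cyc_minor_def prev_idx_def)

section \<open>The actions of the crystal are the column actions\<close>

lemma aff_e_zero:
  assumes "generic1 n M" "c \<noteq> 0"
  shows "aff_e n 0 c (point1 n M) = (if act_dom 0 M \<and> generic1 n (col_action n 0 c M)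
    then Some (point1 n (col_action n 0 c M)) else None)"
proof (cases "\<forall>k\<in>{1..<n}. minor M k n \<noteq> 0")
  case False
  then show ?thesis using sigma_point1[OF n assms(1)] by (auto simp: aff_e_def act_dom_def map_comp_def)
next
  case True
  let ?N = "col_action n 0 c M"
  have idx: "prev_idx n 0 = n" "next_idx n 0 = 1" using n by (auto simp: prev_idx_def next_idx_def)
  have n1: "minor M n 1 \<noteq> 0" using True n minor_swap[of M n 1] by auto
  have m: "minor ?N k l = minor M k l" if "1 \<le> k" "1 \<le> l" for k l using that by simp
  have m1: "minor ?N 1 0 = minor M 1 0" using minor_col_action_next(2)[OF n, of 0 c M] idx by simp
  have mn: "minor ?N n 0 = c * minor M n 0" using minor_col_action_prev[OF n, of 0 M c] idx n1 by simp
  have g2: "generic2 n M" by (rule generic12[OF n assms(1) True])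
  have g2': "generic2 n ?N" using g2 assms(2) n m1 mn by (auto simp: generic2_def)
  \<comment> \<open>Column 0 enters \<open>coords2\<close> only at the indices 1 and
    \<open>n\<close>. The minor of columns 1 and 0 is unchanged, so acting on column 0 rescales just
    the coordinate \<open>n\<close>.\<close>
  have co: "(coords2 n M)(n := c * coords2 n M n) = coords2 n ?N"
    using n m1 mn by (auto simp: coords2_def fun_eq_iff)
  have "e2 n 0 c (point2 n M) = Some (point2 n ?N)"
    using chart2_zero(1)[OF n coords2_chart(1)[OF n g2] assms(2)] coords2_chart(2)[OF n g2]
      coords2_chart(2)[OF n g2'] co by simp
  moreover have "sigma n (point1 n M) = Some (point2 n M)" using sigma_point1[OF n assms(1)] True by simp
  moreover have "act_dom 0 M" using True n1 idx by (simp add: act_dom_def)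
  ultimately show ?thesis by (simp add: aff_e_def partial_inv_sigma[OF n g2'])
qed

text \<open>Here the denominator is itself a minor against column 0, nonzero by genericity, and
  minors against column 0 change at most by the factor \<open>c\<close>. Hence these actions are
  defined everywhere.\<close>

lemma aff_e_end:
  assumes "generic1 n M" "c \<noteq> 0" "i = 1 \<or> i = n"
  shows "act_dom i M" "generic1 n (col_action n i c M)"
    "aff_e n i c (point1 n M) = Some (point1 n (col_action n i c M))"
proof -
  let ?N = "col_action n i c M" and ?x = "coords1 n M"
  have i: "1 \<le> i" "i \<le> n" using assms n by auto
  have p: "minor M (prev_idx n i) (next_idx n i) \<noteq> 0"
  proof (cases "i = 1")
    case True
    have idx: "next_idx n 1 = 2" "prev_idx n 1 = 0" using n by (auto simp: next_idx_def prev_idx_def)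
    show ?thesis unfolding True idx minor_swap[of M 0 2] using generic1_nz(1)[OF assms(1), of 2] n by simp
  next
    case False
    then have idx: "i = n" "prev_idx n n = n - 1" "next_idx n n = 0"
      using assms(3) n by (auto simp: prev_idx_def next_idx_def)
    show ?thesis unfolding idx using generic1_nz(1)[OF assms(1), of "n - 1"] n by simp
  qed
  show "act_dom i M" using p i by (simp add: act_dom_def)
  have z: "minor ?N l 0 = (if i = 1 \<and> l = 1 then c else 1) * minor M l 0" if "1 \<le> l" "l \<le> n" for l
    using minor_col_action_zero(1,2)[OF i that p, of c] assms(3) by auto
  show g: "generic1 n ?N"
    by (rule generic1_col_action[OF assms(1) i(2) assms(2) p])
      (use assms(2) generic1_nz[OF assms(1)] in \<open>auto simp: z\<close>)
  define k where "k = (if i = 1 then n + 1 else n)"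
  have "coords1 n ?N = ?x(k := c * ?x k)"
    using assms(3) n i coords1_simps(2)[of 1 M]
    by (intro coords1_eqI) (auto simp: step_minor_col_action[OF i(2) _ _ p, simplified] z k_def coords1_simps)
  moreover have "e1 n i c (V1 n ?x) = Some (V1 n (?x(k := c * ?x k)))"
    using assms(3) e1_first[OF n coords1_chart(1)[OF n assms(1)] assms(2)]
      e1_last[OF n coords1_chart(1)[OF n assms(1)] assms(2)] n by (auto simp: k_def)
  ultimately show "aff_e n i c (point1 n M) = Some (point1 n ?N)"
    using i coords1_chart(2)[OF n assms(1)] coords1_chart(2)[OF n g] by (simp add: aff_e_def)
qed

text \<open>The two domain conditions translate into minors: \<open>p + q\<close> is a nonzero
  multiple of the denominator of \<open>col_action\<close>, and \<open>c * p + q\<close> vanishes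
  exactly when the new minor of columns \<open>i\<close> and 0 does.\<close>

lemma aff_e_middle:
  assumes "generic1 n M" "c \<noteq> 0" "2 \<le> i" "i < n"
  shows "aff_e n i c (point1 n M) = (if act_dom i M \<and> generic1 n (col_action n i c M)
    then Some (point1 n (col_action n i c M)) else None)"
proof -
  let ?N = "col_action n i c M" and ?x = "coords1 n M"
  define p q where "p = ?x i * ?x (n + i)" and "q = ?x (i + 1) * ?x (n + i - 1)"
  define ci where "ci = c * (p + q) / (c * p + q)"
  have i: "1 \<le> i" "i \<le> n" using assms by auto
  have idx: "prev_idx n i = i - 1" "next_idx n i = i + 1" using assms by (auto simp: prev_idx_def next_idx_def)
  have nz: "minor M i 0 \<noteq> 0" "minor M (i + 1) 0 \<noteq> 0" "minor M n 0 \<noteq> 0"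
    using assms generic1_nz[OF assms(1)] by auto
  define t where "t = minor M (i + 1) 0 * minor M n 0"
  have t: "t \<noteq> 0" using nz by (simp add: t_def)
  have p: "p = minor M (i - 1) i * minor M (i + 1) 0 / t"
    using nz assms(3,4) by (simp add: p_def coords1_simps t_def)
  have "?x (n + (i - 1)) = minor M (i - 1) 0 / minor M n 0" using assms(3,4) by (subst coords1_simps) auto
  then have q: "q = minor M i (i + 1) * minor M (i - 1) 0 / t"
    using nz assms(3,4) coords1_simps(1)[of "i + 1" M] by (simp add: q_def t_def)
  have "minor M (i - 1) i * minor M (i + 1) 0 + minor M i (i + 1) * minor M (i - 1) 0 =
    minor M (i - 1) (i + 1) * minor M i 0"
    by (simp add: minor_def algebra_simps)
  then have pq: "p + q = minor M (i - 1) (i + 1) * minor M i 0 / t"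
    unfolding p q by (simp add: add_divide_distrib[symmetric])
  have dom: "act_dom i M \<longleftrightarrow> p + q \<noteq> 0" using pq t nz assms(3) by (simp add: act_dom_def idx)
  have e: "e1 n i c (V1 n ?x) = (if p + q \<noteq> 0 \<and> c * p + q \<noteq> 0
    then Some (V1 n (?x(i := ci * ?x i, n + i := c / ci * ?x (n + i)))) else None)"
    unfolding p_def q_def ci_def
    by (rule e1_middle[OF n coords1_chart(1)[OF n assms(1)] assms(2-4)])
  have ae: "aff_e n i c (point1 n M) = e1 n i c (V1 n ?x)"
    using assms(3) coords1_chart(2)[OF n assms(1)] by (simp add: aff_e_def)
  show ?thesis
  proof (cases "p + q \<noteq> 0")
    case False
    then show ?thesis unfolding ae e using dom by simp
  next
    case True
    have m0: "minor M (prev_idx n i) (next_idx n i) \<noteq> 0" using True pq unfolding idx by auto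
    have z: "minor ?N l 0 = minor M l 0" if "1 \<le> l" "l \<le> n" "l \<noteq> i" for l
      using minor_col_action_zero(1)[OF i that(1,2) m0, of c] that(3) assms(3) by auto
    have "minor ?N i 0 * minor M (i - 1) (i + 1) = (c * p + q) * t"
      using minor_col_action_zero(3)[OF i i m0 assms(3,4) refl, of c] t unfolding p q
      by (simp add: field_simps)
    then have zi: "minor ?N i 0 = (c * p + q) * minor M i 0 / (p + q)"
      using True t nz m0 unfolding pq idx by (simp add: field_simps)
    have gen: "generic1 n ?N \<longleftrightarrow> c * p + q \<noteq> 0"
    proof
      assume "generic1 n ?N"
      then show "c * p + q \<noteq> 0" using zi i generic1_nz(1)[of ?N i] by auto
    next
      assume *: "c * p + q \<noteq> 0"
      have "minor ?N l 0 \<noteq> 0" if "1 \<le> l" "l \<le> n" for l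
        using z[OF that] zi * True nz generic1_nz(1)[OF assms(1) that] by (cases "l = i") auto
      then show "generic1 n ?N" by (rule generic1_col_action[OF assms(1) i(2) assms(2) m0])
    qed
    show ?thesis
    proof (cases "c * p + q \<noteq> 0")
      case False
      then show ?thesis unfolding ae e using gen by simp
    next
      case T: True
      have "coords1 n ?N = ?x(i := ci * ?x i, n + i := c / ci * ?x (n + i))"
      proof (rule coords1_eqI)
        fix k assume k: "2 \<le> k" "k \<le> n"
        show "(?x(i := ci * ?x i, n + i := c / ci * ?x (n + i))) k = minor ?N (k - 1) k / minor ?N k 0"
          unfolding step_minor_col_action[OF i(2) k m0] using k assms(3,4) True T z[of k] zi
          by (auto simp: coords1_simps ci_def)
      next
        fix l assume l: "1 \<le> l" "l < n"
        have "minor ?N n 0 = minor M n 0" using z[of n] assms by auto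
        then show "(?x(i := ci * ?x i, n + i := c / ci * ?x (n + i))) (n + l) = minor ?N l 0 / minor ?N n 0"
          using l assms(2-4) True T z[of l] zi nz by (auto simp: coords1_simps ci_def)
      next
        fix k assume "\<not> (2 \<le> k \<and> k \<le> 2 * n - 1)"
        then show "(?x(i := ci * ?x i, n + i := c / ci * ?x (n + i))) k = 0"
          using assms(3,4) coords1_simps(3)[of k M] by auto
      qed
      moreover have "generic1 n ?N" using gen T by simp
      ultimately show ?thesis
        unfolding ae e using True T dom coords1_chart(2)[OF n, of ?N] by simp
    qed
  qed
qed

lemma aff_e_point1:
  assumes "generic1 n M" "c \<noteq> 0" "i \<le> n"
  shows "aff_e n i c (point1 n M) = (if act_dom i M \<and> generic1 n (col_action n i c M)
    then Some (point1 n (col_action n i c M)) else None)"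
proof -
  consider "i = 0" | "i = 1 \<or> i = n" | "2 \<le> i" "i < n" using assms(3) by linarith
  then show ?thesis
    by cases (use aff_e_zero[OF assms(1,2)] aff_e_end[OF assms(1,2)] aff_e_middle[OF assms(1,2)] in auto)
qed

lemma aff_e_None: "v \<notin> \<V>1 n \<or> c = 0 \<Longrightarrow> aff_e n i c v = None"
proof -
  assume *: "v \<notin> \<V>1 n \<or> c = 0"
  have "sigma n v = None" if "v \<notin> \<V>1 n" using that sigma_dom[OF n] by blast
  moreover have "e2 n 0 0 w = None" for w by (simp add: e2_def)
  ultimately show ?thesis
    using * by (auto simp: aff_e_def e1_def map_comp_def split: option.splits)
qed

text \<open>The products x_l x_{n+l} are the D_l up to a common scalar, so the coordinate formulas
  for \<gamma> become homogeneous of degree 0 in the D_l.\<close>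

lemma pad_coords1:
  assumes "generic1 n M" "1 \<le> l" "l \<le> n"
  shows "pad n (coords1 n M) l * pad n (coords1 n M) (n + l) = cyc_minor M l / minor M n 0"
    "pad n (coords1 n M) (n + l) = minor M l 0 / minor M n 0"
proof -
  note nz = generic1_nz[OF assms(1)]
  show z: "pad n (coords1 n M) (n + l) = minor M l 0 / minor M n 0"
    using n assms nz(1)[of n] by (cases "l = n") (auto simp: pad_def coords1_simps)
  show "pad n (coords1 n M) l * pad n (coords1 n M) (n + l) = cyc_minor M l / minor M n 0"
  proof (cases "l = 1")
    case True
    then show ?thesis unfolding z using n by (simp add: pad_def cyc_minor_def)
  next
    case False
    then show ?thesis unfolding z using n assms nz(1)[of l]
      by (simp add: pad_def cyc_minor_def prev_idx_def coords1_simps)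
  qed
qed

lemma aff_gamma_point1:
  assumes "generic1 n M" "i \<le> n"
  shows "aff_\<gamma> n i (point1 n M) = (if i = 0 \<and> (\<exists>k\<in>{1..<n}. minor M k n = 0) then None
    else Some (gamma_conf i M))"
proof (cases "i = 0")
  case True
  have "aff_\<gamma> n 0 (point1 n M) = Some (gamma_conf 0 M)" if *: "\<forall>k\<in>{1..<n}. minor M k n \<noteq> 0"
  proof -
    have g2: "generic2 n M" by (rule generic12[OF n assms(1) *])
    have nz: "minor M 1 n \<noteq> 0" "minor M (n - 1) n \<noteq> 0" using * n by auto
    have "coords2 n M 1 * (if n = 2 then 1 else coords2 n M (n + 1)) = minor M 1 0 / minor M (n - 1) n"
    proof (cases "n = 2")
      case True
      then show ?thesis by (simp add: coords2_def)
    next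
      case False
      then show ?thesis using n nz by (auto simp: coords2_def)
    qed
    then show ?thesis
      using * sigma_point1[OF n assms(1)] chart2_zero(2)[OF n coords2_chart(1)[OF n g2]] nz n
      unfolding coords2_chart(2)[OF n g2]
      by (simp add: aff_\<gamma>_def gamma_conf_def cyc_minor_def prev_idx_def next_idx_def coords2_def[of n M n]
          power2_eq_square)
  qed
  then show ?thesis
    using True sigma_point1[OF n assms(1)] by (auto simp: aff_\<gamma>_def)
next
  case False
  let ?x = "pad n (coords1 n M)"
  note T = coords1_chart(1,2)[OF n assms(1)]
  note pd = pad_coords1(1)[OF assms(1)]
  have nz: "minor M n 0 \<noteq> 0" using generic1_nz(1)[OF assms(1), of n] n by simp
  have ag: "aff_\<gamma> n i (point1 n M) = \<gamma>1 n i (V1 n (coords1 n M))"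
    using False T by (simp add: aff_\<gamma>_def)
  have idx1: "next_idx n (Suc 0) = 2" "prev_idx n (Suc 0) = 0"
    using n by (auto simp: next_idx_def prev_idx_def)
  have p1: "?x 1 = 1" "?x (n + n) = 1" using n by (auto simp: pad_def)
  have n0: "cyc_minor M 0 = minor M n 0" by (simp add: cyc_minor_def prev_idx_def)
  consider "i = 1" | "i = n" "i \<noteq> 1" | "2 \<le> i" "i < n" using False assms(2) by linarith
  then show ?thesis
  proof cases
    case 1
    have "?x (n + 1) = cyc_minor M 1 / minor M n 0" "?x 2 * ?x (n + 2) = cyc_minor M 2 / minor M n 0"
      using pd[of 1] pd[of 2] n p1 by auto
    then show ?thesis
      unfolding ag using 1 n nz gamma1_explicit(1)[OF n T(1)]
      by (auto simp: gamma_conf_def idx1 n0 power2_eq_square)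
  next
    case 2
    have "n + (n - 1) = 2 * n - 1" by simp
    then have "?x n = cyc_minor M n / minor M n 0"
      "?x (n - 1) * ?x (2 * n - 1) = cyc_minor M (n - 1) / minor M n 0"
      using pd[of n] pd[of "n - 1"] n p1 by auto
    then show ?thesis
      unfolding ag using 2 n nz gamma1_explicit(3)[OF n T(1)]
      by (auto simp: gamma_conf_def prev_idx_def next_idx_def n0 power2_eq_square)
  next
    case 3
    have "(?x i)\<^sup>2 * (?x (n+i))\<^sup>2 / (?x (i-1) * ?x (i+1) * ?x (n+i-1) * ?x (n+i+1)) =
      (?x i * ?x (n+i))\<^sup>2 / ((?x (i-1) * ?x (n + (i-1))) * (?x (i+1) * ?x (n+(i+1))))"
      using 3 by (simp add: power_mult_distrib mult_ac)
    also have "\<dots> = gamma_conf i M"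
      using 3 pd[of i] pd[of "i - 1"] pd[of "i + 1"] nz
      by (simp add: gamma_conf_def prev_idx_def next_idx_def power2_eq_square)
    finally show ?thesis
      unfolding ag using 3 n gamma1_explicit(2)[OF n T(1), of i] by simp
  qed
qed

text \<open>For interior \<open>i\<close> the two summands of \<epsilon> combine by the Pluecker
  relation of the columns i - 1, i, i + 1 and 0.\<close>

lemma aff_epsilon_point1:
  assumes "generic1 n M" "i \<le> n"
  shows "aff_\<epsilon> n i (point1 n M) = (if i = 0 \<and> (\<exists>k\<in>{1..<n}. minor M k n = 0) then None
    else Some (eps_conf i M))"
proof (cases "i = 0")
  case True
  have "aff_\<epsilon> n 0 (point1 n M) = Some (eps_conf 0 M)" if *: "\<forall>k\<in>{1..<n}. minor M k n \<noteq> 0"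
  proof -
    have g2: "generic2 n M" by (rule generic12[OF n assms(1) *])
    have nz: "minor M 1 n \<noteq> 0" "minor M (n - 1) n \<noteq> 0" using * n by auto
    have "(if n = 2 then 1 else coords2 n M (n + 1)) = minor M 1 n / minor M (n - 1) n"
    proof (cases "n = 2")
      case True
      then show ?thesis using nz by simp
    next
      case False
      then show ?thesis using n by (auto simp: coords2_def)
    qed
    then show ?thesis
      using * sigma_point1[OF n assms(1)] chart2_zero(3)[OF n coords2_chart(1)[OF n g2]] nz n
        minor_swap[of M n 1]
      unfolding coords2_chart(2)[OF n g2]
      by (simp add: aff_\<epsilon>_def eps_conf_def prev_idx_def next_idx_def coords2_def[of n M n])
  qed
  then show ?thesis
    using True sigma_point1[OF n assms(1)] by (auto simp: aff_\<epsilon>_def)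
next
  case False
  let ?x = "pad n (coords1 n M)"
  note T = coords1_chart(1,2)[OF n assms(1)]
  note pd = pad_coords1(1)[OF assms(1)] and pz = pad_coords1(2)[OF assms(1)]
  have nz: "minor M n 0 \<noteq> 0" using generic1_nz(1)[OF assms(1), of n] n by simp
  have ag: "aff_\<epsilon> n i (point1 n M) = \<epsilon>1 n i (V1 n (coords1 n M))"
    using False T by (simp add: aff_\<epsilon>_def)
  have idx1: "next_idx n (Suc 0) = 2" "prev_idx n (Suc 0) = 0"
    using n by (auto simp: next_idx_def prev_idx_def)
  have p1: "?x 1 = 1" "?x (n + n) = 1" using n by (auto simp: pad_def)
  consider "i = 1" | "i = n" "i \<noteq> 1" | "2 \<le> i" "i < n" using False assms(2) by linarith
  then show ?thesis
  proof cases
    case 1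
    have "?x (n + 1) = minor M 1 0 / minor M n 0" "?x (n + 2) = minor M 2 0 / minor M n 0"
      using pz[of 1] pz[of 2] n by auto
    then show ?thesis
      unfolding ag using 1 n nz epsilon1_explicit(1)[OF n T(1)] minor_swap[of M 0 1] minor_swap[of M 0 2]
      by (auto simp: eps_conf_def idx1)
  next
    case 2
    have "n + (n - 1) = 2 * n - 1" by simp
    then have "?x n = cyc_minor M n / minor M n 0"
      "?x (2 * n - 1) = minor M (n - 1) 0 / minor M n 0"
      using pd[of n] pz[of "n - 1"] n p1 by auto
    then show ?thesis
      unfolding ag using 2 n nz epsilon1_explicit(3)[OF n T(1)]
      by (auto simp: eps_conf_def prev_idx_def next_idx_def cyc_minor_def)
  next
    case 3
    have nz': "minor M i 0 \<noteq> 0" "minor M (i + 1) 0 \<noteq> 0" "minor M (i - 1) i \<noteq> 0"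
      using 3 generic1_nz[OF assms(1)] by auto
    have idx: "prev_idx n i = i - 1" "next_idx n i = i + 1" using 3 by (auto simp: prev_idx_def next_idx_def)
    have e: "?x (n + i) = minor M i 0 / minor M n 0" "?x (n + i + 1) = minor M (i + 1) 0 / minor M n 0"
      "?x (n + i - 1) = minor M (i - 1) 0 / minor M n 0"
      "?x i = minor M (i - 1) i / minor M i 0" "?x (i + 1) = minor M i (i + 1) / minor M (i + 1) 0"
      using 3 pz[of i] pz[of "i + 1"] pz[of "i - 1"] coords1_simps(1)[of i M] coords1_simps(1)[of "i + 1" M]
      by (auto simp: pad_def)
    have "?x (n+i+1) / ?x (n+i) + ?x (i+1) * ?x (n+i-1) * ?x (n+i+1) / (?x i * (?x (n+i))\<^sup>2) =
      (minor M (i - 1) i * minor M (i + 1) 0 + minor M i (i + 1) * minor M (i - 1) 0)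
        / (minor M (i - 1) i * minor M i 0)"
      unfolding e using nz nz' by (simp add: field_simps power2_eq_square)
    also have "minor M (i - 1) i * minor M (i + 1) 0 + minor M i (i + 1) * minor M (i - 1) 0 =
      minor M (i - 1) (i + 1) * minor M i 0"
      by (simp add: minor_def algebra_simps)
    also have "\<dots> / (minor M (i - 1) i * minor M i 0) = eps_conf i M"
      using nz' 3 by (simp add: eps_conf_def idx)
    finally show ?thesis
      unfolding ag using 3 n epsilon1_explicit(2)[OF n T(1), of i] by simp
  qed
qed

end

section \<open>Regular families of configurations\<close>

definition reg_conf :: "'j set \<Rightarrow> ('j \<Rightarrow> complex) set \<Rightarrow> (('j \<Rightarrow> complex) \<Rightarrow> config) \<Rightarrow> bool" where
  "reg_conf J U F \<longleftrightarrow>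
     (\<forall>l. (\<lambda>p. fst (F p) l) \<in> quot_funs J U \<and> (\<lambda>p. snd (F p) l) \<in> quot_funs J U)"

lemma quot_funs_if [intro]:
  "(P \<Longrightarrow> f \<in> quot_funs J U) \<Longrightarrow> (\<not> P \<Longrightarrow> g \<in> quot_funs J U) \<Longrightarrow>
    (\<lambda>p. if P then f p else g p) \<in> quot_funs J U"
  by (cases P) auto

lemma poly_funs_if:
  "(P \<Longrightarrow> f \<in> poly_funs J) \<Longrightarrow> (\<not> P \<Longrightarrow> g \<in> poly_funs J) \<Longrightarrow>
    (\<lambda>p. if P then f p else g p) \<in> poly_funs J"
  by (cases P) auto

lemma reg_conf_mono: "reg_conf J U F \<Longrightarrow> V \<subseteq> U \<Longrightarrow> reg_conf J V F"
  unfolding reg_conf_def using quot_funs_mono by blast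

lemma reg_minor: "reg_conf J U F \<Longrightarrow> (\<lambda>p. minor (F p) k l) \<in> quot_funs J U"
  unfolding minor_def reg_conf_def by (intro quot_funs_diff quot_funs_mult) auto

lemma reg_col_action:
  assumes "reg_conf J U F" "c \<in> quot_funs J U"
    "\<And>p. p \<in> U \<Longrightarrow> minor (F p) (prev_idx n i) (next_idx n i) \<noteq> 0"
  shows "reg_conf J U (\<lambda>p. col_action n i (c p) (F p))"
proof -
  have t: "(\<lambda>p. (c p - 1) * minor (F p) (prev_idx n i) i / minor (F p) (prev_idx n i) (next_idx n i))
    \<in> quot_funs J U"
    using assms by (intro quot_funs_divide quot_funs_mult quot_funs_diff reg_minor) auto
  have "(\<lambda>p. f p + (c p - 1) * minor (F p) (prev_idx n i) i / minor (F p) (prev_idx n i) (next_idx n i) * g p)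
    \<in> quot_funs J U" if "f \<in> quot_funs J U" "g \<in> quot_funs J U" for f g
    by (intro quot_funs_add that quot_funs_mult t)
  then show ?thesis
    using assms(1) unfolding reg_conf_def col_action_def shear_def fst_conv snd_conv fun_upd_apply
    by (intro allI conjI quot_funs_if) auto
qed

lemma reg_point1:
  assumes "reg_conf J U F" "\<And>p. p \<in> U \<Longrightarrow> minor (F p) n 0 \<noteq> 0"
  shows "(\<lambda>p. point1 n (F p) b) \<in> quot_funs J U"
proof (cases b)
  case (Pair i j)
  show ?thesis
    unfolding Pair point1_def plvec_def using assms
    by (cases "(i, j) \<in> W_basis n") (auto intro!: quot_funs_divide reg_minor)
qed

lemma reg_coords1:
  assumes "reg_conf J U F" "\<And>p l. p \<in> U \<Longrightarrow> 1 \<le> l \<Longrightarrow> l \<le> n \<Longrightarrow> minor (F p) l 0 \<noteq> 0"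
  shows "(\<lambda>p. coords1 n (F p) k) \<in> quot_funs J U"
proof -
  consider "2 \<le> k" "k \<le> n" | "n + 1 \<le> k" "k \<le> 2 * n - 1" | "\<not> (2 \<le> k \<and> k \<le> n)" "\<not> (n + 1 \<le> k \<and> k \<le> 2 * n - 1)"
    by blast
  then show ?thesis
  proof cases
    case 1
    then show ?thesis using assms by (auto simp: coords1_def intro!: quot_funs_divide reg_minor)
  next
    case 2
    then show ?thesis using assms by (auto simp: coords1_def intro!: quot_funs_divide reg_minor)
  next
    case 3
    then have "coords1 n M k = 0" for M unfolding coords1_def by auto
    then show ?thesis by simp
  qed
qed

text \<open>Reads minors back from a normalised vector, extended to all pairs by
  antisymmetry.\<close>

definition vminor :: "nat \<Rightarrow> wvec \<Rightarrow> nat \<Rightarrow> nat \<Rightarrow> complex" where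
  "vminor n v k l = (if k = l then 0 else if l = 0 then v (k, n + 1) else if k = 0 then - v (l, n + 1)
     else if k < l then v (k, l) else - v (l, k))"

text \<open>A right inverse of \<open>point1\<close> on \<open>\<V>1 n\<close>. Its columns consist
  of minors against columns 0 and \<open>n\<close>, so the entries are coordinates up to sign and
  regularity is immediate.\<close>

definition section_conf :: "nat \<Rightarrow> wvec \<Rightarrow> config" where
  "section_conf n v = (\<lambda>l. vminor n v l 0, \<lambda>l. vminor n v n l)"

lemma reg_section_conf:
  assumes "U \<subseteq> aff_space J"
  shows "reg_conf J U (section_conf n)"
proof -
  have "(\<lambda>v. vminor n v k l) \<in> quot_funs J U" for k l
    using quot_funs_coord[OF assms] unfolding vminor_def by (intro quot_funs_if quot_funs_minus) auto
  then show ?thesis by (simp add: reg_conf_def section_conf_def)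
qed

context
  fixes n :: nat
  assumes n: "n \<ge> 2"
begin

lemma vminor_point1:
  assumes "minor M n 0 \<noteq> 0" "k \<le> n" "l \<le> n"
  shows "vminor n (point1 n M) k l = minor M k l / minor M n 0"
  using assms minor_swap[of M l k]
  by (auto simp: vminor_def point1_def plvec_def W_basis_def)

lemma section_conf_point1:
  assumes "generic1 n M"
  shows "minors_prop n (1 / minor M n 0) M (section_conf n (point1 n M))"
proof -
  have nz: "minor M n 0 \<noteq> 0" using generic1_nz(1)[OF n assms, of n] n by simp
  have f: "fst (section_conf n (point1 n M)) l = minor M l 0 / minor M n 0"
    and s: "snd (section_conf n (point1 n M)) l = minor M n l / minor M n 0" if "l \<le> n" for l
    using that nz by (simp_all add: section_conf_def vminor_point1)
  show ?thesis
    unfolding minors_prop_def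
  proof (intro conjI allI impI)
    fix k l assume kl: "k \<le> n" "l \<le> n"
    have "minor (section_conf n (point1 n M)) k l =
      (minor M k 0 * minor M n l - minor M l 0 * minor M n k) / (minor M n 0 * minor M n 0)"
      unfolding minor_def[of "section_conf n (point1 n M)"] f[OF kl(1)] f[OF kl(2)] s[OF kl(1)] s[OF kl(2)]
      using nz by (simp add: field_simps)
    also have "minor M k 0 * minor M n l - minor M l 0 * minor M n k = minor M k l * minor M n 0"
      by (simp add: minor_def algebra_simps)
    finally show "minor (section_conf n (point1 n M)) k l = 1 / minor M n 0 * minor M k l"
      using nz by simp
  qed (use nz in simp)
qed

lemma section_conf_V1:
  assumes "v \<in> \<V>1 n"
  shows "generic1 n (section_conf n v)" "point1 n (section_conf n v) = v"
  using assms minors_prop_invariants[OF n section_conf_point1] by (auto simp: \<V>1_eq[OF n])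

lemma V1_sub: "\<V>1 n \<subseteq> aff_space (W_basis n)"
  by (auto simp: \<V>1_eq[OF n] aff_space_def point1_def plvec_def)

lemma T1_sub: "T1 n \<subseteq> aff_space {2..2*n-1}"
  by (auto simp: T1_def torus_def)

lemma reg_frame1: "reg_conf {2..2*n-1} (T1 n) (frame1 n)"
proof -
  have c: "(\<lambda>x. x k) \<in> quot_funs {2..2*n-1} (T1 n)" for k by (rule quot_funs_coord[OF T1_sub])
  have "(\<lambda>x. fst (frame1 n x) l) \<in> quot_funs {2..2*n-1} (T1 n)" for l
    unfolding frame1_def fst_conv by (intro quot_funs_if c quot_funs_const)
  moreover have "(\<lambda>x. snd (frame1 n x) l) \<in> quot_funs {2..2*n-1} (T1 n)" for l
  proof (cases "l \<le> n")
    case True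
    have "(\<lambda>x. \<Sum>m=2..l. x m / x (n + m - 1)) \<in> quot_funs {2..2*n-1} (T1 n)"
      using T1_nz[OF n] True by (intro quot_funs_sum quot_funs_divide c) auto
    then show ?thesis
      unfolding frame1_def snd_conv by (intro quot_funs_if quot_funs_mult c quot_funs_const)
  next
    case False
    \<comment> \<open>\<open>reg_conf\<close> also asks about columns beyond \<open>n\<close>. There
      the extra summands have denominator 0 on the torus, hence value 0, and the sum stops at
      \<open>n\<close>.\<close>
    have "(\<lambda>x. \<Sum>m=2..l. x m / x (n + m - 1)) \<in> quot_funs {2..2*n-1} (T1 n)"
    proof (rule quot_funs_cong)
      show "(\<lambda>x. \<Sum>m=2..n. x m / x (n + m - 1)) \<in> quot_funs {2..2*n-1} (T1 n)"
        using T1_nz[OF n] by (intro quot_funs_sum quot_funs_divide c) auto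
      fix x assume x: "x \<in> T1 n"
      have "x (n + m - 1) = 0" if "n < m" for m
        by (rule T1_zero[OF n x]) (use that n in auto)
      then show "(\<Sum>m=2..n. x m / x (n + m - 1)) = (\<Sum>m=2..l. x m / x (n + m - 1))"
        using False by (intro sum.mono_neutral_left) auto
    qed
    then show ?thesis
      unfolding frame1_def snd_conv by (intro quot_funs_if quot_funs_mult c quot_funs_const)
  qed
  ultimately show ?thesis by (simp add: reg_conf_def)
qed

lemma reg_V1: "(\<lambda>x. V1 n x b) \<in> quot_funs {2..2*n-1} (T1 n)"
proof (rule quot_funs_cong)
  show "(\<lambda>x. point1 n (frame1 n x) b) \<in> quot_funs {2..2*n-1} (T1 n)"
    using n frame1_minors(1)[OF n, of _ n] by (intro reg_point1 reg_frame1) auto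
qed (use frame1_chart[OF n] in auto)

lemma irred_T1: "irred {2..2*n-1} (T1 n)"
  unfolding T1_def by (rule irred_torus) simp

lemma irred_V1: "irred (W_basis n) (\<V>1 n)"
  by (rule irred_image[OF irred_T1 V1_sub _ reg_V1]) (simp add: \<V>1_def)

section \<open>\<open>\<V>1\<close> as an irreducible locally closed set\<close>

lemma poly_vminor: "k \<le> n \<Longrightarrow> l \<le> n \<Longrightarrow> (\<lambda>v. vminor n v k l) \<in> poly_funs (W_basis n)"
  unfolding vminor_def
  by (intro poly_funs_if poly_funs_minus poly_funs.const poly_funs.coord) (auto simp: W_basis_def)

text \<open>The open condition \<open>h\<close> collects the minors of \<open>generic1\<close>. The
  equations \<open>E\<close> are the normalisation and the Pluecker relations with columns
  \<open>n\<close> and 0; they express every coordinate through minors against these two columns,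
  which is what makes \<open>section_conf\<close> an inverse.\<close>

lemma variety_V1: "variety (W_basis n) (\<V>1 n)"
proof -
  let ?J = "W_basis n"
  define wr where "wr j = (if j = n + 1 then 0 else j)" for j
  define h where "h v = (\<Prod>l\<in>{1..n}. vminor n v l 0) * (\<Prod>l\<in>{2..n}. vminor n v (l - 1) l)" for v
  define E where "E = insert (\<lambda>v. v (n, n + 1) + (- 1)) ((\<lambda>(i, j) v.
    v (i, j) + - (vminor n v i 0 * vminor n v n (wr j) + - (vminor n v (wr j) 0 * vminor n v n i))) ` ?J)"
  define U where "U = {v \<in> aff_space ?J. \<exists>f\<in>{h}. f v \<noteq> 0}"
  define C where "C = {v \<in> aff_space ?J. \<forall>f\<in>E. f v = 0}"
  have prod: "(\<lambda>v. \<Prod>l\<in>A. f l v) \<in> poly_funs ?J" if "finite A" "\<And>l. l \<in> A \<Longrightarrow> f l \<in> poly_funs ?J"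
    for A :: "nat set" and f using that
    by (induction A rule: finite_induct) (simp_all add: poly_funs.const poly_funs.mult)
  have "h \<in> poly_funs ?J" unfolding h_def
    by (intro poly_funs.mult prod poly_vminor) auto
  then have U: "openin (zariski ?J) U"
    unfolding openin_zariski zariski_open_def U_def by blast
  have "E \<subseteq> poly_funs ?J"
  proof
    fix f assume "f \<in> E"
    then consider "f = (\<lambda>v. v (n, n + 1) + (- 1))"
      | i j where "(i, j) \<in> ?J" "f = (\<lambda>v. v (i, j) + - (vminor n v i 0 * vminor n v n (wr j)
          + - (vminor n v (wr j) 0 * vminor n v n i)))"
      unfolding E_def by auto
    then show "f \<in> poly_funs ?J"
    proof cases
      case 1
      then show ?thesis using n
        by (simp only:) (intro poly_funs.add poly_funs.coord poly_funs.const, auto simp: W_basis_def)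
    next
      case 2
      then have "i \<le> n" "wr j \<le> n" by (auto simp: W_basis_def wr_def)
      then show ?thesis using 2
        by (simp only:) (intro poly_funs.add poly_funs.coord poly_funs_minus poly_funs.mult poly_vminor, auto)
    qed
  qed
  moreover have "aff_space ?J - C = {v \<in> aff_space ?J. \<exists>f\<in>E. f v \<noteq> 0}" by (auto simp: C_def)
  ultimately have "openin (zariski ?J) (aff_space ?J - C)"
    unfolding openin_zariski zariski_open_def by blast
  then have C: "closedin (zariski ?J) C"
    unfolding closedin_def topspace_zariski by (auto simp: C_def)
  have "\<V>1 n = U \<inter> C"
  proof (intro equalityI subsetI)
    fix v assume "v \<in> \<V>1 n"
    then obtain M where M: "generic1 n M" "v = point1 n M" by (auto simp: \<V>1_eq[OF n])
    have nz: "minor M n 0 \<noteq> 0" using generic1_nz(1)[OF n M(1), of n] n by simp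
    have va: "v \<in> aff_space ?J" using \<open>v \<in> \<V>1 n\<close> V1_sub by blast
    have vm: "vminor n v k l = minor M k l / minor M n 0" if "k \<le> n" "l \<le> n" for k l
      unfolding M(2) by (rule vminor_point1[OF nz that])
    have "vminor n v l 0 \<noteq> 0" if "l \<in> {1..n}" for l
      using that nz generic1_nz(1)[OF n M(1), of l] by (simp add: vm)
    moreover have "vminor n v (l - 1) l \<noteq> 0" if "l \<in> {2..n}" for l
    proof -
      have "l - 1 \<le> n" "l \<le> n" "2 \<le> l" using that by auto
      then show ?thesis using nz generic1_nz(2)[OF n M(1), of l] unfolding vm[OF \<open>l - 1 \<le> n\<close> \<open>l \<le> n\<close>] by simp
    qed
    ultimately have h: "h v \<noteq> 0" by (simp add: h_def)
    have v1: "v (n, n + 1) = 1" using nz n by (simp add: M(2) point1_def plvec_def W_basis_def)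
    have v2: "v (i, j) = vminor n v i 0 * vminor n v n (wr j) - vminor n v (wr j) 0 * vminor n v n i"
      if "(i, j) \<in> ?J" for i j
    proof -
      have ij: "i \<le> n" "wr j \<le> n" using that by (auto simp: W_basis_def wr_def)
      have "v (i, j) = minor M i (wr j) / minor M n 0"
        using that by (simp add: M(2) point1_def plvec_def wr_def)
      also have "\<dots> = (minor M i 0 * minor M n (wr j) - minor M (wr j) 0 * minor M n i) / (minor M n 0 * minor M n 0)"
      proof -
        have "minor M i 0 * minor M n (wr j) - minor M (wr j) 0 * minor M n i = minor M i (wr j) * minor M n 0"
          by (simp add: minor_def algebra_simps)
        then show ?thesis using nz by simp
      qed
      finally show ?thesis
        using ij nz by (simp add: M(2) vminor_point1 diff_divide_distrib)
    qed
    have "f v = 0" if "f \<in> E" for f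
    proof -
      from that consider "f = (\<lambda>v. v (n, n + 1) + (- 1))"
        | i j where "(i, j) \<in> ?J" "f = (\<lambda>v. v (i, j) + - (vminor n v i 0 * vminor n v n (wr j)
            + - (vminor n v (wr j) 0 * vminor n v n i)))"
        unfolding E_def by auto
      then show ?thesis
      proof cases
        case 1
        show ?thesis unfolding 1 v1 by simp
      next
        case 2
        show ?thesis unfolding 2(2) v2[OF 2(1)] by simp
      qed
    qed
    then show "v \<in> U \<inter> C" using va h unfolding U_def C_def by blast
  next
    fix v assume v: "v \<in> U \<inter> C"
    let ?M = "section_conf n v"
    have va: "v \<in> aff_space ?J" and E: "\<And>f. f \<in> E \<Longrightarrow> f v = 0" using v unfolding C_def by blast+
    have "(\<lambda>v. v (n, n + 1) + (- 1)) \<in> E" unfolding E_def by (rule insertI1)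
    from E[OF this] have vn: "v (n, n + 1) = 1" by simp
    have eq: "v (i, j) = minor ?M i (wr j)" if "(i, j) \<in> ?J" for i j
    proof -
      have "(\<lambda>v. v (i, j) + - (vminor n v i 0 * vminor n v n (wr j) + - (vminor n v (wr j) 0 * vminor n v n i))) \<in> E"
        unfolding E_def using that by (intro insertI2 image_eqI[where x = "(i, j)"]) simp_all
      from E[OF this] show ?thesis by (simp add: minor_def section_conf_def algebra_simps)
    qed
    have n0: "minor ?M n 0 = 1" using eq[of n "n + 1"] vn n by (simp add: W_basis_def wr_def)
    have "v = point1 n ?M"
    proof
      fix b show "v b = point1 n ?M b"
        using va eq[of "fst b" "snd b"]
        by (cases b; cases "b \<in> ?J") (simp_all add: point1_def n0 plvec_def aff_space_def wr_def)
    qed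
    moreover have "generic1 n ?M"
    proof -
      have nz: "vminor n v l 0 \<noteq> 0" if "l \<in> {1..n}" for l using v that by (auto simp: U_def h_def)
      have nz': "vminor n v (l - 1) l \<noteq> 0" if "l \<in> {2..n}" for l using v that by (auto simp: U_def h_def)
      have "minor ?M l 0 = vminor n v l 0" if "l \<in> {1..n}" for l
        using eq[of l "n + 1"] that by (simp add: W_basis_def wr_def vminor_def)
      moreover have "minor ?M (l - 1) l = vminor n v (l - 1) l" if "l \<in> {2..n}" for l
        using eq[of "l - 1" l] that by (auto simp: W_basis_def wr_def vminor_def)
      ultimately show ?thesis unfolding generic1_def using nz nz' by metis
    qed
    ultimately show "v \<in> \<V>1 n" by (auto simp: \<V>1_eq[OF n])
  qed
  then show ?thesis
    unfolding variety_def using U C irreducible_space_irred[OF irred_V1] by auto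
qed

section \<open>Rationality of the actions\<close>

definition aff_dom :: "nat \<Rightarrow> complex \<Rightarrow> config \<Rightarrow> bool" where
  "aff_dom i c M \<longleftrightarrow> act_dom n i M \<and> generic1 n (col_action n i c M)"

lemma ropen_generic1:
  assumes "U \<subseteq> aff_space J" "reg_conf J U F"
  shows "ropen J U {p \<in> U. generic1 n (F p)}"
  unfolding generic1_def using assms
  by (intro ropen_conj ropen_Ball ropen_nonzero reg_minor ropen_self) auto

lemma ropen_act_dom:
  assumes "U \<subseteq> aff_space J" "reg_conf J U F"
  shows "ropen J U {p \<in> U. act_dom n i (F p)}"
proof (cases "i = 0")
  case True
  then show ?thesis
    unfolding act_dom_def[OF n] using assms
    by (simp, intro ropen_conj ropen_Ball ropen_nonzero reg_minor ropen_self) auto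
next
  case False
  then show ?thesis
    unfolding act_dom_def[OF n] using assms
    by (simp, intro ropen_nonzero reg_minor) auto
qed

text \<open>Both the slices of the action and the action as a map of two variables are of the
  following form.\<close>

lemma action_family:
  fixes i :: nat
  assumes Z: "Z \<subseteq> aff_space K" and F: "reg_conf K Z F" and c: "c \<in> quot_funs K Z"
  defines "D \<equiv> {p \<in> Z. aff_dom i (c p) (F p)}"
  shows "ropen K Z D" "reg_conf K D (\<lambda>p. col_action n i (c p) (F p))"
proof -
  define D1 where "D1 = {p \<in> Z. act_dom n i (F p)}"
  have D1: "ropen K Z D1" unfolding D1_def by (rule ropen_act_dom[OF Z F])
  have sub: "D1 \<subseteq> Z" by (auto simp: D1_def)
  have r: "reg_conf K D1 (\<lambda>p. col_action n i (c p) (F p))"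
    using reg_conf_mono[OF F sub] quot_funs_mono[OF c sub]
    by (intro reg_col_action) (auto simp: D1_def act_dom_def[OF n])
  have "ropen K D1 {p \<in> D1. generic1 n (col_action n i (c p) (F p))}"
    using sub Z by (intro ropen_generic1 r) auto
  also have "{p \<in> D1. generic1 n (col_action n i (c p) (F p))} = D"
    by (auto simp: D1_def D_def aff_dom_def)
  finally show "ropen K Z D" using ropen_trans[OF D1] by blast
  show "reg_conf K D (\<lambda>p. col_action n i (c p) (F p))"
    by (rule reg_conf_mono[OF r]) (auto simp: D_def D1_def aff_dom_def)
qed

lemma rational_action_family:
  assumes Z: "Z \<subseteq> aff_space K" and F: "reg_conf K Z F" and c: "c \<in> quot_funs K Z"
    and f: "\<And>p. f p = (if p \<in> Z \<and> aff_dom i (c p) (F p) then Some (point1 n (col_action n i (c p) (F p))) else None)"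
    and ne: "dom f \<noteq> {}"
  shows "rational_map K Z (W_basis n) (\<V>1 n) f"
    "\<And>b. (\<lambda>p. the (f p) b) \<in> quot_funs K (dom f)" "ropen K Z (dom f)" "ran f \<subseteq> \<V>1 n"
proof -
  have d: "dom f = {p \<in> Z. aff_dom i (c p) (F p)}" by (auto simp: f split: if_splits)
  note a = action_family[OF Z F c, of i, folded d]
  show o: "ropen K Z (dom f)" by (rule a)
  show q: "(\<lambda>p. the (f p) b) \<in> quot_funs K (dom f)" for b
  proof (rule quot_funs_cong)
    show "(\<lambda>p. point1 n (col_action n i (c p) (F p)) b) \<in> quot_funs K (dom f)"
      using n generic1_nz(1)[OF n, of _ n] by (intro reg_point1 a(2)) (auto simp: d aff_dom_def)
  qed (auto simp: f d)
  show r: "ran f \<subseteq> \<V>1 n"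
    by (auto simp: ran_def f \<V>1_eq[OF n] aff_dom_def split: if_splits)
  show "rational_map K Z (W_basis n) (\<V>1 n) f"
    by (rule rational_mapI[OF Z o ne r q])
qed

lemma aff_e_section:
  assumes "c \<noteq> 0" "i \<le> n"
  shows "aff_e n i c v = (if v \<in> \<V>1 n \<and> aff_dom i c (section_conf n v)
    then Some (point1 n (col_action n i c (section_conf n v))) else None)"
proof (cases "v \<in> \<V>1 n")
  case True
  then show ?thesis
    using aff_e_point1[OF n section_conf_V1(1)[OF True] assms] section_conf_V1(2)[OF True]
    by (simp add: aff_dom_def)
qed (simp add: aff_e_None[OF n])

lemma aff_e_Some:
  assumes "aff_e n i c (point1 n M) = Some w" "generic1 n M" "i \<le> n"
  shows "c \<noteq> 0" "act_dom n i M" "generic1 n (col_action n i c M)" "w = point1 n (col_action n i c M)"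
proof -
  show c: "c \<noteq> 0" using aff_e_None[OF n, of "point1 n M" c i] assms(1) by auto
  show "act_dom n i M" "generic1 n (col_action n i c M)" "w = point1 n (col_action n i c M)"
    using aff_e_point1[OF n assms(2) c assms(3)] assms(1) by (auto split: if_splits)
qed

lemma act_dom_nz: "act_dom n i M \<Longrightarrow> minor M (prev_idx n i) (next_idx n i) \<noteq> 0"
  by (simp add: act_dom_def[OF n])

text \<open>Openness does not exclude an empty domain, and every slice needs a point, so one is
  exhibited for each \<open>c\<close>.\<close>

lemma exists_act:
  assumes "c \<noteq> 0" "i \<le> n"
  obtains v where "v \<in> dom (aff_e n i c)"
proof -
  have T: "(\<lambda>k. if k \<in> {2..2*n-1} then if k = m then t else 1 else 0) \<in> T1 n" if "t \<noteq> 0" for m t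
    using that by (auto simp: T1_def torus_def aff_space_def)
  consider "i = 0" | "i = 1 \<or> i = n" | "2 \<le> i" "i < n" using assms by linarith
  then show thesis
  proof cases
    case 1
    \<comment> \<open>Column 0 is (0, 1) and the other columns are (1, S l), so their minors are
      differences of \<open>S\<close>. The two progressions are the values of \<open>t\<close> that
      would make an old minor against column \<open>n\<close>, or a new minor against column 0,
      vanish.\<close>
    define A where "A = {of_nat l | l. l \<le> n} \<union> {(1 - c) * of_nat l | l. l \<le> n}"
    have "finite A" unfolding A_def by auto
    then obtain t where t: "t \<notin> A" using ex_new_if_finite[OF infinite_UNIV_char_0] by blast
    define S :: "nat \<Rightarrow> complex" where "S l = (if l = n then t else of_nat (l - 1))" for l
    define M :: config where "M = (\<lambda>l. if l = 0 then 0 else 1, \<lambda>l. if l = 0 then 1 else S l)"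
    have m: "minor M k l = S l - S k" if "1 \<le> k" "1 \<le> l" for k l using that by (auto simp: minor_def M_def)
    have m0: "minor M k 0 = 1" if "1 \<le> k" for k using that by (auto simp: minor_def M_def)
    have tS: "t \<noteq> of_nat l" "t \<noteq> (1 - c) * of_nat l" if "l \<le> n" for l using t that by (auto simp: A_def)
    have S: "S (l - 1) \<noteq> S l" if l: "l \<in> {2..n}" for l
    proof (cases "l = n")
      case True
      then show ?thesis using tS(1)[of "n - 2"] n by (simp add: S_def numeral_2_eq_2)
    next
      case False
      then have "l - 1 - 1 \<noteq> l - 1" "l - 1 \<noteq> n" using l by auto
      then show ?thesis using False unfolding S_def by (metis of_nat_eq_iff)
    qed
    have "minor M (l - 1) l \<noteq> 0" if "l \<in> {2..n}" for l
    proof -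
      have "1 \<le> l - 1" "1 \<le> l" using that by auto
      from m[OF this] show ?thesis using S[OF that] by simp
    qed
    then have g: "generic1 n M" by (simp add: generic1_def m0)
    have "minor M n 1 \<noteq> 0" using n tS(1)[of 0] by (simp add: m S_def)
    moreover have "minor M k n \<noteq> 0" if "k \<in> {1..<n}" for k
    proof -
      have "1 \<le> k" "1 \<le> n" "k - 1 \<le> n" "k \<noteq> n" using that by auto
      then show ?thesis using tS(1)[of "k - 1"] m[of k n] by (simp add: S_def)
    qed
    ultimately have ad: "act_dom n 0 M"
      using n by (auto simp: act_dom_def[OF n] prev_idx_def next_idx_def)
    have "generic1 n (col_action n 0 c M)"
    proof (rule generic1_col_action[OF n g _ assms(1) act_dom_nz[OF ad]])
      fix l assume l: "1 \<le> l" "l \<le> n"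
      have t0: "t \<noteq> 0" using tS(1)[of 0] by simp
      have "minor (col_action n 0 c M) l 0 = 1 + (c - 1) / (S 1 - S n) * (S 1 - S l)"
        using l n by (simp add: minor_col_action[OF n] Let_def prev_idx_def next_idx_def m m0)
      also have "\<dots> = (t + (c - 1) * S l) / t" using n t0 by (simp add: S_def field_simps)
      also have "\<dots> \<noteq> 0"
      proof (cases "l = n")
        case True
        then show ?thesis using t0 assms(1) by (simp add: S_def algebra_simps)
      next
        case False
        have "t + (c - 1) * S l = t - (1 - c) * of_nat (l - 1)" using False by (simp add: S_def algebra_simps)
        then show ?thesis using tS(2)[of "l - 1"] l t0 by simp
      qed
      finally show "minor (col_action n 0 c M) l 0 \<noteq> 0" .
    qed simp
    then show thesis
      using that aff_e_point1[OF n g assms] ad 1 by (metis domI)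
  next
    case 2
    \<comment> \<open>The point with all parameters 1, written in the shape that \<open>T\<close>
      provides.\<close>
    have "generic1 n (frame1 n (\<lambda>k. if k \<in> {2..2*n-1} then if k = n then 1 else 1 else 0))"
      using frame1_chart(1)[OF n T] by simp
    then show thesis using that aff_e_end(3)[OF n _ assms(1) 2] by blast
  next
    case 3
    \<comment> \<open>For the point chosen here p = 1 and q = t; the excluded values keep
      \<open>t\<close>, \<open>p + q\<close> and \<open>c * p + q\<close> nonzero.\<close>
    have "finite {0, -1, -c}" by simp
    then obtain t where t: "t \<notin> {0, -1, -c}" using ex_new_if_finite[OF infinite_UNIV_char_0] by blast
    define x where "x = (\<lambda>k. if k \<in> {2..2*n-1} then if k = i + 1 then t else 1 else 0)"
    have x: "x \<in> T1 n" unfolding x_def by (rule T) (use t in auto)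
    have "x i * x (n + i) = 1" "x (i + 1) * x (n + i - 1) = t" using 3 by (auto simp: x_def)
    moreover have "1 + t \<noteq> 0" "c + t \<noteq> 0" using t by (auto simp: add_eq_0_iff)
    ultimately have "e1 n i c (V1 n x) \<noteq> None" using e1_middle[OF n x assms(1) 3] by simp
    then show thesis using that[of "V1 n x"] 3 by (auto simp: aff_e_def)
  qed
qed

lemma aff_e_slice:
  assumes "c \<noteq> 0" "i \<le> n"
  shows "rational_map (W_basis n) (\<V>1 n) (W_basis n) (\<V>1 n) (aff_e n i c)"
    "(\<lambda>p. the (aff_e n i c p) b) \<in> quot_funs (W_basis n) (dom (aff_e n i c))"
    "ropen (W_basis n) (\<V>1 n) (dom (aff_e n i c))" "dom (aff_e n i c) \<noteq> {}" "ran (aff_e n i c) \<subseteq> \<V>1 n"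
proof -
  show ne: "dom (aff_e n i c) \<noteq> {}" using exists_act[OF assms] by blast
  note r = rational_action_family[OF V1_sub reg_section_conf[OF V1_sub] quot_funs_const aff_e_section[OF assms] ne]
  show "rational_map (W_basis n) (\<V>1 n) (W_basis n) (\<V>1 n) (aff_e n i c)"
    "(\<lambda>p. the (aff_e n i c p) b) \<in> quot_funs (W_basis n) (dom (aff_e n i c))"
    "ropen (W_basis n) (\<V>1 n) (dom (aff_e n i c))" "ran (aff_e n i c) \<subseteq> \<V>1 n"
    using r by auto
qed

lemma act_dom_col_action:
  assumes "i \<le> n" "act_dom n i M"
  shows "act_dom n i (col_action n i c M)"
  using assms idx_distinct[OF n assms(1)] by (simp add: act_dom_def[OF n])

text \<open>An exact equality wherever the first action is defined: an action leaves the minors in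
  its own \<open>act_dom\<close> untouched, and the composite of the column actions is a single one,
  so both sides have the same domain condition.\<close>

lemma aff_e_compose:
  assumes "aff_e n i d v = Some w" "i \<le> n" "c \<noteq> 0"
  shows "aff_e n i c w = aff_e n i (c * d) v"
proof -
  have "v \<in> \<V>1 n" using aff_e_None[OF n, of v d i] assms(1) by auto
  then obtain M where M: "generic1 n M" "v = point1 n M" by (auto simp: \<V>1_eq[OF n])
  note s = aff_e_Some[OF assms(1)[unfolded M(2)] M(1) assms(2)]
  have "c * d \<noteq> 0" using s assms by simp
  then show ?thesis
    unfolding s(4) M(2) aff_e_point1[OF n s(3) assms(3,2)]
    using aff_e_point1[OF n M(1) _ assms(2), of "c * d"] s act_dom_col_action[OF assms(2) s(2)]
    by (simp add: col_action_mult[OF n assms(2) act_dom_nz])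
qed

lemma aff_e_one: "i \<le> n \<Longrightarrow> aff_e n i 1 v = Some w \<Longrightarrow> w = v"
  using aff_e_section[of 1 i v] section_conf_V1(2)[of v] by (auto split: if_splits)

lemma aff_e_inverse:
  assumes "aff_e n i (1 / c) w = Some v" "i \<le> n" "c \<noteq> 0"
  shows "aff_e n i c v = Some w"
proof -
  have w: "w \<in> \<V>1 n" using aff_e_None[OF n, of w "1/c" i] assms(1) by auto
  have "aff_e n i c v = aff_e n i 1 w" using aff_e_compose[OF assms] assms(3) by simp
  moreover have "aff_e n i (1 / c) w \<noteq> None" using assms(1) by simp
  then have "act_dom n i (section_conf n w)"
    using aff_e_section[of "1/c" i w] assms by (auto simp: aff_dom_def split: if_splits)
  then have "aff_e n i 1 w = Some w"
    using w aff_e_section[of 1 i w] assms(2) section_conf_V1[OF w] by (simp add: aff_dom_def)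
  ultimately show ?thesis by simp
qed

text \<open>Since every \<open>e\<^sub>i\<^sup>c\<close> is inverted by \<open>e\<^sub>i\<^sup>1\<^sup>/\<^sup>c\<close>, it is dominant, and composing
  with it preserves having a nonempty open domain.\<close>

lemma aff_e_dominant:
  assumes "c \<noteq> 0" "i \<le> n" "ropen (W_basis n) (\<V>1 n) (dom g)" "dom g \<noteq> {}"
  shows "ropen (W_basis n) (\<V>1 n) (dom (g \<circ>\<^sub>m aff_e n i c))" "dom (g \<circ>\<^sub>m aff_e n i c) \<noteq> {}"
proof -
  show "ropen (W_basis n) (\<V>1 n) (dom (g \<circ>\<^sub>m aff_e n i c))"
    using aff_e_slice[OF assms(1,2)] assms(3) by (intro ropen_dom_map_comp[OF V1_sub V1_sub])
  have c': "1 / c \<noteq> 0" using assms(1) by simp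
  \<comment> \<open>A point of \<open>dom g\<close> at which the inverse action is defined; its
    image is a point that \<open>aff_e n i c\<close> takes into \<open>dom g\<close>.\<close>
  have "dom (aff_e n i (1 / c)) \<inter> dom g \<noteq> {}"
    using aff_e_slice(3,4)[OF c' assms(2)] assms(3,4) by (intro irredD[OF irred_V1])
  then obtain w v where "w \<in> dom g" "aff_e n i (1 / c) w = Some v" by auto
  then have "v \<in> dom (g \<circ>\<^sub>m aff_e n i c)"
    using aff_e_inverse[OF _ assms(2,1)] by (auto simp: dom_map_comp)
  then show "dom (g \<circ>\<^sub>m aff_e n i c) \<noteq> {}" by blast
qed

text \<open>Moves rational identities to generic configurations, where all maps are explicit in
  minors.\<close>

lemma aff_rat_eqI:
  assumes "ropen (W_basis n) (\<V>1 n) (dom f)" "dom f \<noteq> {}" "ropen (W_basis n) (\<V>1 n) (dom g)" "dom g \<noteq> {}"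
    "\<And>M a b. generic1 n M \<Longrightarrow> f (point1 n M) = Some a \<Longrightarrow> g (point1 n M) = Some b \<Longrightarrow> a = b"
  shows "rat_eq (W_basis n) (\<V>1 n) f g"
proof -
  have "\<V>1 n \<inter> dom f = dom f" "\<V>1 n \<inter> dom g = dom g" using ropen_subset assms(1,3) by blast+
  then show ?thesis
    using assms by (intro rat_eqI[OF irred_V1]) (auto simp: \<V>1_eq[OF n])
qed

section \<open>The actions as maps of two variables\<close>

lemma Gm_times_sub: "Gm_times (\<V>1 n) \<subseteq> aff_space (opt_index (W_basis n))"
  using V1_sub by (fastforce simp: Gm_times_def aff_space_def opt_index_def split: option.splits)

lemma Gm_times_iff: "p \<in> Gm_times X \<longleftrightarrow> p None \<noteq> 0 \<and> p \<circ> Some \<in> X"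
proof
  assume "p None \<noteq> 0 \<and> p \<circ> Some \<in> X"
  moreover have "p = case_option (p None) (p \<circ> Some)" by (auto simp: fun_eq_iff split: option.splits)
  ultimately show "p \<in> Gm_times X" unfolding Gm_times_def by blast
qed (auto simp: Gm_times_def comp_def)

lemma reg_conf_compose:
  assumes "reg_conf K V F" "\<phi> ` U \<subseteq> V" "\<And>k. k \<in> K \<Longrightarrow> (\<lambda>p. \<phi> p k) \<in> quot_funs J U"
  shows "reg_conf J U (\<lambda>p. F (\<phi> p))"
  using assms quot_funs_compose[OF _ assms(2,3)] unfolding reg_conf_def by blast

text \<open>The group element enters only through the coefficient of the shear, so it may serve as
  one more coordinate of a regular family.\<close>

lemma aff_e_joint:
  assumes "i \<le> n"
  shows "rational_map (opt_index (W_basis n)) (Gm_times (\<V>1 n)) (W_basis n) (\<V>1 n) (joint_map (aff_e n i))"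
proof (rule rational_action_family(1)[OF Gm_times_sub, of "\<lambda>p. section_conf n (p \<circ> Some)" "\<lambda>p. p None" _ i])
  show "reg_conf (opt_index (W_basis n)) (Gm_times (\<V>1 n)) (\<lambda>p. section_conf n (p \<circ> Some))"
    by (rule reg_conf_compose[OF reg_section_conf[OF V1_sub]])
      (auto simp: Gm_times_iff comp_def intro: quot_funs_coord[OF Gm_times_sub])
  show "(\<lambda>p. p None) \<in> quot_funs (opt_index (W_basis n)) (Gm_times (\<V>1 n))"
    by (rule quot_funs_coord[OF Gm_times_sub])
  show "joint_map (aff_e n i) p = (if p \<in> Gm_times (\<V>1 n) \<and> aff_dom i (p None) (section_conf n (p \<circ> Some))
    then Some (point1 n (col_action n i (p None) (section_conf n (p \<circ> Some)))) else None)" for p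
  proof (cases "p \<in> Gm_times (\<V>1 n)")
    case True
    then show ?thesis
      using aff_e_section[OF _ assms, of "p None" "p \<circ> Some"] by (simp add: joint_map_def Gm_times_iff)
  next
    case False
    then show ?thesis
      using aff_e_None[OF n, of "p \<circ> Some" "p None" i] by (auto simp: joint_map_def Gm_times_iff)
  qed
  obtain v where "v \<in> dom (aff_e n i 1)" using exists_act[of 1 i] assms by auto
  then have "case_option 1 v \<in> dom (joint_map (aff_e n i))"
    by (auto simp: joint_map_def comp_def)
  then show "dom (joint_map (aff_e n i)) \<noteq> {}" by blast
qed

lemma rat_eq_Some:
  assumes "i \<le> n"
  shows "rat_eq (W_basis n) (\<V>1 n) (aff_e n i 1) Some"
proof (rule rat_eqI[OF irred_V1])
  have "\<V>1 n \<inter> dom (aff_e n i 1) = dom (aff_e n i 1)"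
    using ropen_subset[OF aff_e_slice(3)[of 1 i]] assms by auto
  then show "ropen (W_basis n) (\<V>1 n) (\<V>1 n \<inter> dom (aff_e n i 1))" "\<V>1 n \<inter> dom (aff_e n i 1) \<noteq> {}"
    using aff_e_slice(3,4)[of 1 i] assms by auto
  show "ropen (W_basis n) (\<V>1 n) (\<V>1 n \<inter> dom Some)" "\<V>1 n \<inter> dom Some \<noteq> {}"
    using ropen_self[OF V1_sub] irred_V1 by (auto simp: irred_def dom_def)
qed (use aff_e_one[OF assms] in auto)

lemma aff_action:
  assumes "i \<le> n"
  shows "rational_Gm_action (W_basis n) (\<V>1 n) (aff_e n i)"
  unfolding rational_Gm_action_def
proof (intro conjI allI impI)
  fix c d :: complex assume c: "c \<noteq> 0" "d \<noteq> 0"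
  then have cd: "c * d \<noteq> 0" by simp
  show "rat_eq (W_basis n) (\<V>1 n) (aff_e n i c \<circ>\<^sub>m aff_e n i d) (aff_e n i (c * d))"
  proof (rule aff_rat_eqI)
    fix M a b
    assume "generic1 n M" "(aff_e n i c \<circ>\<^sub>m aff_e n i d) (point1 n M) = Some a"
      "aff_e n i (c * d) (point1 n M) = Some b"
    then show "a = b" using aff_e_compose[OF _ assms c(1)] by (auto simp: map_comp_Some_iff)
  qed (intro aff_e_dominant aff_e_slice(3,4) c cd assms)+
qed (use aff_e_joint rat_eq_Some assms in auto)

text \<open>Density is the main point: an open set meeting \<open>{1} \<times> X\<close> pulls back
  to a nonempty open subset of \<open>X\<close>, which meets the domain of \<open>e 1\<close> by
  irreducibility.\<close>

lemma aff_unit_domain: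
  assumes "i \<le> n"
  shows "unit_domain_condition (W_basis n) (\<V>1 n) (aff_e n i)"
proof -
  let ?J = "W_basis n" and ?X = "\<V>1 n" and ?K = "opt_index (W_basis n)"
  let ?Z = "zariski ?K" and ?X1 = "case_option 1 ` ?X"
  let ?R = "rat_dom ?K (Gm_times ?X) ?J ?X (joint_map (aff_e n i))"
  have X1: "?X1 \<subseteq> Gm_times ?X" by (auto simp: Gm_times_iff comp_def)
  have "openin (subtopology ?Z (Gm_times ?X)) ?R"
    unfolding rat_dom_def by (intro openin_Union) (auto simp: rational_map_def)
  then have o: "openin (subtopology ?Z ?X1) (?X1 \<inter> ?R)"
    unfolding openin_subtopology using X1 by blast
  have jd: "dom (joint_map (aff_e n i)) \<subseteq> ?R"
  proof -
    have "rat_eq ?K (Gm_times ?X) (joint_map (aff_e n i)) (joint_map (aff_e n i))"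
      unfolding rat_eq_def using aff_e_joint[OF assms] unfolding rational_map_def by blast
    then show ?thesis unfolding rat_dom_def using aff_e_joint[OF assms] by blast
  qed
  have cl: "?X1 \<subseteq> ?Z closure_of (?X1 \<inter> ?R)"
  proof
    fix q assume q: "q \<in> ?X1"
    show "q \<in> ?Z closure_of (?X1 \<inter> ?R)"
      unfolding in_closure_of topspace_zariski
    proof (intro conjI allI impI)
      show "q \<in> aff_space ?K" using q X1 Gm_times_sub by blast
      fix T assume T: "q \<in> T \<and> openin ?Z T"
      have "ropen ?J ?X {v \<in> ?X. case_option 1 v \<in> T \<inter> Gm_times ?X}"
      proof (rule ropen_vimage[OF V1_sub Gm_times_sub X1])
        show "ropen ?K (Gm_times ?X) (T \<inter> Gm_times ?X)"
          unfolding ropen_def openin_subtopology using T by blast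
        fix k assume "k \<in> ?K"
        show "(\<lambda>v. case_option 1 v k) \<in> quot_funs ?J ?X"
          by (cases k) (auto intro: quot_funs_coord[OF V1_sub])
      qed
      moreover have "{v \<in> ?X. case_option 1 v \<in> T \<inter> Gm_times ?X} \<noteq> {}" using q T X1 by blast
      ultimately have "{v \<in> ?X. case_option 1 v \<in> T \<inter> Gm_times ?X} \<inter> dom (aff_e n i 1) \<noteq> {}"
        using aff_e_slice(3,4)[OF one_neq_zero assms] by (intro irredD[OF irred_V1])
      then obtain v where v: "v \<in> ?X" "case_option 1 v \<in> T" "v \<in> dom (aff_e n i 1)" by blast
      then have "case_option 1 v \<in> dom (joint_map (aff_e n i))" by (auto simp: joint_map_def comp_def)
      then show "\<exists>y. y \<in> ?X1 \<inter> ?R \<and> y \<in> T" using v jd by blast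
    qed
  qed
  \<comment> \<open>The identity of \<open>X\<close> is a representative of \<open>e 1\<close>
    defined on all of \<open>X\<close>.\<close>
  define g where "g v = (if v \<in> ?X then Some v else None)" for v
  have g: "dom g = ?X" by (auto simp: g_def split: if_splits)
  have "rational_map ?J ?X ?J ?X g"
  proof (rule rational_mapI[OF V1_sub])
    show "(\<lambda>p. the (g p) k) \<in> quot_funs ?J (dom g)" for k
      unfolding g by (rule quot_funs_cong[OF quot_funs_coord[OF V1_sub, of k]]) (simp add: g_def)
  qed (use ropen_self[OF V1_sub] irred_V1 in \<open>auto simp: g ran_def irred_def, auto simp: g_def split: if_splits\<close>)
  moreover have "rat_eq ?J ?X (aff_e n i 1) g"
  proof (rule aff_rat_eqI)
    fix M a b assume "aff_e n i 1 (point1 n M) = Some a" "g (point1 n M) = Some b"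
    then show "a = b" using aff_e_one[OF assms] by (auto simp: g_def split: if_splits)
  qed (use aff_e_slice(3,4)[OF one_neq_zero assms] ropen_self[OF V1_sub] irred_V1 in \<open>auto simp: g irred_def\<close>)
  ultimately have "?X \<subseteq> rat_dom ?J ?X ?J ?X (aff_e n i 1)"
    unfolding rat_dom_def using g by blast
  then show ?thesis unfolding unit_domain_condition_def Let_def using o cl by blast
qed

section \<open>Rationality of \<gamma> and \<epsilon>\<close>

lemma reg_cyc_minor: "reg_conf J U F \<Longrightarrow> (\<lambda>p. cyc_minor n (F p) j) \<in> quot_funs J U"
  unfolding cyc_minor_def[OF n] by (cases "j = 1") (auto intro: reg_minor)

text \<open>Common treatment of \<gamma> and \<epsilon>: they are defined on all of
  \<open>\<V>1 n\<close>, except that for \<open>i = 0\<close> they are restricted to the domain of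
  \<open>sigma\<close>.\<close>

lemma data_rational:
  fixes f :: "wvec \<rightharpoonup> complex"
  assumes "i \<le> n"
    and f: "\<And>M. generic1 n M \<Longrightarrow> f (point1 n M) =
      (if i = 0 \<and> (\<exists>k\<in>{1..<n}. minor M k n = 0) then None else Some (h M))"
    and None: "\<And>v. v \<notin> \<V>1 n \<Longrightarrow> f v = None"
    and h: "(\<lambda>v. h (section_conf n v)) \<in> quot_funs (W_basis n) (\<V>1 n)"
  shows "rational_function (W_basis n) (\<V>1 n) f" "ropen (W_basis n) (\<V>1 n) (dom f)" "dom f \<noteq> {}"
proof -
  have s: "f v = (if i = 0 \<and> (\<exists>k\<in>{1..<n}. minor (section_conf n v) k n = 0) then None
    else Some (h (section_conf n v)))" if "v \<in> \<V>1 n" for v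
    using f[OF section_conf_V1(1)[OF that]] section_conf_V1(2)[OF that] by simp
  \<comment> \<open>The index set of \<open>k\<close> is empty unless \<open>i = 0\<close>, so one
    open condition covers both cases.\<close>
  have d: "dom f = {v \<in> \<V>1 n. \<forall>k\<in>{k\<in>{1..<n}. i = 0}. minor (section_conf n v) k n \<noteq> 0}"
  proof (rule set_eqI)
    fix v
    show "v \<in> dom f \<longleftrightarrow> v \<in> {v \<in> \<V>1 n. \<forall>k\<in>{k\<in>{1..<n}. i = 0}. minor (section_conf n v) k n \<noteq> 0}"
      by (cases "v \<in> \<V>1 n") (auto simp: s None domIff)
  qed
  show o: "ropen (W_basis n) (\<V>1 n) (dom f)" unfolding d
    by (intro ropen_Ball ropen_nonzero reg_minor reg_section_conf V1_sub ropen_self) auto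
  obtain v where v: "v \<in> dom (aff_e n 0 1)" using exists_act[of 1 0] by auto
  then have "v \<in> \<V>1 n" "act_dom n 0 (section_conf n v)"
    using aff_e_section[of 1 0 v] by (auto simp: aff_dom_def split: if_splits)
  then have "v \<in> dom f" unfolding d by (auto simp: act_dom_def[OF n])
  then show ne: "dom f \<noteq> {}" by blast
  show "rational_function (W_basis n) (\<V>1 n) f"
  proof (rule rational_functionI[OF V1_sub o ne])
    have sub: "dom f \<subseteq> \<V>1 n" by (auto simp: d)
    show "(\<lambda>p. the (f p)) \<in> quot_funs (W_basis n) (dom f)"
      by (rule quot_funs_cong[OF quot_funs_mono[OF h sub]])
        (use s in \<open>auto simp: d split: if_splits\<close>)
  qed
qed

lemma sigma_None: "v \<notin> \<V>1 n \<Longrightarrow> sigma n v = None"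
  using sigma_dom[OF n] by blast

lemma aff_gamma_rational:
  assumes "i \<le> n"
  shows "rational_function (W_basis n) (\<V>1 n) (aff_\<gamma> n i)" "ropen (W_basis n) (\<V>1 n) (dom (aff_\<gamma> n i))"
    "dom (aff_\<gamma> n i) \<noteq> {}"
proof -
  have h: "(\<lambda>v. gamma_conf n i (section_conf n v)) \<in> quot_funs (W_basis n) (\<V>1 n)"
    unfolding gamma_conf_def[OF n] power2_eq_square
    using assms cyc_minor_nz[OF n section_conf_V1(1)]
    by (intro quot_funs_divide quot_funs_mult reg_cyc_minor reg_section_conf V1_sub) auto
  have N: "v \<notin> \<V>1 n \<Longrightarrow> aff_\<gamma> n i v = None" for v
    using sigma_None by (auto simp: aff_\<gamma>_def \<gamma>1_def)
  show "rational_function (W_basis n) (\<V>1 n) (aff_\<gamma> n i)" "ropen (W_basis n) (\<V>1 n) (dom (aff_\<gamma> n i))"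
    "dom (aff_\<gamma> n i) \<noteq> {}"
    using data_rational[OF assms aff_gamma_point1[OF n _ assms] N h] by blast+
qed

lemma step_minor_nz:
  assumes "generic1 n M" "i \<le> n"
  shows "minor M (prev_idx n i) i \<noteq> 0"
  using cyc_minor_nz[OF n assms] minor_swap[of M 0 1]
  by (cases "i = 1") (auto simp: cyc_minor_def[OF n] prev_idx_def)

lemma aff_epsilon_rational:
  assumes "i \<le> n"
  shows "rational_function (W_basis n) (\<V>1 n) (aff_\<epsilon> n i)" "ropen (W_basis n) (\<V>1 n) (dom (aff_\<epsilon> n i))"
    "dom (aff_\<epsilon> n i) \<noteq> {}"
proof -
  have h: "(\<lambda>v. eps_conf n i (section_conf n v)) \<in> quot_funs (W_basis n) (\<V>1 n)"
    unfolding eps_conf_def[OF n]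
    using assms step_minor_nz[OF section_conf_V1(1)]
    by (intro quot_funs_divide quot_funs_mult quot_funs_const reg_minor reg_section_conf V1_sub) auto
  have N: "v \<notin> \<V>1 n \<Longrightarrow> aff_\<epsilon> n i v = None" for v
    using sigma_None by (auto simp: aff_\<epsilon>_def \<epsilon>1_def)
  show "rational_function (W_basis n) (\<V>1 n) (aff_\<epsilon> n i)" "ropen (W_basis n) (\<V>1 n) (dom (aff_\<epsilon> n i))"
    "dom (aff_\<epsilon> n i) \<noteq> {}"
    using data_rational[OF assms aff_epsilon_point1[OF n _ assms] N h] by blast+
qed

section \<open>Verification of the crystal axioms\<close>

lemma gamma_conf_col_action:
  assumes "i \<le> n" "j \<le> n" "minor M (prev_idx n i) (next_idx n i) \<noteq> 0" "c \<noteq> 0"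
  shows "gamma_conf n j (col_action n i c M) = c powi cartan n i j * gamma_conf n j M"
proof -
  note d = idx_distinct[OF n assms(2)]
  \<comment> \<open>Only D_i is rescaled, and its exponent in \<gamma>_j is 2, -1 or 0, which is the
    Cartan entry.\<close>
  have C: "cyc_minor n (col_action n i c M) k = (if k = i then c else 1) * cyc_minor n M k" if "k \<le> n" for k
    by (rule cyc_minor_col_action[OF n assms(1) that assms(3)])
  consider "i = j" | "i = next_idx n j" | "i = prev_idx n j"
    | "i \<noteq> j" "i \<noteq> next_idx n j" "i \<noteq> prev_idx n j" by blast
  then show ?thesis
    using d assms(4) unfolding gamma_conf_def[OF n] cartan_eq[OF assms(2,1)]
      C[OF assms(2)] C[OF prev_idx_le[OF assms(2)]] C[OF next_idx_le[OF assms(2)]]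
    by cases (auto simp: power_int_minus power_mult_distrib divide_inverse mult_ac)
qed

lemma cartan_zero:
  assumes "i \<le> n" "j \<le> n" "cartan n i j = 0"
  shows "j \<noteq> i" "j \<noteq> next_idx n i" "j \<noteq> prev_idx n i" "i \<noteq> next_idx n j" "i \<noteq> prev_idx n j"
  using assms by (auto simp: cartan_eq split: if_splits)

theorem aff_geometric_crystal:
  "geometric_crystal {0..n} (cartan n) (W_basis n) (\<V>1 n) (aff_e n) (aff_\<gamma> n) (aff_\<epsilon> n)"
  unfolding geometric_crystal_def
proof (intro conjI ballI allI impI)
  show "variety (W_basis n) (\<V>1 n)" by (rule variety_V1)
next
  fix i assume "i \<in> {0..n}"
  then have i: "i \<le> n" by simp
  show "rational_Gm_action (W_basis n) (\<V>1 n) (aff_e n i)" by (rule aff_action[OF i])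
  show "rational_function (W_basis n) (\<V>1 n) (aff_\<gamma> n i)" by (rule aff_gamma_rational[OF i])
  show "rational_function (W_basis n) (\<V>1 n) (aff_\<epsilon> n i)" by (rule aff_epsilon_rational[OF i])
  show "unit_domain_condition (W_basis n) (\<V>1 n) (aff_e n i)" by (rule aff_unit_domain[OF i])
next
  fix i j and c :: complex assume "i \<in> {0..n}" "j \<in> {0..n}" and c: "c \<noteq> 0"
  then have i: "i \<le> n" and j: "j \<le> n" by auto
  have d: "dom (\<lambda>x. map_option ((*) (c powi cartan n i j)) (aff_\<gamma> n j x)) = dom (aff_\<gamma> n j)"
    by (auto simp: dom_def)
  show "rat_eq (W_basis n) (\<V>1 n) (aff_\<gamma> n j \<circ>\<^sub>m aff_e n i c)
    (\<lambda>x. map_option (\<lambda>z. c powi cartan n i j * z) (aff_\<gamma> n j x))"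
  proof (rule aff_rat_eqI)
    fix M a b assume M: "generic1 n M" "(aff_\<gamma> n j \<circ>\<^sub>m aff_e n i c) (point1 n M) = Some a"
      "map_option (\<lambda>z. c powi cartan n i j * z) (aff_\<gamma> n j (point1 n M)) = Some b"
    then obtain w where w: "aff_e n i c (point1 n M) = Some w" "aff_\<gamma> n j w = Some a"
      by (auto simp: map_comp_Some_iff)
    note s = aff_e_Some[OF w(1) M(1) i]
    have "a = gamma_conf n j (col_action n i c M)"
      using w(2) aff_gamma_point1[OF n s(3) j] by (auto simp: s(4) split: if_splits)
    moreover have "b = c powi cartan n i j * gamma_conf n j M"
      using M(3) aff_gamma_point1[OF n M(1) j] by (auto split: if_splits)
    ultimately show "a = b" using gamma_conf_col_action[OF i j act_dom_nz[OF s(2)] c] by simp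
  qed (intro aff_e_dominant aff_gamma_rational(2,3) c i j | subst d)+
next
  fix i j and c1 c2 :: complex assume "i \<in> {0..n}" "j \<in> {0..n}" and c: "c1 \<noteq> 0" "c2 \<noteq> 0"
    and a: "cartan n i j = 0" "cartan n j i = 0"
  then have i: "i \<le> n" and j: "j \<le> n" by auto
  show "rat_eq (W_basis n) (\<V>1 n) (aff_e n i c1 \<circ>\<^sub>m aff_e n j c2) (aff_e n j c2 \<circ>\<^sub>m aff_e n i c1)"
  proof (rule aff_rat_eqI)
    fix M a b assume M: "generic1 n M" and "(aff_e n i c1 \<circ>\<^sub>m aff_e n j c2) (point1 n M) = Some a"
      "(aff_e n j c2 \<circ>\<^sub>m aff_e n i c1) (point1 n M) = Some b"
    then obtain u w where u: "aff_e n j c2 (point1 n M) = Some u" "aff_e n i c1 u = Some a"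
      and w: "aff_e n i c1 (point1 n M) = Some w" "aff_e n j c2 w = Some b"
      by (auto simp: map_comp_Some_iff)
    note su = aff_e_Some[OF u(1) M j] and sw = aff_e_Some[OF w(1) M i]
    note su' = aff_e_Some[OF u(2)[unfolded su(4)] su(3) i] and sw' = aff_e_Some[OF w(2)[unfolded sw(4)] sw(3) j]
    show "a = b" unfolding su'(4) sw'(4)
      by (subst col_action_commute[OF cartan_zero[OF i j a(1)]]) simp
  qed (intro aff_e_dominant aff_e_slice(3,4) c i j)+
next
  fix i j and c1 c2 :: complex assume "i \<in> {0..n}" "j \<in> {0..n}" and c: "c1 \<noteq> 0" "c2 \<noteq> 0"
    and a: "cartan n i j = -1" "cartan n j i = -1"
  then have i: "i \<le> n" and j: "j \<le> n" and c12: "c1 * c2 \<noteq> 0" by auto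
  show "rat_eq (W_basis n) (\<V>1 n) (aff_e n i c1 \<circ>\<^sub>m aff_e n j (c1 * c2) \<circ>\<^sub>m aff_e n i c2)
    (aff_e n j c2 \<circ>\<^sub>m aff_e n i (c1 * c2) \<circ>\<^sub>m aff_e n j c1)"
  proof (rule aff_rat_eqI)
    fix M a' b assume M: "generic1 n M"
      and "(aff_e n i c1 \<circ>\<^sub>m aff_e n j (c1 * c2) \<circ>\<^sub>m aff_e n i c2) (point1 n M) = Some a'"
      "(aff_e n j c2 \<circ>\<^sub>m aff_e n i (c1 * c2) \<circ>\<^sub>m aff_e n j c1) (point1 n M) = Some b"
    then obtain u u' w w' where u: "aff_e n i c2 (point1 n M) = Some u" "aff_e n j (c1 * c2) u = Some u'"
        "aff_e n i c1 u' = Some a'"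
      and w: "aff_e n j c1 (point1 n M) = Some w" "aff_e n i (c1 * c2) w = Some w'"
        "aff_e n j c2 w' = Some b"
      by (auto simp: map_comp_Some_iff)
    note u1 = aff_e_Some[OF u(1) M i]
    note u2 = aff_e_Some[OF u(2)[unfolded u1(4)] u1(3) j]
    note u3 = aff_e_Some[OF u(3)[unfolded u2(4)] u2(3) i]
    note w1 = aff_e_Some[OF w(1) M j]
    note w2 = aff_e_Some[OF w(2)[unfolded w1(4)] w1(3) i]
    note w3 = aff_e_Some[OF w(3)[unfolded w2(4)] w2(3) j]
    note nz = u1(2) u2(2) u3(2) w1(2) w2(2) w3(2)
    have "col_action n i c1 (col_action n j (c1 * c2) (col_action n i c2 M)) =
      col_action n j c2 (col_action n i (c1 * c2) (col_action n j c1 M))"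
    proof -
      \<comment> \<open>\<open>col_action_braid\<close> treats one orientation of adjacency. The
        other follows by exchanging the two indices and the two parameters, which swaps the
        sides.\<close>
      have "i = next_idx n j \<or> i = prev_idx n j" using a(1) cartan_eq[OF j i] by (auto split: if_splits)
      then consider "j = next_idx n i" | "i = next_idx n j" using j by auto
      then show ?thesis
      proof cases
        case 1
        show ?thesis by (rule col_action_braid[OF n i 1]) (use nz[THEN act_dom_nz] in auto)
      next
        case 2
        show ?thesis
          using col_action_braid[OF n j 2, of M c1 c2] nz[THEN act_dom_nz] by (simp add: mult.commute)
      qed
    qed
    then show "a' = b" unfolding u3(4) w3(4) by simp
  qed (intro aff_e_dominant aff_e_slice(3,4) c c12 i j)+
next
  fix i and c :: complex assume "i \<in> {0..n}" and c: "c \<noteq> 0"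
  then have i: "i \<le> n" by auto
  have d: "dom (\<lambda>x. map_option ((*) (inverse c)) (aff_\<epsilon> n i x)) = dom (aff_\<epsilon> n i)"
    by (auto simp: dom_def)
  show "rat_eq (W_basis n) (\<V>1 n) (aff_\<epsilon> n i \<circ>\<^sub>m aff_e n i c)
    (\<lambda>x. map_option (\<lambda>z. inverse c * z) (aff_\<epsilon> n i x))"
  proof (rule aff_rat_eqI)
    fix M a b assume M: "generic1 n M" "(aff_\<epsilon> n i \<circ>\<^sub>m aff_e n i c) (point1 n M) = Some a"
      "map_option (\<lambda>z. inverse c * z) (aff_\<epsilon> n i (point1 n M)) = Some b"
    then obtain w where w: "aff_e n i c (point1 n M) = Some w" "aff_\<epsilon> n i w = Some a"
      by (auto simp: map_comp_Some_iff)
    note s = aff_e_Some[OF w(1) M(1) i]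
    have "a = eps_conf n i (col_action n i c M)"
      using w(2) aff_epsilon_point1[OF n s(3) i] by (auto simp: s(4) split: if_splits)
    moreover have "b = inverse c * eps_conf n i M"
      using M(3) aff_epsilon_point1[OF n M(1) i] by (auto split: if_splits)
    ultimately show "a = b"
      using idx_distinct[OF n i] c
      by (simp add: eps_conf_def[OF n] minor_col_action_prev[OF n i act_dom_nz[OF s(2)]] field_simps)
  qed (intro aff_e_dominant aff_epsilon_rational(2,3) c i | subst d)+
next
  fix i j and c :: complex assume "i \<in> {0..n}" "j \<in> {0..n}" and c: "c \<noteq> 0"
    and a: "cartan n i j = 0" "cartan n j i = 0"
  then have i: "i \<le> n" and j: "j \<le> n" by auto
  show "rat_eq (W_basis n) (\<V>1 n) (aff_\<epsilon> n i \<circ>\<^sub>m aff_e n j c) (aff_\<epsilon> n i)"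
  proof (rule aff_rat_eqI)
    fix M a' b assume M: "generic1 n M" "(aff_\<epsilon> n i \<circ>\<^sub>m aff_e n j c) (point1 n M) = Some a'"
      "aff_\<epsilon> n i (point1 n M) = Some b"
    then obtain w where w: "aff_e n j c (point1 n M) = Some w" "aff_\<epsilon> n i w = Some a'"
      by (auto simp: map_comp_Some_iff)
    note s = aff_e_Some[OF w(1) M(1) j]
    have "a' = eps_conf n i (col_action n j c M)"
      using w(2) aff_epsilon_point1[OF n s(3) i] by (auto simp: s(4) split: if_splits)
    moreover have "b = eps_conf n i M"
      using M(3) aff_epsilon_point1[OF n M(1) i] by (auto split: if_splits)
    \<comment> \<open>\<epsilon>_i reads only column \<open>i\<close> and its neighbours, and column
      \<open>j\<close> is none of these.\<close>
    moreover note cartan_zero[OF i j a(1)]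
    ultimately show "a' = b" by (simp add: eps_conf_def[OF n] eq_commute[of _ j])
  qed (intro aff_e_dominant aff_epsilon_rational(2,3) c i j)+
qed

end

section \<open>Positive functions\<close>

text \<open>Characters are multiplicative only on the torus (\<open>0 powi k\<close> is a junk value), so
  positivity is closed under products only up to equality on the torus.\<close>

definition pos_comb_on :: "'j set \<Rightarrow> (('j \<Rightarrow> complex) \<Rightarrow> complex) \<Rightarrow> bool" where
  "pos_comb_on J g \<longleftrightarrow> (\<exists>h. positive_combination J h \<and> (\<forall>t\<in>torus J. g t = h t))"

text \<open>Different indices may carry the same character; adding coefficients over the fibres of
  \<open>m\<close> keeps them positive. Sums and products can then be indexed by disjoint unions and
  cartesian products, without regard to coincidences.\<close>

lemma pos_comb_family:
  assumes "finite A" "A \<noteq> {}" "\<And>i. i \<in> A \<Longrightarrow> b i > 0"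
    "\<And>t. t \<in> torus J \<Longrightarrow> g t = (\<Sum>i\<in>A. of_real (b i) * character J (m i) t)"
  shows "pos_comb_on J g"
proof -
  define a where "a k = (\<Sum>i\<in>{i\<in>A. m i = k}. b i)" for k
  have "positive_combination J (\<lambda>t. \<Sum>k\<in>m ` A. of_real (a k) * character J k t)"
    unfolding positive_combination_def
  proof (intro exI[of _ "m ` A"] exI[of _ a] conjI ballI refl)
    fix k assume "k \<in> m ` A"
    then show "a k > 0" unfolding a_def using assms(1,3) by (intro sum_pos) auto
  qed (use assms in auto)
  moreover have "(\<Sum>i\<in>A. of_real (b i) * character J (m i) t) =
    (\<Sum>k\<in>m ` A. of_real (a k) * character J k t)" for t
    unfolding sum.image_gen[OF assms(1), of _ m] a_def of_real_sum sum_distrib_right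
    by (intro sum.cong refl) auto
  ultimately show ?thesis unfolding pos_comb_on_def using assms(4) by (intro exI conjI ballI) auto
qed

lemma pos_comb_onE:
  assumes "pos_comb_on J g"
  obtains M a where "finite M" "M \<noteq> {}" "\<And>m. m \<in> M \<Longrightarrow> a m > (0::real)"
    "\<And>t. t \<in> torus J \<Longrightarrow> g t = (\<Sum>m\<in>M. of_real (a m) * character J m t)"
  using assms unfolding pos_comb_on_def positive_combination_def by auto

lemma pos_comb_add:
  assumes "pos_comb_on J g" "pos_comb_on J h"
  shows "pos_comb_on J (\<lambda>t. g t + h t)"
proof -
  obtain M a where g: "finite M" "M \<noteq> {}" "\<And>m. m \<in> M \<Longrightarrow> a m > (0::real)"
    "\<And>t. t \<in> torus J \<Longrightarrow> g t = (\<Sum>m\<in>M. of_real (a m) * character J m t)"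
    using assms(1) by (rule pos_comb_onE) blast
  obtain N b where h: "finite N" "N \<noteq> {}" "\<And>m. m \<in> N \<Longrightarrow> b m > (0::real)"
    "\<And>t. t \<in> torus J \<Longrightarrow> h t = (\<Sum>m\<in>N. of_real (b m) * character J m t)"
    using assms(2) by (rule pos_comb_onE) blast
  show ?thesis
    using g h
    by (intro pos_comb_family[where A = "M <+> N" and b = "case_sum a b" and m = "case_sum id id"])
      (auto simp: sum.Plus)
qed

lemma character_add:
  "t \<in> torus J \<Longrightarrow> character J (\<lambda>j. m j + k j) t = character J m t * character J k t"
  by (auto simp: character_def prod.distrib[symmetric] torus_def power_int_add intro!: prod.cong)

lemma pos_comb_mult:
  assumes "pos_comb_on J g" "pos_comb_on J h"
  shows "pos_comb_on J (\<lambda>t. g t * h t)"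
proof -
  obtain M a where g: "finite M" "M \<noteq> {}" "\<And>m. m \<in> M \<Longrightarrow> a m > (0::real)"
    "\<And>t. t \<in> torus J \<Longrightarrow> g t = (\<Sum>m\<in>M. of_real (a m) * character J m t)"
    using assms(1) by (rule pos_comb_onE) blast
  obtain N b where h: "finite N" "N \<noteq> {}" "\<And>m. m \<in> N \<Longrightarrow> b m > (0::real)"
    "\<And>t. t \<in> torus J \<Longrightarrow> h t = (\<Sum>m\<in>N. of_real (b m) * character J m t)"
    using assms(2) by (rule pos_comb_onE) blast
  show ?thesis
  proof (rule pos_comb_family[where A = "M \<times> N" and b = "\<lambda>(m, k). a m * b k" and m = "\<lambda>(m, k) j. m j + k j"])
    fix t assume t: "t \<in> torus J"
    show "g t * h t = (\<Sum>p\<in>M \<times> N. of_real ((\<lambda>(m, k). a m * b k) p) * character J ((\<lambda>(m, k) j. m j + k j) p) t)"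
      unfolding g(4)[OF t] h(4)[OF t] sum_product sum.cartesian_product
      by (intro sum.cong refl) (auto simp: character_add[OF t])
  qed (use g h in auto)
qed

lemma pos_comb_one: "pos_comb_on J (\<lambda>_. 1)"
  by (rule pos_comb_family[where A = "{()}" and b = "\<lambda>_. 1" and m = "\<lambda>_ _. 0"]) (auto simp: character_def)

lemma pos_comb_coord: "finite J \<Longrightarrow> j \<in> J \<Longrightarrow> pos_comb_on J (\<lambda>t. t j)"
  by (rule pos_comb_family[where A = "{()}" and b = "\<lambda>_. 1" and m = "\<lambda>_ k. if k = j then 1 else 0"])
    (auto simp: character_def if_distrib[of "\<lambda>k. _ powi k"] cong: if_cong)

text \<open>Equality is required only off the zeros of \<open>h\<close>; this determines the
  rational function and makes the values of totalised division at its poles harmless.\<close>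

definition pos_on :: "'j set \<Rightarrow> (('j \<Rightarrow> complex) \<Rightarrow> complex) \<Rightarrow> bool" where
  "pos_on J f \<longleftrightarrow> (\<exists>g h. pos_comb_on J g \<and> pos_comb_on J h \<and> (\<forall>t\<in>torus J. h t \<noteq> 0 \<longrightarrow> f t = g t / h t))"

lemma pos_onI:
  "pos_comb_on J g \<Longrightarrow> pos_comb_on J h \<Longrightarrow> (\<And>t. t \<in> torus J \<Longrightarrow> h t \<noteq> 0 \<Longrightarrow> f t = g t / h t) \<Longrightarrow> pos_on J f"
  unfolding pos_on_def by blast

lemma pos_on_comb: "pos_comb_on J g \<Longrightarrow> pos_on J g"
  by (rule pos_onI[OF _ pos_comb_one]) auto

lemma pos_on_one: "pos_on J (\<lambda>_. 1)"
  by (rule pos_on_comb[OF pos_comb_one])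

lemma pos_on_coord: "finite J \<Longrightarrow> j \<in> J \<Longrightarrow> pos_on J (\<lambda>t. t j)"
  by (rule pos_on_comb[OF pos_comb_coord])

lemma pos_on_add:
  assumes "pos_on J f" "pos_on J f'"
  shows "pos_on J (\<lambda>t. f t + f' t)"
proof -
  obtain g h where 1: "pos_comb_on J g" "pos_comb_on J h" "\<forall>t\<in>torus J. h t \<noteq> 0 \<longrightarrow> f t = g t / h t"
    using assms(1) unfolding pos_on_def by blast
  obtain g' h' where 2: "pos_comb_on J g'" "pos_comb_on J h'" "\<forall>t\<in>torus J. h' t \<noteq> 0 \<longrightarrow> f' t = g' t / h' t"
    using assms(2) unfolding pos_on_def by blast
  show ?thesis
    by (rule pos_onI[OF pos_comb_add[OF pos_comb_mult[OF 1(1) 2(2)] pos_comb_mult[OF 2(1) 1(2)]]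
          pos_comb_mult[OF 1(2) 2(2)]])
      (use 1(3) 2(3) in \<open>auto simp: field_simps\<close>)
qed

lemma pos_on_mult:
  assumes "pos_on J f" "pos_on J f'"
  shows "pos_on J (\<lambda>t. f t * f' t)"
proof -
  obtain g h where 1: "pos_comb_on J g" "pos_comb_on J h" "\<forall>t\<in>torus J. h t \<noteq> 0 \<longrightarrow> f t = g t / h t"
    using assms(1) unfolding pos_on_def by blast
  obtain g' h' where 2: "pos_comb_on J g'" "pos_comb_on J h'" "\<forall>t\<in>torus J. h' t \<noteq> 0 \<longrightarrow> f' t = g' t / h' t"
    using assms(2) unfolding pos_on_def by blast
  show ?thesis
    by (rule pos_onI[OF pos_comb_mult[OF 1(1) 2(1)] pos_comb_mult[OF 1(2) 2(2)]]) (use 1(3) 2(3) in auto)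
qed

lemma pos_on_inverse:
  assumes "pos_on J f"
  shows "pos_on J (\<lambda>t. inverse (f t))"
proof -
  obtain g h where 1: "pos_comb_on J g" "pos_comb_on J h" "\<forall>t\<in>torus J. h t \<noteq> 0 \<longrightarrow> f t = g t / h t"
    using assms(1) unfolding pos_on_def by blast
  \<comment> \<open>The extra factor \<open>h\<close> in both parts restricts the claim to points
    where the given quotient describes \<open>f\<close>.\<close>
  show ?thesis
    by (rule pos_onI[OF pos_comb_mult[OF 1(2) 1(2)] pos_comb_mult[OF 1(1) 1(2)]]) (use 1(3) in auto)
qed

lemma pos_on_divide: "pos_on J f \<Longrightarrow> pos_on J g \<Longrightarrow> pos_on J (\<lambda>t. f t / g t)"
  unfolding divide_inverse by (intro pos_on_mult pos_on_inverse)

lemma pos_on_power: "pos_on J f \<Longrightarrow> pos_on J (\<lambda>t. f t ^ k)"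
  by (induction k) (auto intro: pos_on_mult pos_on_one)

lemma pos_on_power_int: "pos_on J f \<Longrightarrow> pos_on J (\<lambda>t. f t powi k)"
  unfolding power_int_def by (cases "k \<ge> 0") (auto intro: pos_on_power pos_on_inverse)

lemma pos_on_prod: "(\<And>a. a \<in> A \<Longrightarrow> pos_on J (f a)) \<Longrightarrow> pos_on J (\<lambda>t. \<Prod>a\<in>A. f a t)"
  by (induction A rule: infinite_finite_induct) (auto intro: pos_on_mult pos_on_one)

lemma pos_on_sum:
  "finite A \<Longrightarrow> A \<noteq> {} \<Longrightarrow> (\<And>a. a \<in> A \<Longrightarrow> pos_on J (f a)) \<Longrightarrow> pos_on J (\<lambda>t. \<Sum>a\<in>A. f a t)"
  by (induction A rule: finite_ne_induct) (auto intro: pos_on_add)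

lemma quot_funs_character: "character J m \<in> quot_funs J (torus J)"
  unfolding character_def
  by (intro quot_funs_prod quot_funs_power_int quot_funs_coord) (auto simp: torus_def)

text \<open>At the identity of the torus a positive combination is a sum of positive coefficients,
  so its nonvanishing set is nonempty and, by irreducibility, meets the domain of \<open>F\<close>;
  there the two functions are compared.\<close>

lemma positive_functionI:
  assumes J: "finite J" and F: "rational_function J (torus J) F" "pos_on J f"
    and eq: "\<And>t a. t \<in> torus J \<Longrightarrow> F t = Some a \<Longrightarrow> a = f t"
  shows "positive_function J F"
proof -
  obtain g h where gh: "pos_comb_on J g" "pos_comb_on J h" "\<forall>t\<in>torus J. h t \<noteq> 0 \<longrightarrow> f t = g t / h t"
    using F(2) unfolding pos_on_def by blast
  obtain g' h' where g': "positive_combination J g'" "\<forall>t\<in>torus J. g t = g' t"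
    and h': "positive_combination J h'" "\<forall>t\<in>torus J. h t = h' t"
    using gh unfolding pos_comb_on_def by blast
  obtain M a where M: "finite M" "M \<noteq> {}" "\<forall>m\<in>M. a m > (0::real)"
    "h' = (\<lambda>t. \<Sum>m\<in>M. of_real (a m) * character J m t)"
    using h'(1) unfolding positive_combination_def by blast
  have sub: "torus J \<subseteq> aff_space J" by (auto simp: torus_def)
  have "h' \<in> quot_funs J (torus J)" unfolding M(4)
    by (intro quot_funs_sum quot_funs_mult quot_funs_const quot_funs_character)
  then have o: "ropen J (torus J) {t \<in> torus J. h' t \<noteq> 0}" by (rule ropen_nonzero[OF sub])
  let ?F = "\<lambda>t. if h' t \<noteq> 0 then Some (g' t / h' t) else None"
  have d: "torus J \<inter> dom ?F = {t \<in> torus J. h' t \<noteq> 0}" by (auto split: if_splits)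
  let ?u = "\<lambda>j. if j \<in> J then 1 else 0 :: complex"
  have u: "?u \<in> torus J" by (auto simp: torus_def aff_space_def)
  have "character J m ?u = 1" for m by (auto simp: character_def intro!: prod.neutral)
  then have "h' ?u = of_real (\<Sum>m\<in>M. a m)" by (simp add: M(4))
  moreover have "(\<Sum>m\<in>M. a m) > 0" using M by (intro sum_pos) auto
  ultimately have "h' ?u \<noteq> 0" by (metis less_irrefl of_real_eq_0_iff)
  then have ne: "{t \<in> torus J. h' t \<noteq> 0} \<noteq> {}" using u by blast
  have F': "ropen J (torus J) (dom F)" "dom F \<noteq> {}"
    using F(1) by (auto simp: rational_function_def ropen_def)
  have dF: "torus J \<inter> dom F = dom F" using ropen_subset[OF F'(1)] by blast
  have "rat_eq J (torus J) F ?F"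
  proof (rule rat_eqI[OF irred_torus[OF J]])
    fix t x y assume t: "t \<in> torus J" "F t = Some x" "?F t = Some y"
    then have "h' t \<noteq> 0" "y = g' t / h' t" by (auto split: if_splits)
    then show "x = y" using eq[OF t(1,2)] gh(3) g'(2) h'(2) t(1) by simp
  qed (unfold d dF, (rule o ne F')+)
  then show ?thesis unfolding positive_function_def using F(1) g'(1) h'(1) by blast
qed

section \<open>Explicit form of the action and positivity\<close>

context
  fixes n :: nat
  assumes n: "n \<ge> 2"
begin

definition ratio_sum :: "(nat \<Rightarrow> complex) \<Rightarrow> nat \<Rightarrow> nat \<Rightarrow> complex" where
  "ratio_sum x a b = (\<Sum>j=a..b. x j / x (n + j - 1))"

text \<open>Runs from \<open>ratio_sum x 2 n\<close> at \<open>k = 1\<close> to \<open>c\<close>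
  times this at \<open>k = n\<close>, so that x_n' and x_{n+1}' obey the same formulas as their
  neighbours.\<close>

definition mixed_sum :: "complex \<Rightarrow> (nat \<Rightarrow> complex) \<Rightarrow> nat \<Rightarrow> complex" where
  "mixed_sum c x k = c * ratio_sum x 2 k + ratio_sum x (k + 1) n"

definition zero_step :: "complex \<Rightarrow> (nat \<Rightarrow> complex) \<Rightarrow> nat \<Rightarrow> complex" where
  "zero_step c x = (\<lambda>k. if k \<in> {2..<n} then x k * (ratio_sum x 2 n / mixed_sum c x k)
     else if k = n then x n / c
     else if k = n + 1 then x (n + 1) / c
     else if k \<in> {n+2..<2*n} then x k * (mixed_sum c x (k - n) / (c * ratio_sum x 2 n))
     else 0)"

lemma ratio_sum_split: "1 \<le> k \<Longrightarrow> k \<le> n \<Longrightarrow> ratio_sum x 2 n = ratio_sum x 2 k + ratio_sum x (k + 1) n"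
proof -
  assume "1 \<le> k" "k \<le> n"
  then have "{2..n} = {2..k} \<union> {k+1..n}" "{2..k} \<inter> {k+1..n} = {}" by auto
  then show ?thesis unfolding ratio_sum_def by (simp add: sum.union_disjoint)
qed

lemma mixed_sum_ends: "mixed_sum c x 1 = ratio_sum x 2 n" "mixed_sum c x n = c * ratio_sum x 2 n"
  by (simp_all add: mixed_sum_def ratio_sum_def numeral_2_eq_2)

text \<open>Column \<open>l\<close> has slope \<open>ratio_sum x 2 l\<close>, so minors are
  differences of partial sums.\<close>

lemma frame1_minor:
  assumes "1 \<le> k" "1 \<le> l"
  shows "minor (frame1 n x) k l = (if k < n then x (n + k) else 1) * (if l < n then x (n + l) else 1)
    * (ratio_sum x 2 l - ratio_sum x 2 k)"
  using assms unfolding minor_def frame1_def ratio_sum_def fst_conv snd_conv by (simp add: algebra_simps)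

lemma frame1_tail:
  assumes "x \<in> T1 n" "1 \<le> k" "k < n"
  shows "minor (frame1 n x) k n \<noteq> 0 \<longleftrightarrow> ratio_sum x (k + 1) n \<noteq> 0"
  using assms ratio_sum_split[of k x] T1_nz[OF n assms(1), of "n + k"] by (simp add: frame1_minor)

text \<open>Adding column 1 to column 0 changes the minor against \<open>l\<close> by a multiple of
  the partial sum up to \<open>l\<close>; weighting that part by \<open>c\<close> and keeping the
  rest gives \<open>mixed_sum\<close>.\<close>

lemma frame1_zero_action:
  assumes x: "x \<in> T1 n" and S: "ratio_sum x 2 n \<noteq> 0" and l: "1 \<le> l" "l \<le> n"
  shows "minor (col_action n 0 c (frame1 n x)) l 0 =
    (if l < n then x (n + l) else 1) * mixed_sum c x l / ratio_sum x 2 n"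
proof -
  let ?M = "frame1 n x" and ?S = "ratio_sum x 2 n"
  define z where "z = (if l < n then x (n + l) else 1)"
  have idx: "prev_idx n 0 = n" "next_idx n 0 = 1" using n by (auto simp: prev_idx_def next_idx_def)
  have x1: "x (n + 1) \<noteq> 0" using T1_nz[OF n x, of "n + 1"] n by simp
  have r1: "ratio_sum x 2 1 = 0" by (simp add: ratio_sum_def)
  have m: "minor ?M n 0 = 1" "minor ?M l 0 = z" using frame1_minors(1)[OF n x] l n by (auto simp: z_def)
  have m1: "minor ?M n 1 = - (x (n + 1) * ?S)" "minor ?M l 1 = - (z * x (n + 1) * ratio_sum x 2 l)"
    using frame1_minor[of n 1 x] frame1_minor[of l 1 x] l n unfolding r1 by (simp_all add: z_def)
  have "minor (col_action n 0 c ?M) l 0 =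
    minor ?M l 0 + (c - 1) * minor ?M n 0 / minor ?M n 1 * minor ?M l 1"
    using l unfolding minor_col_action[OF n le0] idx Let_def by simp
  also have "\<dots> = z * (?S + (c - 1) * ratio_sum x 2 l) / ?S"
    unfolding m m1 using x1 S by (simp add: field_simps)
  also have "?S + (c - 1) * ratio_sum x 2 l = mixed_sum c x l"
    unfolding mixed_sum_def ratio_sum_split[OF l] by (simp add: algebra_simps)
  finally show ?thesis by (simp add: z_def)
qed

text \<open>Minors of consecutive columns among 1, ..., n are unchanged, so the new coordinates
  differ from the old only through the minors against column 0.\<close>

lemma zero_step_coords:
  assumes x: "x \<in> T1 n" and c: "c \<noteq> 0" and S: "ratio_sum x 2 n \<noteq> 0"
    and P: "\<And>k. k \<in> {2..<n} \<Longrightarrow> mixed_sum c x k \<noteq> 0"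
    and act: "act_dom n 0 (frame1 n x)"
  shows "generic1 n (col_action n 0 c (frame1 n x))" "coords1 n (col_action n 0 c (frame1 n x)) = zero_step c x"
proof -
  let ?M = "frame1 n x" and ?S = "ratio_sum x 2 n"
  let ?N = "col_action n 0 c ?M"
  note N0 = frame1_zero_action[OF x S, of _ c]
  have P': "mixed_sum c x k \<noteq> 0" if "1 \<le> k" "k \<le> n" for k
  proof -
    have "k = 1 \<or> k = n \<or> k \<in> {2..<n}" using that by auto
    then consider "k = 1" | "k = n" | "k \<in> {2..<n}" by blast
    then show ?thesis by cases (use P S c mixed_sum_ends[of c x] in auto)
  qed
  have z: "(if k < n then x (n + k) else 1) \<noteq> 0" if "1 \<le> k" "k \<le> n" for k
    using that T1_nz[OF n x, of "n + k"] n by auto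
  have "minor ?N l 0 \<noteq> 0" if "1 \<le> l" "l \<le> n" for l
    using N0[OF that] P'[OF that] z[OF that] S by simp
  then show "generic1 n ?N"
    by (rule generic1_col_action[OF n frame1_chart(1)[OF n x] le0 c act_dom_nz[OF n act]])
  have Nn: "minor ?N n 0 = c" using N0[of n] n S mixed_sum_ends(2)[of c x] by simp
  show "coords1 n ?N = zero_step c x"
  proof (rule coords1_eqI[OF n])
    fix k assume k: "2 \<le> k" "k \<le> n"
    have "minor ?N (k - 1) k = minor ?M (k - 1) k"
      using step_minor_col_action[OF n le0 k act_dom_nz[OF n act], of c] k by simp
    also have "\<dots> = x k * (if k < n then x (n + k) else 1)" by (rule frame1_minors(2)[OF n x k])
    finally have "minor ?N (k - 1) k / minor ?N k 0 = x k * (?S / mixed_sum c x k)"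
      using z[of k] k N0[of k] by simp
    also have "\<dots> = zero_step c x k"
      using k S mixed_sum_ends(2)[of c x] by (cases "k = n") (auto simp: zero_step_def)
    finally show "zero_step c x k = minor ?N (k - 1) k / minor ?N k 0" by simp
  next
    fix l assume l: "1 \<le> l" "l < n"
    show "zero_step c x (n + l) = minor ?N l 0 / minor ?N n 0"
      using l N0[of l] Nn S mixed_sum_ends(1)[of c x] by (cases "l = 1") (auto simp: zero_step_def)
  next
    fix k assume "\<not> (2 \<le> k \<and> k \<le> 2 * n - 1)"
    then show "zero_step c x k = 0" using n by (auto simp: zero_step_def)
  qed
qed

lemma act_dom_zero:
  assumes x: "x \<in> T1 n"
  shows "act_dom n 0 (frame1 n x) \<longleftrightarrow> (\<forall>k\<in>{1..n-1}. ratio_sum x (k + 1) n \<noteq> 0)"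
proof -
  have idx: "prev_idx n 0 = n" "next_idx n 0 = 1" using n by (auto simp: prev_idx_def next_idx_def)
  have s: "{1..n-1} = {1..<n}" using n by auto
  have "(\<forall>k\<in>{1..<n}. minor (frame1 n x) k n \<noteq> 0) \<longleftrightarrow> (\<forall>k\<in>{1..<n}. ratio_sum x (k + 1) n \<noteq> 0)"
    using frame1_tail[OF x] by (intro ball_cong refl) simp
  moreover have "minor (frame1 n x) 1 n \<noteq> 0 \<Longrightarrow> minor (frame1 n x) n 1 \<noteq> 0"
    using minor_swap[of "frame1 n x" n 1] by simp
  ultimately show ?thesis unfolding act_dom_def[OF n] idx s using n by auto
qed

lemma aff_e_V1:
  assumes "x \<in> T1 n" "c \<noteq> 0" "i \<le> n"
  shows "aff_e n i c (V1 n x) = (if act_dom n i (frame1 n x) \<and> generic1 n (col_action n i c (frame1 n x))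
    then Some (point1 n (col_action n i c (frame1 n x))) else None)"
  using aff_e_point1[OF n frame1_chart(1)[OF n assms(1)] assms(2,3)] frame1_chart(3)[OF n assms(1)] by simp

lemma aff_e_zero_explicit:
  assumes x: "x \<in> T1 n" and c: "c \<noteq> 0" and "\<forall>k\<in>{1..n-1}. ratio_sum x (k + 1) n \<noteq> 0"
    and P: "\<forall>k\<in>{2..<n}. mixed_sum c x k \<noteq> 0"
  shows "aff_e n 0 c (V1 n x) = Some (V1 n (zero_step c x))"
proof -
  have act: "act_dom n 0 (frame1 n x)" using act_dom_zero[OF x] assms(3) by blast
  have S: "ratio_sum x 2 n \<noteq> 0" using assms(3) n by (auto dest: bspec[where x = 1] simp: numeral_2_eq_2)
  note z = zero_step_coords[OF x c S P[rule_format] act]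
  show ?thesis
    using aff_e_V1[OF x c le0] act z coords1_chart(2)[OF n z(1)] by simp
qed

section \<open>All actions in torus coordinates\<close>

definition coord_step :: "nat \<Rightarrow> complex \<Rightarrow> (nat \<Rightarrow> complex) \<Rightarrow> nat \<Rightarrow> complex" where
  "coord_step i c x = (if i = 0 then zero_step c x
     else if i = 1 then x(n + 1 := c * x (n + 1))
     else if i = n then x(n := c * x n)
     else let p = x i * x (n + i); q = x (i + 1) * x (n + i - 1); ci = c * (p + q) / (c * p + q)
       in x(i := ci * x i, n + i := c / ci * x (n + i)))"

lemma coord_step_middle:
  assumes "2 \<le> i" "i < n"
  shows "coord_step i c x = (let p = x i * x (n + i); q = x (i + 1) * x (n + i - 1); ci = c * (p + q) / (c * p + q)
    in x(i := ci * x i, n + i := c / ci * x (n + i)))"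
proof -
  have "i \<noteq> 0" "i \<noteq> 1" "i \<noteq> n" using assms by auto
  then show ?thesis by (simp only: coord_step_def if_False)
qed

text \<open>Links the column actions, whose domains are known, to formulas from which positivity can
  be read off. For \<open>i \<noteq> 0\<close> both describe the same point and the parametrisation
  is injective.\<close>

lemma aff_e_coord_step:
  assumes x: "x \<in> T1 n" and c: "c \<noteq> 0" and i: "i \<le> n" and w: "aff_e n i c (V1 n x) = Some w"
  shows "coords1 n (col_action n i c (frame1 n x)) = coord_step i c x"
proof (cases "i = 0")
  case True
  have act: "act_dom n 0 (frame1 n x)" and g: "generic1 n (col_action n 0 c (frame1 n x))"
    using aff_e_V1[OF x c i] w True by (auto split: if_splits)
  have S: "ratio_sum x 2 n \<noteq> 0"
    using act act_dom_zero[OF x] n by (auto dest: bspec[where x = 1] simp: numeral_2_eq_2)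
  have P: "mixed_sum c x k \<noteq> 0" if "k \<in> {2..<n}" for k
    using that generic1_nz(1)[OF n g, of k] frame1_zero_action[OF x S, of k c] by auto
  show ?thesis using zero_step_coords(2)[OF x c S P act] True by (simp add: coord_step_def)
next
  case False
  let ?N = "col_action n i c (frame1 n x)"
  have g: "generic1 n ?N" and wN: "w = point1 n ?N"
    using aff_e_V1[OF x c i] w by (auto split: if_splits)
  have ae: "aff_e n i c (V1 n x) = e1 n i c (V1 n x)" using False by (simp add: aff_e_def)
  have "w = V1 n (coord_step i c x)"
  proof -
    consider "i = 1" | "i = n" "i \<noteq> 1" | "2 \<le> i" "i < n" using False i by linarith
    then show ?thesis
    proof cases
      case 1
      then show ?thesis using w ae e1_first[OF n x c] by (simp add: coord_step_def)
    next
      case 2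
      then show ?thesis using w ae e1_last[OF n x c] n by (simp add: coord_step_def)
    next
      case 3
      have D: "(if P then Some a else None) = Some b \<Longrightarrow> b = a" for P and a b :: wvec
        by (auto split: if_splits)
      show ?thesis
        unfolding coord_step_middle[OF 3] Let_def
        by (rule D[OF trans[OF e1_middle[OF n x c 3, symmetric] trans[OF ae[symmetric] w]]])
    qed
  qed
  moreover have "coord_step i c x \<in> T1 n"
  proof -
    have *: "y(k := a) \<in> T1 n" if "y \<in> T1 n" "a \<noteq> 0" "2 \<le> k" "k \<le> 2 * n - 1" for y k and a :: complex
      using that by (auto simp: T1_def torus_def aff_space_def)
    consider "i = 1" | "i = n" "i \<noteq> 1" | "2 \<le> i" "i < n" using False i by linarith
    then show ?thesis
    proof cases
      case 1
      then show ?thesis using *[OF x, of "c * x (n + 1)" "n + 1"] c T1_nz[OF n x, of "n + 1"] n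
        by (simp add: coord_step_def)
    next
      case 2
      then show ?thesis using *[OF x, of "c * x n" n] c T1_nz[OF n x, of n] n
        by (simp add: coord_step_def)
    next
      case 3
      define p q where "p = x i * x (n + i)" and "q = x (i + 1) * x (n + i - 1)"
      define ci where "ci = c * (p + q) / (c * p + q)"
      have "p + q \<noteq> 0" "c * p + q \<noteq> 0"
        using w ae e1_middle[OF n x c 3] by (auto simp: p_def q_def split: if_splits)
      then have ci: "ci \<noteq> 0" using c by (simp add: ci_def)
      have "x(i := ci * x i, n + i := c / ci * x (n + i)) \<in> T1 n"
        using ci c 3 T1_nz[OF n x, of i] T1_nz[OF n x, of "n + i"] by (intro * x) auto
      then show ?thesis unfolding coord_step_middle[OF 3] Let_def p_def q_def ci_def .
    qed
  qed
  moreover have "params1 n w = coords1 n ?N" unfolding wN by (rule params1_point1[OF n g])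
  ultimately show ?thesis using params1_V1[OF n] by simp
qed

lemma torus_K: "torus {2..2*n-1} = T1 n" by (simp add: T1_def)

lemma torus_opt_iff: "t \<in> torus (opt_index {2..2*n-1}) \<longleftrightarrow> t None \<noteq> 0 \<and> t \<circ> Some \<in> T1 n"
  unfolding T1_def torus_def aff_space_def opt_index_def
  by (auto simp: image_iff)

lemma finite_opt: "finite (opt_index {2..2*n-1})" by (simp add: opt_index_def)

section \<open>Positivity of the coordinate formulas\<close>

lemma pos_pad:
  assumes "1 \<le> l" "l \<le> 2 * n"
  shows "pos_on {2..2*n-1} (\<lambda>x. pad n x l)"
proof -
  have "l = 1 \<or> l = 2 * n \<or> (l \<in> {2..2*n-1} \<and> l \<noteq> 1 \<and> l \<noteq> 2 * n)" using assms by auto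
  then consider "l = 1 \<or> l = 2 * n" | "l \<in> {2..2*n-1}" "l \<noteq> 1" "l \<noteq> 2 * n" by blast
  then show ?thesis
  proof cases
    case 1
    then show ?thesis using pos_on_one by (auto simp: pad_def[OF n])
  next
    case 2
    then show ?thesis using pos_on_coord[of "{2..2*n-1}" l] by (simp add: pad_def[OF n])
  qed
qed

lemma gamma_zero_explicit:
  assumes x: "x \<in> T1 n" and "\<forall>k\<in>{1..n-1}. ratio_sum x (k + 1) n \<noteq> 0"
  shows "aff_\<gamma> n 0 (V1 n x) = Some (1 / (x n * x (n + 1)))"
    "aff_\<epsilon> n 0 (V1 n x) = Some (x (n + 1) * ratio_sum x 2 n)"
proof -
  let ?M = "frame1 n x"
  have "act_dom n 0 ?M" using act_dom_zero[OF x] assms(2) by blast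
  then have nz: "\<not> (\<exists>k\<in>{1..<n}. minor ?M k n = 0)" by (auto simp: act_dom_def[OF n])
  have m: "minor ?M n 0 = 1" "minor ?M 1 0 = x (n + 1)" "minor ?M (n - 1) n = x n"
    using frame1_minors[OF n x] n by auto
  have idx: "prev_idx n 0 = n" "next_idx n 0 = 1" "prev_idx n n = n - 1"
    using n by (auto simp: prev_idx_def next_idx_def)
  have "gamma_conf n 0 ?M = 1 / (x n * x (n + 1))"
    using n m by (simp add: gamma_conf_def[OF n] cyc_minor_def[OF n] idx)
  then show "aff_\<gamma> n 0 (V1 n x) = Some (1 / (x n * x (n + 1)))"
    using aff_gamma_point1[OF n frame1_chart(1)[OF n x] le0] nz frame1_chart(3)[OF n x] by simp
  have "minor ?M n 1 = - (x (n + 1) * ratio_sum x 2 n)"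
    using frame1_minor[of n 1 x] n by (simp add: ratio_sum_def)
  then have "eps_conf n 0 ?M = x (n + 1) * ratio_sum x 2 n"
    by (simp add: eps_conf_def[OF n] idx m)
  then show "aff_\<epsilon> n 0 (V1 n x) = Some (x (n + 1) * ratio_sum x 2 n)"
    using aff_epsilon_point1[OF n frame1_chart(1)[OF n x] le0] nz frame1_chart(3)[OF n x] by simp
qed

lemma data_zero_dom:
  assumes x: "x \<in> T1 n" and "aff_\<gamma> n 0 (V1 n x) = Some a \<or> aff_\<epsilon> n 0 (V1 n x) = Some a"
  shows "\<forall>k\<in>{1..n-1}. ratio_sum x (k + 1) n \<noteq> 0"
proof -
  have "\<not> (\<exists>k\<in>{1..<n}. minor (frame1 n x) k n = 0)"
    using assms(2) aff_gamma_point1[OF n frame1_chart(1)[OF n x] le0]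
      aff_epsilon_point1[OF n frame1_chart(1)[OF n x] le0] frame1_chart(3)[OF n x]
    by (auto split: if_splits)
  then show ?thesis using frame1_tail[OF x] by auto
qed

lemma pos_ratio_sum: "2 \<le> a \<Longrightarrow> a \<le> b \<Longrightarrow> b \<le> n \<Longrightarrow> pos_on {2..2*n-1} (\<lambda>x. ratio_sum x a b)"
  unfolding ratio_sum_def by (intro pos_on_sum pos_on_divide pos_on_coord) auto

lemma pos_gamma:
  assumes "i \<le> n"
  shows "\<exists>\<phi>. pos_on {2..2*n-1} \<phi> \<and> (\<forall>x\<in>T1 n. \<forall>a. aff_\<gamma> n i (V1 n x) = Some a \<longrightarrow> a = \<phi> x)"
proof -
  consider "i = 0" | "i = 1" | "i = n" "i \<noteq> 1" "i \<noteq> 0" | "2 \<le> i" "i < n" using assms by linarith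
  then show ?thesis
  proof cases
    case 1
    have "pos_on {2..2*n-1} (\<lambda>x. 1 / (x n * x (n + 1)))"
      using n by (intro pos_on_divide pos_on_mult pos_on_one pos_on_coord) auto
    moreover have "a = 1 / (x n * x (n + 1))" if x: "x \<in> T1 n" and a: "aff_\<gamma> n 0 (V1 n x) = Some a" for x a
      using gamma_zero_explicit(1)[OF x data_zero_dom[OF x disjI1[OF a]]] a by simp
    ultimately show ?thesis unfolding 1 by blast
  next
    case 2
    have "pos_on {2..2*n-1} (\<lambda>x. (pad n x (n+1))\<^sup>2 / (pad n x 2 * pad n x (n+2)))"
      using n by (intro pos_on_divide pos_on_mult pos_on_power pos_pad) auto
    then show ?thesis using 2 gamma1_explicit(1)[OF n] by (intro exI conjI) (auto simp: aff_\<gamma>_def)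
  next
    case 3
    have "pos_on {2..2*n-1} (\<lambda>x. (pad n x n)\<^sup>2 / (pad n x (n-1) * pad n x (2*n-1)))"
      using n by (intro pos_on_divide pos_on_mult pos_on_power pos_pad) auto
    then show ?thesis using 3 gamma1_explicit(3)[OF n] by (intro exI conjI) (auto simp: aff_\<gamma>_def)
  next
    case 4
    have "pos_on {2..2*n-1} (\<lambda>x. (pad n x i)\<^sup>2 * (pad n x (n+i))\<^sup>2 /
        (pad n x (i-1) * pad n x (i+1) * pad n x (n+i-1) * pad n x (n+i+1)))"
      using 4 by (intro pos_on_divide pos_on_mult pos_on_power pos_pad) auto
    then show ?thesis using 4 gamma1_explicit(2)[OF n _ 4] by (intro exI conjI) (auto simp: aff_\<gamma>_def)
  qed
qed

lemma pos_epsilon: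
  assumes "i \<le> n"
  shows "\<exists>\<phi>. pos_on {2..2*n-1} \<phi> \<and> (\<forall>x\<in>T1 n. \<forall>a. aff_\<epsilon> n i (V1 n x) = Some a \<longrightarrow> a = \<phi> x)"
proof -
  consider "i = 0" | "i = 1" | "i = n" "i \<noteq> 1" "i \<noteq> 0" | "2 \<le> i" "i < n" using assms by linarith
  then show ?thesis
  proof cases
    case 1
    have "pos_on {2..2*n-1} (\<lambda>x. x (n + 1) * ratio_sum x 2 n)"
      using n by (intro pos_on_mult pos_ratio_sum pos_on_coord) auto
    moreover have "a = x (n + 1) * ratio_sum x 2 n" if x: "x \<in> T1 n" and a: "aff_\<epsilon> n 0 (V1 n x) = Some a" for x a
      using gamma_zero_explicit(2)[OF x data_zero_dom[OF x disjI2[OF a]]] a by simp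
    ultimately show ?thesis unfolding 1 by blast
  next
    case 2
    have "pos_on {2..2*n-1} (\<lambda>x. pad n x (n+2) / pad n x (n+1))"
      using n by (intro pos_on_divide pos_pad) auto
    then show ?thesis using 2 epsilon1_explicit(1)[OF n] by (intro exI conjI) (auto simp: aff_\<epsilon>_def)
  next
    case 3
    have "pos_on {2..2*n-1} (\<lambda>x. pad n x (2*n-1) / pad n x n)"
      using n by (intro pos_on_divide pos_pad) auto
    then show ?thesis using 3 epsilon1_explicit(3)[OF n] by (intro exI conjI) (auto simp: aff_\<epsilon>_def)
  next
    case 4
    have "pos_on {2..2*n-1} (\<lambda>x. pad n x (n+i+1) / pad n x (n+i)
        + pad n x (i+1) * pad n x (n+i-1) * pad n x (n+i+1) / (pad n x i * (pad n x (n+i))\<^sup>2))"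
      using 4 by (intro pos_on_add pos_on_divide pos_on_mult pos_on_power pos_pad) auto
    then show ?thesis using 4 epsilon1_explicit(2)[OF n _ 4] by (intro exI conjI) (auto simp: aff_\<epsilon>_def)
  qed
qed

text \<open>Every formula is built from \<open>c\<close> and the coordinates by sums, products and
  quotients. Here \<open>c\<close> is the torus coordinate \<open>None\<close>.\<close>

lemma pos_coord_step:
  assumes "i \<le> n" "k \<in> {2..2*n-1}"
  shows "pos_on (opt_index {2..2*n-1}) (\<lambda>t. coord_step i (t None) (t \<circ> Some) k)"
proof -
  have c: "pos_on (opt_index {2..2*n-1}) (\<lambda>t. t None)"
    by (rule pos_on_coord[OF finite_opt]) (simp add: opt_index_def)
  have x: "pos_on (opt_index {2..2*n-1}) (\<lambda>t. (t \<circ> Some) l)" if "2 \<le> l" "l \<le> 2 * n - 1" for l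
    unfolding comp_def by (rule pos_on_coord[OF finite_opt]) (use that in \<open>simp add: opt_index_def\<close>)
  have r: "pos_on (opt_index {2..2*n-1}) (\<lambda>t. ratio_sum (t \<circ> Some) a b)" if "2 \<le> a" "a \<le> b" "b \<le> n" for a b
    unfolding ratio_sum_def using that by (intro pos_on_sum pos_on_divide x) auto
  have m: "pos_on (opt_index {2..2*n-1}) (\<lambda>t. mixed_sum (t None) (t \<circ> Some) l)" if "2 \<le> l" "l < n" for l
    unfolding mixed_sum_def using that by (intro pos_on_add pos_on_mult c r) auto
  have k: "2 \<le> k" "k \<le> 2 * n - 1" using assms(2) by auto
  consider "i = 0" | "i = 1" | "i = n" "i \<noteq> 1" "i \<noteq> 0" | "2 \<le> i" "i < n" using assms(1) by linarith
  then show ?thesis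
  proof cases
    case 1
    have "k \<in> {2..<n} \<or> k = n \<or> k = n + 1 \<or> k \<in> {n+2..<2*n}" using k n by auto
    then consider "k \<in> {2..<n}" | "k = n" | "k = n + 1" | "k \<in> {n+2..<2*n}" by blast
    then show ?thesis
    proof cases
      case a: 1
      have "pos_on (opt_index {2..2*n-1}) (\<lambda>t. (t \<circ> Some) k * (ratio_sum (t \<circ> Some) 2 n / mixed_sum (t None) (t \<circ> Some) k))"
        using a n by (intro pos_on_mult pos_on_divide x r m) auto
      then show ?thesis using a 1 by (simp add: coord_step_def zero_step_def)
    next
      case a: 2
      have "pos_on (opt_index {2..2*n-1}) (\<lambda>t. (t \<circ> Some) n / t None)" using n by (intro pos_on_divide x c) auto
      then show ?thesis using a 1 by (simp add: coord_step_def zero_step_def)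
    next
      case a: 3
      have "pos_on (opt_index {2..2*n-1}) (\<lambda>t. (t \<circ> Some) (n + 1) / t None)" using n by (intro pos_on_divide x c) auto
      then show ?thesis using a 1 by (simp add: coord_step_def zero_step_def)
    next
      case a: 4
      have "pos_on (opt_index {2..2*n-1}) (\<lambda>t. (t \<circ> Some) k *
          (mixed_sum (t None) (t \<circ> Some) (k - n) / (t None * ratio_sum (t \<circ> Some) 2 n)))"
        using a n by (intro pos_on_mult pos_on_divide x r m c) auto
      then show ?thesis using a 1 by (simp add: coord_step_def zero_step_def)
    qed
  next
    case 2
    have "pos_on (opt_index {2..2*n-1}) (\<lambda>t. t None * (t \<circ> Some) (n + 1))" using n by (intro pos_on_mult x c) auto
    then show ?thesis using 2 x[OF k] by (cases "k = n + 1") (simp_all add: coord_step_def)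
  next
    case 3
    have "pos_on (opt_index {2..2*n-1}) (\<lambda>t. t None * (t \<circ> Some) n)" using n by (intro pos_on_mult x c) auto
    then show ?thesis using 3 x[OF k] by (cases "k = n") (simp_all add: coord_step_def)
  next
    case 4
    define p q where "p x = x i * x (n + i)" and "q x = x (i + 1) * x (n + i - 1)" for x :: "nat \<Rightarrow> complex"
    have pq: "pos_on (opt_index {2..2*n-1}) (\<lambda>t. p (t \<circ> Some))" "pos_on (opt_index {2..2*n-1}) (\<lambda>t. q (t \<circ> Some))"
      unfolding p_def q_def using 4 by (intro pos_on_mult x; simp)+
    have ci: "pos_on (opt_index {2..2*n-1}) (\<lambda>t. t None * (p (t \<circ> Some) + q (t \<circ> Some)) / (t None * p (t \<circ> Some) + q (t \<circ> Some)))"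
      by (intro pos_on_divide pos_on_mult pos_on_add c pq)
    have st: "coord_step i c x = x(i := c * (p x + q x) / (c * p x + q x) * x i,
        n + i := c / (c * (p x + q x) / (c * p x + q x)) * x (n + i))" for c x
      unfolding coord_step_middle[OF 4] Let_def p_def q_def ..
    consider "k = n + i" | "k = i" "k \<noteq> n + i" | "k \<noteq> i" "k \<noteq> n + i" by blast
    then show ?thesis
    proof cases
      case a: 1
      have "pos_on (opt_index {2..2*n-1}) (\<lambda>t. t None / (t None * (p (t \<circ> Some) + q (t \<circ> Some)) /
          (t None * p (t \<circ> Some) + q (t \<circ> Some))) * (t \<circ> Some) (n + i))"
        using 4 by (intro pos_on_mult[OF pos_on_divide[OF c ci]] x) auto
      then show ?thesis unfolding st using a by (simp only: fun_upd_same)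
    next
      case a: 2
      have "pos_on (opt_index {2..2*n-1}) (\<lambda>t. t None * (p (t \<circ> Some) + q (t \<circ> Some)) /
          (t None * p (t \<circ> Some) + q (t \<circ> Some)) * (t \<circ> Some) i)"
        using 4 by (intro pos_on_mult[OF ci] x) auto
      then show ?thesis unfolding st using a by (simp only: fun_upd_apply if_False if_True refl)
    next
      case a: 3
      then show ?thesis unfolding st fun_upd_apply using x[OF k] by simp
    qed
  qed
qed

section \<open>The parametrisation as a positive structure\<close>

definition theta_inv :: "wvec \<rightharpoonup> (nat \<Rightarrow> complex)" where
  "theta_inv v = (if v \<in> \<V>1 n then Some (params1 n v) else None)"

lemma theta_inv_section: "v \<in> \<V>1 n \<Longrightarrow> theta_inv v = Some (coords1 n (section_conf n v))"
  using params1_point1[OF n section_conf_V1(1)[OF n]] section_conf_V1(2)[OF n] by (simp add: theta_inv_def)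

lemma theta_dom: "dom (theta n) = T1 n" "dom theta_inv = \<V>1 n"
  by (auto simp: theta_def theta_inv_def split: if_splits)

text \<open>\<open>theta\<close> is a bijection from the torus onto \<open>\<V>1 n\<close>, so both
  composites are the identity without exception; \<open>section_conf\<close> makes the inverse
  regular.\<close>

lemma theta_birational: "birational_inverses {2..2*n-1} (torus {2..2*n-1}) (W_basis n) (\<V>1 n) (theta n) theta_inv"
  unfolding birational_inverses_def torus_K
proof (intro conjI)
  have ne: "T1 n \<noteq> {}" "\<V>1 n \<noteq> {}" using irred_T1[OF n] irred_V1[OF n] by (auto simp: irred_def)
  have o: "ropen {2..2*n-1} (T1 n) (T1 n)" "ropen (W_basis n) (\<V>1 n) (\<V>1 n)"
    by (intro ropen_self T1_sub[OF n] V1_sub[OF n])+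
  show "rational_map {2..2*n-1} (T1 n) (W_basis n) (\<V>1 n) (theta n)"
  proof (rule rational_mapI[OF T1_sub[OF n]])
    show "(\<lambda>p. the (theta n p) b) \<in> quot_funs {2..2*n-1} (dom (theta n))" for b
      unfolding theta_dom by (rule quot_funs_cong[OF reg_V1[OF n]]) (simp add: theta_def)
  qed (use ne o in \<open>auto simp: theta_dom ran_def, auto simp: theta_def \<V>1_def split: if_splits\<close>)
  show "rational_map (W_basis n) (\<V>1 n) {2..2*n-1} (T1 n) theta_inv"
  proof (rule rational_mapI[OF V1_sub[OF n]])
    have "(\<lambda>v. coords1 n (section_conf n v) k) \<in> quot_funs (W_basis n) (\<V>1 n)" for k
      using generic1_nz(1)[OF n section_conf_V1(1)[OF n]]
      by (intro reg_coords1 reg_section_conf V1_sub[OF n]) auto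
    then show "(\<lambda>p. the (theta_inv p) k) \<in> quot_funs (W_basis n) (dom theta_inv)" for k
      unfolding theta_dom by (rule quot_funs_cong) (simp add: theta_inv_section)
    show "ran theta_inv \<subseteq> T1 n"
    proof
      fix x assume "x \<in> ran theta_inv"
      then obtain v where "theta_inv v = Some x" by (auto simp: ran_def)
      moreover from this have "v \<in> \<V>1 n" by (auto simp: theta_inv_def split: if_splits)
      ultimately show "x \<in> T1 n"
        using coords1_chart(1)[OF n section_conf_V1(1)[OF n]] theta_inv_section by auto
    qed
  qed (use ne o in \<open>auto simp: theta_dom\<close>)
  have th: "theta_inv (V1 n x) = Some x" if "x \<in> T1 n" for x
    using that params1_V1[OF n] by (simp add: theta_inv_def \<V>1_def)
  have d1: "T1 n \<inter> dom (theta_inv \<circ>\<^sub>m theta n) = T1 n"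
    using th by (auto simp: theta_def dom_map_comp)
  have ht: "theta n x = Some v" if "theta_inv v = Some x" for x v
  proof -
    have "v \<in> \<V>1 n" using that by (auto simp: theta_inv_def split: if_splits)
    then obtain y where "y \<in> T1 n" "v = V1 n y" by (auto simp: \<V>1_def)
    then show ?thesis using th[of y] that by (simp add: theta_def)
  qed
  have d2: "\<V>1 n \<inter> dom (theta n \<circ>\<^sub>m theta_inv) = \<V>1 n"
  proof -
    have "v \<in> dom (theta n \<circ>\<^sub>m theta_inv)" if v: "v \<in> \<V>1 n" for v
    proof -
      obtain x where "theta_inv v = Some x" using v theta_dom(2) by blast
      then show ?thesis using ht by (auto simp: dom_map_comp)
    qed
    then show ?thesis by blast
  qed
  show "rat_eq {2..2*n-1} (T1 n) (theta_inv \<circ>\<^sub>m theta n) Some"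
    by (rule rat_eqI[OF irred_T1[OF n]])
      (use d1 ne o th in \<open>auto simp: theta_def map_comp_Some_iff dom_def[of Some] split: if_splits\<close>)
  show "rat_eq (W_basis n) (\<V>1 n) (theta n \<circ>\<^sub>m theta_inv) Some"
    by (rule rat_eqI[OF irred_V1[OF n]])
      (use d2 ne o ht in \<open>auto simp: map_comp_Some_iff dom_def[of Some]\<close>)
qed

text \<open>Two descriptions of the same values are combined: \<open>h\<close> in minors gives
  regularity, \<phi> in coordinates gives positivity.\<close>

lemma data_positive:
  fixes f :: "wvec \<rightharpoonup> complex"
  assumes "i \<le> n"
    and f: "\<And>M. generic1 n M \<Longrightarrow> f (point1 n M) =
      (if i = 0 \<and> (\<exists>k\<in>{1..<n}. minor M k n = 0) then None else Some (h M))"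
    and ne: "dom f \<noteq> {}" "dom f \<subseteq> \<V>1 n"
    and h: "(\<lambda>x. h (frame1 n x)) \<in> quot_funs {2..2*n-1} (T1 n)"
    and pos: "\<exists>\<phi>. pos_on {2..2*n-1} \<phi> \<and> (\<forall>x\<in>T1 n. \<forall>a. f (V1 n x) = Some a \<longrightarrow> a = \<phi> x)"
  shows "positive_function {2..2*n-1} (f \<circ>\<^sub>m theta n)"
proof -
  let ?F = "f \<circ>\<^sub>m theta n"
  have F: "?F x = (if i = 0 \<and> (\<exists>k\<in>{1..<n}. minor (frame1 n x) k n = 0) then None else Some (h (frame1 n x)))"
    if "x \<in> T1 n" for x
    using that f[OF frame1_chart(1)[OF n that]] frame1_chart(3)[OF n that] by (simp add: theta_def)
  have d: "dom ?F = {x \<in> T1 n. \<forall>k\<in>{k\<in>{1..<n}. i = 0}. minor (frame1 n x) k n \<noteq> 0}"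
  proof (rule set_eqI)
    fix x
    show "x \<in> dom ?F \<longleftrightarrow> x \<in> {x \<in> T1 n. \<forall>k\<in>{k\<in>{1..<n}. i = 0}. minor (frame1 n x) k n \<noteq> 0}"
    proof (cases "x \<in> T1 n")
      case True
      then show ?thesis by (auto simp: F domIff)
    qed (auto simp: dom_map_comp theta_def)
  qed
  have o: "ropen {2..2*n-1} (T1 n) (dom ?F)"
    unfolding d by (intro ropen_Ball ropen_nonzero reg_minor reg_frame1[OF n] T1_sub[OF n] ropen_self) auto
  obtain v where v: "v \<in> dom f" "v \<in> \<V>1 n" using ne by blast
  then obtain x where "x \<in> T1 n" "v = V1 n x" by (auto simp: \<V>1_def)
  then have "x \<in> dom ?F" using v by (auto simp: dom_map_comp theta_def)
  then have ne': "dom ?F \<noteq> {}" by blast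
  have sub: "dom ?F \<subseteq> T1 n" by (auto simp: d)
  have "rational_function {2..2*n-1} (T1 n) ?F"
  proof (rule rational_functionI[OF T1_sub[OF n] o ne'])
    show "(\<lambda>x. the (?F x)) \<in> quot_funs {2..2*n-1} (dom ?F)"
    proof (rule quot_funs_cong[OF quot_funs_mono[OF h sub]])
      fix x assume x: "x \<in> dom ?F"
      then have "x \<in> T1 n" "?F x \<noteq> None" using sub by blast+
      then show "h (frame1 n x) = the (?F x)" by (auto simp: F split: if_splits)
    qed
  qed
  moreover obtain \<phi> where \<phi>: "pos_on {2..2*n-1} \<phi>" "\<forall>x\<in>T1 n. \<forall>a. f (V1 n x) = Some a \<longrightarrow> a = \<phi> x"
    using pos by blast
  ultimately show ?thesis
    by (intro positive_functionI[where f = \<phi>])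
      (auto simp: torus_K[unfolded One_nat_def] map_comp_Some_iff theta_def split: if_splits)
qed

lemma gamma_positive:
  assumes "i \<le> n"
  shows "positive_function {2..2*n-1} (aff_\<gamma> n i \<circ>\<^sub>m theta n)"
proof (rule data_positive[OF assms aff_gamma_point1[OF n _ assms] _ _ _ pos_gamma[OF assms]])
  show "(\<lambda>x. gamma_conf n i (frame1 n x)) \<in> quot_funs {2..2*n-1} (T1 n)"
    unfolding gamma_conf_def[OF n] power2_eq_square
    using assms cyc_minor_nz[OF n frame1_chart(1)[OF n]]
    by (intro quot_funs_divide quot_funs_mult reg_cyc_minor[OF n] reg_frame1[OF n]) auto
qed (assumption | rule aff_gamma_rational(3)[OF n assms] ropen_subset[OF aff_gamma_rational(2)[OF n assms]])+

lemma epsilon_positive: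
  assumes "i \<le> n"
  shows "positive_function {2..2*n-1} (aff_\<epsilon> n i \<circ>\<^sub>m theta n)"
proof (rule data_positive[OF assms aff_epsilon_point1[OF n _ assms] _ _ _ pos_epsilon[OF assms]])
  show "(\<lambda>x. eps_conf n i (frame1 n x)) \<in> quot_funs {2..2*n-1} (T1 n)"
    unfolding eps_conf_def[OF n]
    using assms step_minor_nz[OF n frame1_chart(1)[OF n]]
    by (intro quot_funs_divide quot_funs_mult quot_funs_const reg_minor reg_frame1[OF n]) auto
qed (assumption | rule aff_epsilon_rational(3)[OF n assms] ropen_subset[OF aff_epsilon_rational(2)[OF n assms]])+

text \<open>Rationality comes from the configuration formula, whose domain is known exactly, and
  positivity from \<open>coord_step\<close>, which agrees with it on that domain.\<close>

lemma action_positive: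
  assumes i: "i \<le> n"
  shows "positive_map (opt_index {2..2*n-1}) {2..2*n-1} (joint_map (\<lambda>c. theta_inv \<circ>\<^sub>m aff_e n i c \<circ>\<^sub>m theta n))"
proof -
  let ?G = "joint_map (\<lambda>c. theta_inv \<circ>\<^sub>m aff_e n i c \<circ>\<^sub>m theta n)"
  let ?N = "\<lambda>t. col_action n i (t None) (frame1 n (t \<circ> Some))"
  define D where "D = {t \<in> torus (opt_index {2..2*n-1}). aff_dom n i (t None) (frame1 n (t \<circ> Some))}"
  have sub: "torus (opt_index {2..2*n-1}) \<subseteq> aff_space (opt_index {2..2*n-1})" by (auto simp: torus_def)
  have G_in: "?G t = Some (coords1 n (?N t))" if "t \<in> D" for t
  proof -
    have t: "t None \<noteq> 0" "t \<circ> Some \<in> T1 n" and d: "aff_dom n i (t None) (frame1 n (t \<circ> Some))"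
      using that by (auto simp: D_def torus_opt_iff[unfolded One_nat_def])
    have g: "generic1 n (?N t)" using d by (simp add: aff_dom_def[OF n])
    then have V: "point1 n (?N t) \<in> \<V>1 n" by (auto simp: \<V>1_eq[OF n])
    have "aff_e n i (t None) (V1 n (t \<circ> Some)) = Some (point1 n (?N t))"
      using aff_e_V1[OF t(2,1) i] d by (simp add: aff_dom_def[OF n])
    then show ?thesis using t V params1_point1[OF n g] by (simp add: joint_map_def theta_def theta_inv_def)
  qed
  have G_out: "?G t = None" if "t \<notin> D" for t
  proof (cases "t \<circ> Some \<in> T1 n \<and> t None \<noteq> 0")
    case True
    then have "\<not> aff_dom n i (t None) (frame1 n (t \<circ> Some))" using that by (auto simp: D_def torus_opt_iff[unfolded One_nat_def])
    then have "aff_e n i (t None) (V1 n (t \<circ> Some)) = None"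
      using aff_e_V1[OF _ _ i, of "t \<circ> Some" "t None"] True by (auto simp: aff_dom_def[OF n])
    then show ?thesis using True by (simp add: joint_map_def theta_def map_comp_def)
  next
    case False
    then consider "t None = 0" | "t \<circ> Some \<notin> T1 n" by blast
    then show ?thesis
    proof cases
      case 1
      then have "aff_e n i (t None) v = None" for v using aff_e_None[OF n, of v "t None" i] by blast
      then show ?thesis by (simp add: joint_map_def map_comp_def split: option.split)
    next
      case 2
      then show ?thesis by (simp add: joint_map_def theta_def)
    qed
  qed
  have dG: "dom ?G = D"
  proof (rule set_eqI)
    fix t show "t \<in> dom ?G \<longleftrightarrow> t \<in> D"
      unfolding domIff using G_in[of t] G_out[of t] by (cases "t \<in> D") simp_all
  qed
  have "reg_conf (opt_index {2..2*n-1}) (torus (opt_index {2..2*n-1})) (\<lambda>t. frame1 n (t \<circ> Some))"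
    by (rule reg_conf_compose[OF n reg_frame1[OF n]])
      (auto simp: torus_opt_iff[unfolded One_nat_def] comp_def intro: quot_funs_coord[OF sub[unfolded One_nat_def]])
  note fam = action_family[OF n sub this quot_funs_coord[OF sub, of None], of i, folded D_def]
  \<comment> \<open>A point with group element 1 shows that the joint domain is nonempty.\<close>
  obtain v where v: "v \<in> dom (aff_e n i 1)" using exists_act[OF n, of 1 i] i by auto
  have "v \<in> \<V>1 n"
    using ropen_subset[OF aff_e_slice(3)[OF n one_neq_zero i]] v by (rule subsetD)
  then obtain x where x: "x \<in> T1 n" "v = V1 n x" by (auto simp: \<V>1_def)
  then have "aff_dom n i 1 (frame1 n x)"
    using v aff_e_V1[OF x(1) _ i, of 1] by (auto simp: aff_dom_def[OF n] split: if_splits)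
  then have "case_option 1 x \<in> D" using x(1) by (simp add: D_def torus_opt_iff[unfolded One_nat_def] comp_def)
  then have ne: "D \<noteq> {}" by blast
  have gN: "generic1 n (?N t)" if "t \<in> D" for t using that by (simp add: D_def aff_dom_def[OF n])
  have q: "(\<lambda>t. coords1 n (?N t) k) \<in> quot_funs (opt_index {2..2*n-1}) D" for k
    using generic1_nz(1)[OF n gN] by (intro reg_coords1 fam(2)) auto
  have T: "coords1 n (?N t) \<in> T1 n" if "t \<in> D" for t by (rule coords1_chart(1)[OF n gN[OF that]])
  have "rational_map (opt_index {2..2*n-1}) (torus (opt_index {2..2*n-1})) {2..2*n-1} (torus {2..2*n-1}) ?G"
  proof (rule rational_mapI[OF sub])
    show "ran ?G \<subseteq> torus {2..2*n-1}" 
    proof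
      fix y assume "y \<in> ran ?G"
      then obtain t where t: "?G t = Some y" unfolding ran_def by blast
      then have "t \<in> dom ?G" by (simp add: domIff)
      then have "t \<in> D" unfolding dG .
      then show "y \<in> torus {2..2*n-1}" unfolding torus_K using t G_in[of t] T[of t] by simp
    qed
    show "(\<lambda>t. the (?G t) k) \<in> quot_funs (opt_index {2..2*n-1}) (dom ?G)" for k
      unfolding dG by (rule quot_funs_cong[OF q]) (simp add: G_in)
  qed (unfold dG, (rule fam(1) ne)+)
  moreover have "positive_function (opt_index {2..2*n-1}) (\<lambda>t. map_option (character {2..2*n-1} m) (?G t))" for m
  proof (rule positive_functionI[OF finite_opt, where f = "\<lambda>t. character {2..2*n-1} m (coord_step i (t None) (t \<circ> Some))"])
    let ?H = "\<lambda>t. map_option (character {2..2*n-1} m) (?G t)"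
    have dH: "dom ?H = D"
    proof (rule set_eqI)
      fix t show "t \<in> dom ?H \<longleftrightarrow> t \<in> D"
        unfolding domIff using G_in[of t] G_out[of t] by (cases "t \<in> D") simp_all
    qed
    show "rational_function (opt_index {2..2*n-1}) (torus (opt_index {2..2*n-1})) ?H"
    proof (rule rational_functionI[OF sub])
      have "(\<lambda>t. character {2..2*n-1} m (coords1 n (?N t))) \<in> quot_funs (opt_index {2..2*n-1}) D"
        unfolding character_def using T by (intro quot_funs_prod quot_funs_power_int q) (auto simp: T1_def torus_def)
      then show "(\<lambda>t. the (?H t)) \<in> quot_funs (opt_index {2..2*n-1}) (dom ?H)"
        unfolding dH by (rule quot_funs_cong) (simp add: G_in)
    qed (unfold dH, (rule fam(1) ne)+)
    show "pos_on (opt_index {2..2*n-1}) (\<lambda>t. character {2..2*n-1} m (coord_step i (t None) (t \<circ> Some)))"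
      unfolding character_def by (intro pos_on_prod pos_on_power_int pos_coord_step i)
    fix t a assume t: "t \<in> torus (opt_index {2..2*n-1})" "?H t = Some a"
    then have "t \<in> D" using dH by blast
    then have "aff_e n i (t None) (V1 n (t \<circ> Some)) \<noteq> None" "t None \<noteq> 0" "t \<circ> Some \<in> T1 n"
      using aff_e_V1[OF _ _ i, of "t \<circ> Some" "t None"] by (auto simp: D_def torus_opt_iff[unfolded One_nat_def] aff_dom_def[OF n])
    then have "coords1 n (?N t) = coord_step i (t None) (t \<circ> Some)" using aff_e_coord_step[OF _ _ i] by blast
    then show "a = character {2..2*n-1} m (coord_step i (t None) (t \<circ> Some))" using t(2) G_in[OF \<open>t \<in> D\<close>] by simp
  qed
  ultimately show ?thesis unfolding positive_map_def by blast
qed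

theorem aff_positive_structure:
  "positive_structure {0..n} (W_basis n) (\<V>1 n) (aff_e n) (aff_\<gamma> n) (aff_\<epsilon> n) {2..2*n-1} (theta n)"
  unfolding positive_structure_def
  using theta_birational gamma_positive epsilon_positive action_positive by (intro conjI exI[of _ theta_inv]) auto

end

theorem theorem4p3:
  fixes n :: nat
  assumes "n \<ge> 2"
  shows "geometric_crystal {0..n} (cartan n) (W_basis n) (\<V>1 n) (aff_e n) (aff_\<gamma> n) (aff_\<epsilon> n)
    \<and> positive_structure {0..n} (W_basis n) (\<V>1 n) (aff_e n) (aff_\<gamma> n) (aff_\<epsilon> n)
        {2..2*n-1} (theta n)
    \<and> (\<forall>x\<in>T1 n. \<forall>c. c \<noteq> 0 \<longrightarrow>
         aff_e n 1 c (V1 n x) = Some (V1 n (x(n+1 := c * x (n+1))))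
       \<and> (\<forall>i\<in>{2..n-1}.
            let p = x i * x (n+i); q = x (i+1) * x (n+i-1); ci = c * (p + q) / (c * p + q) in
            p + q \<noteq> 0 \<longrightarrow> c * p + q \<noteq> 0 \<longrightarrow>
            aff_e n i c (V1 n x) = Some (V1 n (x(i := ci * x i, n+i := c / ci * x (n+i)))))
       \<and> aff_e n n c (V1 n x) = Some (V1 n (x(n := c * x n))))
    \<and> (\<forall>x0\<in>T1 n. let x = x0(1 := 1, 2*n := 1) in
         aff_\<gamma> n 1 (V1 n x0) = Some ((x (n+1))^2 / (x 2 * x (n+2)))
       \<and> (\<forall>i\<in>{2..n-1}. aff_\<gamma> n i (V1 n x0) =
            Some ((x i)^2 * (x (n+i))^2 / (x (i-1) * x (i+1) * x (n+i-1) * x (n+i+1))))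
       \<and> aff_\<gamma> n n (V1 n x0) = Some ((x n)^2 / (x (n-1) * x (2*n-1)))
       \<and> aff_\<epsilon> n 1 (V1 n x0) = Some (x (n+2) / x (n+1))
       \<and> (\<forall>i\<in>{2..n-2}. aff_\<epsilon> n i (V1 n x0) =
            Some (x (n+i+1) / x (n+i)
                  + x (i+1) * x (n+i-1) * x (n+i+1) / (x i * (x (n+i))^2)))
       \<and> (n \<ge> 3 \<longrightarrow> aff_\<epsilon> n (n-1) (V1 n x0) =
            Some (1 / x (2*n-1) + x n * x (2*n-2) / (x (n-1) * (x (2*n-1))^2)))
       \<and> aff_\<epsilon> n n (V1 n x0) = Some (x (2*n-1) / x n))
    \<and> (\<forall>x\<in>T1 n. (\<forall>k\<in>{1..n-1}. (\<Sum>j=k+1..n. x j / x (n+j-1)) \<noteq> 0) \<longrightarrow>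
         aff_\<gamma> n 0 (V1 n x) = Some (1 / (x n * x (n+1)))
       \<and> aff_\<epsilon> n 0 (V1 n x) = Some (x (n+1) * (\<Sum>j=2..n. x j / x (n+j-1)))
       \<and> (\<forall>c. c \<noteq> 0 \<longrightarrow>
            (let S = (\<Sum>j=2..n. x j / x (n+j-1));
                 P = (\<lambda>k. c * (\<Sum>j=2..k. x j / x (n+j-1)) + (\<Sum>j=k+1..n. x j / x (n+j-1)))
             in (\<forall>k\<in>{2..<n}. P k \<noteq> 0) \<longrightarrow>
                aff_e n 0 c (V1 n x) = Some (V1 n (\<lambda>k.
                  if k \<in> {2..<n} then x k * (S / P k)
                  else if k = n then x n / c
                  else if k = n + 1 then x (n+1) / c
                  else if k \<in> {n+2..<2*n} then x k * (P (k-n) / (c * S))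
                  else 0)))))"
proof (intro conjI ballI allI impI)
  note n = assms
  show "geometric_crystal {0..n} (cartan n) (W_basis n) (\<V>1 n) (aff_e n) (aff_\<gamma> n) (aff_\<epsilon> n)"
    by (rule aff_geometric_crystal[OF n])
  show "positive_structure {0..n} (W_basis n) (\<V>1 n) (aff_e n) (aff_\<gamma> n) (aff_\<epsilon> n) {2..2*n-1} (theta n)"
    by (rule aff_positive_structure[OF n])
  fix x assume x: "x \<in> T1 n"
  show "aff_e n 1 c (V1 n x) = Some (V1 n (x(n+1 := c * x (n+1))))" if "c \<noteq> 0" for c
    using e1_first[OF n x that] by (simp add: aff_e_def)
  show "aff_e n n c (V1 n x) = Some (V1 n (x(n := c * x n)))" if "c \<noteq> 0" for c
    using e1_last[OF n x that] n by (simp add: aff_e_def)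
  show "let p = x i * x (n+i); q = x (i+1) * x (n+i-1); ci = c * (p + q) / (c * p + q) in
      p + q \<noteq> 0 \<longrightarrow> c * p + q \<noteq> 0 \<longrightarrow>
      aff_e n i c (V1 n x) = Some (V1 n (x(i := ci * x i, n+i := c / ci * x (n+i))))"
    if "c \<noteq> 0" "i \<in> {2..n-1}" for c i
  proof -
    have i: "2 \<le> i" "i < n" using that(2) n by auto
    have ae: "aff_e n i c = e1 n i c" using i by (simp add: aff_e_def)
    show ?thesis
      unfolding Let_def ae
      by (intro impI, subst e1_middle[OF n x that(1) i], rule if_P) blast
  qed
  show "let x' = x(1 := 1, 2*n := 1) in
         aff_\<gamma> n 1 (V1 n x) = Some ((x' (n+1))^2 / (x' 2 * x' (n+2)))
       \<and> (\<forall>i\<in>{2..n-1}. aff_\<gamma> n i (V1 n x) =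
            Some ((x' i)^2 * (x' (n+i))^2 / (x' (i-1) * x' (i+1) * x' (n+i-1) * x' (n+i+1))))
       \<and> aff_\<gamma> n n (V1 n x) = Some ((x' n)^2 / (x' (n-1) * x' (2*n-1)))
       \<and> aff_\<epsilon> n 1 (V1 n x) = Some (x' (n+2) / x' (n+1))
       \<and> (\<forall>i\<in>{2..n-2}. aff_\<epsilon> n i (V1 n x) =
            Some (x' (n+i+1) / x' (n+i)
                  + x' (i+1) * x' (n+i-1) * x' (n+i+1) / (x' i * (x' (n+i))^2)))
       \<and> (n \<ge> 3 \<longrightarrow> aff_\<epsilon> n (n-1) (V1 n x) =
            Some (1 / x' (2*n-1) + x' n * x' (2*n-2) / (x' (n-1) * (x' (2*n-1))^2)))
       \<and> aff_\<epsilon> n n (V1 n x) = Some (x' (2*n-1) / x' n)"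
    unfolding Let_def pad_def[OF n, symmetric]
  proof (intro conjI ballI impI)
    have g: "aff_\<gamma> n i = \<gamma>1 n i" "aff_\<epsilon> n i = \<epsilon>1 n i" if "i \<noteq> 0" for i
      using that by (simp_all add: aff_\<gamma>_def aff_\<epsilon>_def)
    have n0: "n \<noteq> 0" "n - 1 \<noteq> 0" using n by auto
    show "aff_\<gamma> n 1 (V1 n x) = Some ((pad n x (n+1))^2 / (pad n x 2 * pad n x (n+2)))"
      unfolding g(1)[OF one_neq_zero] by (rule gamma1_explicit(1)[OF n x])
    show "aff_\<gamma> n n (V1 n x) = Some ((pad n x n)^2 / (pad n x (n-1) * pad n x (2*n-1)))"
      unfolding g(1)[OF n0(1)] by (rule gamma1_explicit(3)[OF n x])
    show "aff_\<epsilon> n 1 (V1 n x) = Some (pad n x (n+2) / pad n x (n+1))"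
      unfolding g(2)[OF one_neq_zero] by (rule epsilon1_explicit(1)[OF n x])
    show "aff_\<epsilon> n n (V1 n x) = Some (pad n x (2*n-1) / pad n x n)"
      unfolding g(2)[OF n0(1)] by (rule epsilon1_explicit(3)[OF n x])
    fix i
    show "aff_\<gamma> n i (V1 n x) = Some ((pad n x i)^2 * (pad n x (n+i))^2 /
        (pad n x (i-1) * pad n x (i+1) * pad n x (n+i-1) * pad n x (n+i+1)))" if "i \<in> {2..n-1}"
    proof -
      have i: "2 \<le> i" "i < n" "i \<noteq> 0" using that n by auto
      show ?thesis unfolding g(1)[OF i(3)] by (rule gamma1_explicit(2)[OF n x i(1,2)])
    qed
    show "aff_\<epsilon> n i (V1 n x) = Some (pad n x (n+i+1) / pad n x (n+i)
        + pad n x (i+1) * pad n x (n+i-1) * pad n x (n+i+1) / (pad n x i * (pad n x (n+i))^2))"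
      if "i \<in> {2..n-2}"
    proof -
      have i: "2 \<le> i" "i < n" "i \<noteq> 0" using that n by auto
      show ?thesis unfolding g(2)[OF i(3)] by (rule epsilon1_explicit(2)[OF n x i(1,2)])
    qed
    \<comment> \<open>The case \<open>i = n - 1\<close> is the interior formula with x_{2n} read as
      1.\<close>
    assume "n \<ge> 3"
    then have i: "2 \<le> n - 1" "n - 1 < n"
      and idx: "n + (n - 1) + 1 = 2 * n" "n + (n - 1) = 2 * n - 1" "n + (n - 1) - 1 = 2 * n - 2"
        "n - 1 + 1 = n" by auto
    have idx2: "2 * n - 1 + 1 = 2 * n" "2 * n - 1 - 1 = 2 * n - 2" using n by linarith+
    have "pad n x (2 * n) = 1" by (simp add: pad_def[OF n])
    then show "aff_\<epsilon> n (n-1) (V1 n x) =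
        Some (1 / pad n x (2*n-1) + pad n x n * pad n x (2*n-2) / (pad n x (n-1) * (pad n x (2*n-1))^2))"
      using epsilon1_explicit(2)[OF n x i, unfolded idx idx2] unfolding g(2)[OF n0(2)] by simp
  qed
  assume tails: "\<forall>k\<in>{1..n-1}. (\<Sum>j=k+1..n. x j / x (n+j-1)) \<noteq> 0"
  then have t: "\<forall>k\<in>{1..n-1}. ratio_sum n x (k + 1) n \<noteq> 0" by (simp add: ratio_sum_def[OF n])
  show "aff_\<gamma> n 0 (V1 n x) = Some (1 / (x n * x (n+1)))"
    by (rule gamma_zero_explicit(1)[OF n x t])
  show "aff_\<epsilon> n 0 (V1 n x) = Some (x (n+1) * (\<Sum>j=2..n. x j / x (n+j-1)))"
    using gamma_zero_explicit(2)[OF n x t] by (simp add: ratio_sum_def[OF n])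
  fix c :: complex assume c: "c \<noteq> 0"
  show "let S = (\<Sum>j=2..n. x j / x (n+j-1));
            P = (\<lambda>k. c * (\<Sum>j=2..k. x j / x (n+j-1)) + (\<Sum>j=k+1..n. x j / x (n+j-1)))
        in (\<forall>k\<in>{2..<n}. P k \<noteq> 0) \<longrightarrow>
           aff_e n 0 c (V1 n x) = Some (V1 n (\<lambda>k.
             if k \<in> {2..<n} then x k * (S / P k)
             else if k = n then x n / c
             else if k = n + 1 then x (n+1) / c
             else if k \<in> {n+2..<2*n} then x k * (P (k-n) / (c * S))
             else 0))"
    using aff_e_zero_explicit[OF n x c t]
    unfolding zero_step_def[OF n] mixed_sum_def[OF n] ratio_sum_def[OF n] Let_def by blast
qed

end
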